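(* Let $\beta>0$, $\mathbb{S}_\beta=\{z\in\mathbb{C}:0<\operatorname{Im}z<\beta\}$, and let $H^\infty(\mathbb{S}_\beta)$ be equipped with the involution $f^\sharp(z)=\overline{f(\beta i+\overline z)}$. The functions $g_t(z)=e^{t\beta/2}e^{itz}$, $t\in\mathbb{R}$, define a unitary one-parameter group of the Banach $*$-algebra $(H^\infty(\mathbb{S}_\beta),\sharp)$ (that is, $g_tg_s=g_{t+s}$ and $g_t^\sharp=g_{-t}=g_t^{-1}$). It has the following properties: (a) Its range spans a weakly dense $*$-subalgebra, and $\|g_t\|=e^{|t|\beta/2}$ for $t\in\mathbb{R}$. (b) Every weakly continuous state $\omega$ of $H^\infty(\mathbb{S}_\beta)$ is represented by a probability measure $\mu$ on the fixed point set $\frac{\beta i}{2}+\mathbb{R}$ of $\sigma(z)=\beta i+\overline z$ (identified with $\mathbb{R}$) via $$\omega(F)=\omega_\mu(F)=\int_{\mathbb{R}}F\Big(\frac{\beta i}{2}+x\Big)\,d\mu(x)\quad\text{ for } F\in H^\infty(\mathbb{S}_\beta),$$ and satisfies $$\omega_\mu(g_t)=\widehat\mu(t)=\int_{\mathbb{R}}e^{it\lambda}\,d\mu(\lambda)\quad\text{ for } t\in\mathbb{R}.$$ All continuous normalized positive definite functions on $\mathbb{R}$ are of this form.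
   Context: $H^\infty(\mathbb{S}_\beta)$ is the Banach algebra of bounded holomorphic functions on $\mathbb{S}_\beta$ with the sup norm; the weak topology is the weak-$*$ topology from its unique predual. A state is a linear functional $\omega$ with $\omega(f^\sharp f)\ge0$ for all $f$ and $\omega(1)=1$. A positive definite function $\varphi$ on $\mathbb{R}$ is normalized if $\varphi(0)=1$. *)

theory Defs
  imports
    "HOL-Complex_Analysis.Complex_Analysis"
    "HOL-Probability.Probability"
begin

section \<open>Normed spaces of complex-valued functions, preduals and weak topologies\<close>

text \<open>
  Throughout, a complex vector space is a set \<open>V\<close> of complex-valued functions closed under the
  pointwise operations, with a norm \<open>N\<close>.  Functionals on \<open>V\<close> are normalised to vanish outside
  \<open>V\<close>, so that they are again complex-valued functions and the same notions apply to spaces of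
  functionals.
\<close>

definition is_subspace :: "('a \<Rightarrow> complex) set \<Rightarrow> bool" where
  "is_subspace V \<longleftrightarrow> (\<lambda>x. 0) \<in> V \<and>
     (\<forall>u\<in>V. \<forall>v\<in>V. (\<lambda>x. u x + v x) \<in> V) \<and> (\<forall>c. \<forall>u\<in>V. (\<lambda>x. c * u x) \<in> V)"

definition cspan :: "('a \<Rightarrow> complex) set \<Rightarrow> ('a \<Rightarrow> complex) set" where
  "cspan S = {(\<lambda>x. \<Sum>u\<in>T. c u * u x) | T c. finite T \<and> T \<subseteq> S}"

definition is_linear_on :: "('a \<Rightarrow> complex) set \<Rightarrow> (('a \<Rightarrow> complex) \<Rightarrow> complex) \<Rightarrow> bool" where
  "is_linear_on V \<phi> \<longleftrightarrow>
     (\<forall>u\<in>V. \<forall>v\<in>V. \<phi> (\<lambda>x. u x + v x) = \<phi> u + \<phi> v) \<and> (\<forall>c. \<forall>u\<in>V. \<phi> (\<lambda>x. c * u x) = c * \<phi> u)"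

definition dual_of ::
  "('a \<Rightarrow> complex) set \<Rightarrow> (('a \<Rightarrow> complex) \<Rightarrow> real) \<Rightarrow> (('a \<Rightarrow> complex) \<Rightarrow> complex) set" where
  "dual_of V N = {\<phi>. is_linear_on V \<phi> \<and> (\<exists>C. \<forall>u\<in>V. cmod (\<phi> u) \<le> C * N u) \<and> (\<forall>u. u \<notin> V \<longrightarrow> \<phi> u = 0)}"

definition dual_norm ::
  "('a \<Rightarrow> complex) set \<Rightarrow> (('a \<Rightarrow> complex) \<Rightarrow> real) \<Rightarrow> (('a \<Rightarrow> complex) \<Rightarrow> complex) \<Rightarrow> real" where
  "dual_norm V N \<phi> = (SUP u\<in>{u\<in>V. N u \<le> 1}. cmod (\<phi> u))"

definition eval_on :: "('a \<Rightarrow> complex) set \<Rightarrow> 'a \<Rightarrow> ('a \<Rightarrow> complex) \<Rightarrow> complex" where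
  "eval_on V x = (\<lambda>u. if u \<in> V then u x else 0)"

definition norm_closure_in_dual ::
  "('a \<Rightarrow> complex) set \<Rightarrow> (('a \<Rightarrow> complex) \<Rightarrow> real)
    \<Rightarrow> (('a \<Rightarrow> complex) \<Rightarrow> complex) set \<Rightarrow> (('a \<Rightarrow> complex) \<Rightarrow> complex) set" where
  "norm_closure_in_dual V N Y =
     {\<phi>\<in>dual_of V N. \<forall>\<epsilon>>0. \<exists>\<psi>\<in>Y. dual_norm V N (\<lambda>u. \<phi> u - \<psi> u) < \<epsilon>}"

text \<open>
  A predual of \<open>V\<close>, realised inside the dual of \<open>V\<close>: a norm-closed subspace \<open>Y\<close> of the dual such that
  the canonical map from \<open>V\<close> to the dual of \<open>Y\<close> is a surjective isometry.
\<close>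

definition is_predual ::
  "('a \<Rightarrow> complex) set \<Rightarrow> (('a \<Rightarrow> complex) \<Rightarrow> real) \<Rightarrow> (('a \<Rightarrow> complex) \<Rightarrow> complex) set \<Rightarrow> bool" where
  "is_predual V N Y \<longleftrightarrow>
     Y \<subseteq> dual_of V N \<and> is_subspace Y \<and> norm_closure_in_dual V N Y \<subseteq> Y \<and>
     bij_betw (eval_on Y) V (dual_of Y (dual_norm V N)) \<and>
     (\<forall>f\<in>V. dual_norm Y (dual_norm V N) (eval_on Y f) = N f)"

definition weak_topology ::
  "('a \<Rightarrow> complex) set \<Rightarrow> (('a \<Rightarrow> complex) \<Rightarrow> complex) set \<Rightarrow> ('a \<Rightarrow> complex) topology" where
  "weak_topology V Y = topology_generated_by {{f\<in>V. \<phi> f \<in> U} | \<phi> U. \<phi> \<in> Y \<and> open U}"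

section \<open>Bounded holomorphic functions on a strip\<close>

definition strip :: "real \<Rightarrow> complex set" where
  "strip \<beta> = {z. 0 < Im z \<and> Im z < \<beta>}"

definition strip_refl :: "real \<Rightarrow> complex \<Rightarrow> complex" where
  "strip_refl \<beta> z = of_real \<beta> * \<i> + cnj z"

text \<open>Elements are extended by 0 off the strip, so that equality of functions is equality on the strip.\<close>

definition Hinf :: "real \<Rightarrow> (complex \<Rightarrow> complex) set" where
  "Hinf \<beta> = {f. f holomorphic_on strip \<beta> \<and> bounded (f ` strip \<beta>) \<and> (\<forall>z. z \<notin> strip \<beta> \<longrightarrow> f z = 0)}"

definition Hinf_norm :: "real \<Rightarrow> (complex \<Rightarrow> complex) \<Rightarrow> real" where
  "Hinf_norm \<beta> f = (SUP z\<in>strip \<beta>. cmod (f z))"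

definition Hinf_one :: "real \<Rightarrow> complex \<Rightarrow> complex" where
  "Hinf_one \<beta> z = (if z \<in> strip \<beta> then 1 else 0)"

definition Hinf_mult :: "(complex \<Rightarrow> complex) \<Rightarrow> (complex \<Rightarrow> complex) \<Rightarrow> complex \<Rightarrow> complex" where
  "Hinf_mult f g = (\<lambda>z. f z * g z)"

definition Hinf_star :: "real \<Rightarrow> (complex \<Rightarrow> complex) \<Rightarrow> complex \<Rightarrow> complex" where
  "Hinf_star \<beta> f = (\<lambda>z. cnj (f (strip_refl \<beta> z)))"

definition Hinf_star_subalgebra :: "real \<Rightarrow> (complex \<Rightarrow> complex) set \<Rightarrow> bool" where
  "Hinf_star_subalgebra \<beta> A \<longleftrightarrow>
     A \<subseteq> Hinf \<beta> \<and> is_subspace A \<and> (\<forall>f\<in>A. \<forall>g\<in>A. Hinf_mult f g \<in> A) \<and> (\<forall>f\<in>A. Hinf_star \<beta> f \<in> A)"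

text \<open>
  By Ando's theorem, bounded holomorphic functions on the strip have exactly one predual.  It is the
  norm-closed span of the point evaluations (the same subspace of the dual as the functionals
  \<open>f \<mapsto> \<integral> f h\<close> with \<open>h\<close> integrable over the strip); lemma \<open>is_predual_Hinf_predual\<close> below proves
  that it is indeed a predual.
\<close>

definition Hinf_predual :: "real \<Rightarrow> ((complex \<Rightarrow> complex) \<Rightarrow> complex) set" where
  "Hinf_predual \<beta> =
     norm_closure_in_dual (Hinf \<beta>) (Hinf_norm \<beta>) (cspan (eval_on (Hinf \<beta>) ` strip \<beta>))"

definition Hinf_weak :: "real \<Rightarrow> (complex \<Rightarrow> complex) topology" where
  "Hinf_weak \<beta> = weak_topology (Hinf \<beta>) (Hinf_predual \<beta>)"

definition Hinf_state :: "real \<Rightarrow> ((complex \<Rightarrow> complex) \<Rightarrow> complex) \<Rightarrow> bool" where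
  "Hinf_state \<beta> \<omega> \<longleftrightarrow>
     is_linear_on (Hinf \<beta>) \<omega> \<and>
     (\<forall>f\<in>Hinf \<beta>. \<omega> (Hinf_mult (Hinf_star \<beta> f) f) \<in> \<real>\<^sub>\<ge>\<^sub>0) \<and> \<omega> (Hinf_one \<beta>) = 1"

definition Hinf_g :: "real \<Rightarrow> real \<Rightarrow> complex \<Rightarrow> complex" where
  "Hinf_g \<beta> t z =
     (if z \<in> strip \<beta> then of_real (exp (t * \<beta> / 2)) * exp (\<i> * of_real t * z) else 0)"

definition midline_functional :: "real \<Rightarrow> real measure \<Rightarrow> (complex \<Rightarrow> complex) \<Rightarrow> complex" where
  "midline_functional \<beta> \<mu> F = (\<integral>x. F (of_real \<beta> * \<i> / 2 + of_real x) \<partial>\<mu>)"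

definition positive_definite :: "(real \<Rightarrow> complex) \<Rightarrow> bool" where
  "positive_definite \<phi> \<longleftrightarrow>
     (\<forall>(n::nat) (t :: nat \<Rightarrow> real) (c :: nat \<Rightarrow> complex).
        (\<Sum>j<n. \<Sum>k<n. c j * cnj (c k) * \<phi> (t j - t k)) \<in> \<real>\<^sub>\<ge>\<^sub>0)"

section \<open>The chosen predual is a predual\<close>

lemma is_subspaceD:
  assumes "is_subspace V"
  shows "(\<lambda>x. 0) \<in> V" "\<And>u v. u \<in> V \<Longrightarrow> v \<in> V \<Longrightarrow> (\<lambda>x. u x + v x) \<in> V"
    "\<And>c u. u \<in> V \<Longrightarrow> (\<lambda>x. c * u x) \<in> V"
  using assms unfolding is_subspace_def by auto

lemma is_subspace_diff:
  assumes "is_subspace V" "u \<in> V" "v \<in> V"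
  shows "(\<lambda>x. u x - v x) \<in> V"
  using is_subspaceD(2)[OF assms(1) assms(2) is_subspaceD(3)[OF assms(1) assms(3), of "-1"]] by simp

lemma is_linear_onD:
  assumes "is_linear_on V \<phi>"
  shows "\<And>u v. u \<in> V \<Longrightarrow> v \<in> V \<Longrightarrow> \<phi> (\<lambda>x. u x + v x) = \<phi> u + \<phi> v"
    "\<And>c u. u \<in> V \<Longrightarrow> \<phi> (\<lambda>x. c * u x) = c * \<phi> u"
  using assms unfolding is_linear_on_def by auto

lemma is_linear_on_zero:
  assumes "is_subspace V" "is_linear_on V \<phi>"
  shows "\<phi> (\<lambda>x. 0) = 0"
proof -
  show ?thesis
    using is_linear_onD(2)[OF assms(2) is_subspaceD(1)[OF assms(1)], of 0] by simp
qed

lemma is_linear_on_diff: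
  assumes "is_subspace V" "is_linear_on V \<phi>" "u \<in> V" "v \<in> V"
  shows "\<phi> (\<lambda>x. u x - v x) = \<phi> u - \<phi> v"
proof -
  have v: "(\<lambda>x. (-1) * v x) \<in> V" using is_subspaceD(3)[OF assms(1,4)] .
  have "\<phi> (\<lambda>x. u x + (-1) * v x) = \<phi> u + \<phi> (\<lambda>x. (-1) * v x)"
    by (rule is_linear_onD(1)[OF assms(2,3) v])
  also have "\<phi> (\<lambda>x. (-1) * v x) = (-1) * \<phi> v"
    by (rule is_linear_onD(2)[OF assms(2,4)])
  finally show ?thesis by simp
qed

lemma is_subspace_sum:
  assumes "is_subspace V" "finite T" "T \<subseteq> V"
  shows "(\<lambda>x. \<Sum>u\<in>T. c u * u x) \<in> V"
  using assms(2,3)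
proof (induction T rule: finite_induct)
  case empty
  then show ?case using is_subspaceD(1)[OF assms(1)] by simp
next
  case (insert u T)
  then show ?case
    using is_subspaceD(2)[OF assms(1) is_subspaceD(3)[OF assms(1), of u "c u"]] by simp
qed

lemma cspan_subset: "is_subspace V \<Longrightarrow> S \<subseteq> V \<Longrightarrow> cspan S \<subseteq> V"
  unfolding cspan_def using is_subspace_sum[of V] by blast

lemma cspan_base: "u \<in> S \<Longrightarrow> u \<in> cspan S"
  unfolding cspan_def by (intro CollectI exI[of _ "{u}"] exI[of _ "\<lambda>_. 1"]) auto

lemma is_subspace_cspan: "is_subspace (cspan S)"
  unfolding is_subspace_def
proof (intro conjI ballI allI)
  show "(\<lambda>x. 0) \<in> cspan S"
    unfolding cspan_def by (intro CollectI exI[of _ "{}"]) auto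
next
  fix u v assume "u \<in> cspan S" "v \<in> cspan S"
  then obtain T c T' c' where T: "u = (\<lambda>x. \<Sum>w\<in>T. c w * w x)" "finite T" "T \<subseteq> S"
     and T': "v = (\<lambda>x. \<Sum>w\<in>T'. c' w * w x)" "finite T'" "T' \<subseteq> S"
    unfolding cspan_def by blast
  have e1: "(\<Sum>w\<in>T. c w * w x) = (\<Sum>w\<in>T \<union> T'. (if w \<in> T then c w else 0) * w x)" for x
    using T(2) T'(2) by (intro sum.mono_neutral_cong_left) auto
  have e2: "(\<Sum>w\<in>T'. c' w * w x) = (\<Sum>w\<in>T \<union> T'. (if w \<in> T' then c' w else 0) * w x)" for x
    using T(2) T'(2) by (intro sum.mono_neutral_cong_left) auto
  have "(\<lambda>x. u x + v x) =
     (\<lambda>x. \<Sum>w\<in>T \<union> T'. ((if w \<in> T then c w else 0) + (if w \<in> T' then c' w else 0)) * w x)"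
    unfolding T(1) T'(1) e1 e2 by (simp add: sum.distrib distrib_right)
  then show "(\<lambda>x. u x + v x) \<in> cspan S"
    unfolding cspan_def using T T'
    by (intro CollectI exI[of _ "T \<union> T'"]
      exI[of _ "\<lambda>w. (if w \<in> T then c w else 0) + (if w \<in> T' then c' w else 0)"]) auto
next
  fix a u assume "u \<in> cspan S"
  then obtain T c where T: "u = (\<lambda>x. \<Sum>w\<in>T. c w * w x)" "finite T" "T \<subseteq> S"
    unfolding cspan_def by blast
  then show "(\<lambda>x. a * u x) \<in> cspan S"
    unfolding cspan_def
    by (intro CollectI exI[of _ T] exI[of _ "\<lambda>w. a * c w"]) (auto simp: sum_distrib_left mult.assoc)
qed

lemma open_strip: "open (strip \<beta>)"
proof -
  have "strip \<beta> = {z. 0 < Im z} \<inter> {z. Im z < \<beta>}" unfolding strip_def by auto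
  then show ?thesis by (simp add: open_Int open_halfspace_Im_gt open_halfspace_Im_lt)
qed

lemma Hinf_norm_bound:
  assumes "f \<in> Hinf \<beta>" "z \<in> strip \<beta>"
  shows "cmod (f z) \<le> Hinf_norm \<beta> f"
proof -
  have "bdd_above ((\<lambda>z. cmod (f z)) ` strip \<beta>)"
    using assms(1) unfolding Hinf_def bounded_iff bdd_above_def by auto
  then show ?thesis unfolding Hinf_norm_def using assms(2) by (rule cSUP_upper2) auto
qed

context
  fixes \<beta> :: real
  assumes beta_pos: "\<beta> > 0"
begin

private abbreviation (input) "V \<equiv> Hinf \<beta>"
private abbreviation (input) "N \<equiv> Hinf_norm \<beta>"
private abbreviation (input) "D \<equiv> dual_of (Hinf \<beta>) (Hinf_norm \<beta>)"
private abbreviation (input) "M \<equiv> dual_norm (Hinf \<beta>) (Hinf_norm \<beta>)"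
private abbreviation (input) "Y \<equiv> Hinf_predual \<beta>"
private abbreviation (input) "evl \<equiv> eval_on (Hinf \<beta>)"

private lemma mid_in_strip: "of_real (\<beta>/2) * \<i> \<in> strip \<beta>"
  using beta_pos by (simp add: strip_def)

private lemma Hinf_subspace: "is_subspace V"
  unfolding is_subspace_def
proof (intro conjI ballI allI)
  show "(\<lambda>x. 0) \<in> V" unfolding Hinf_def by (auto simp: bounded_iff)
next
  fix u v assume "u \<in> V" "v \<in> V"
  then show "(\<lambda>x. u x + v x) \<in> V"
    unfolding Hinf_def by (auto intro!: holomorphic_intros bounded_plus_comp)
next
  fix c u assume u: "u \<in> V"
  then obtain B where "\<forall>x\<in>strip \<beta>. cmod (u x) \<le> B" unfolding Hinf_def bounded_iff by auto
  then have "bounded ((\<lambda>x. c * u x) ` strip \<beta>)"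
    unfolding bounded_iff
    by (intro exI[of _ "cmod c * B"]) (auto simp: norm_mult intro!: mult_left_mono)
  then show "(\<lambda>x. c * u x) \<in> V"
    using u unfolding Hinf_def by (auto intro!: holomorphic_intros)
qed

private lemma N_le:
  assumes "\<And>z. z \<in> strip \<beta> \<Longrightarrow> cmod (f z) \<le> C"
  shows "N f \<le> C"
  unfolding Hinf_norm_def using mid_in_strip assms by (intro cSUP_least) auto

private lemma N_nonneg: "f \<in> V \<Longrightarrow> 0 \<le> N f"
  using Hinf_norm_bound[OF _ mid_in_strip, of f] norm_ge_zero order_trans by blast

private lemma N_scale_le: "f \<in> V \<Longrightarrow> N (\<lambda>x. c * f x) \<le> cmod c * N f"
  by (rule N_le) (auto simp: norm_mult intro!: mult_left_mono Hinf_norm_bound)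

private lemma N_eq_0:
  assumes "f \<in> V" "N f \<le> 0"
  shows "f = (\<lambda>x. 0)"
proof
  fix x show "f x = 0"
  proof (cases "x \<in> strip \<beta>")
    case True
    have "cmod (f x) \<le> 0"
      using Hinf_norm_bound[OF assms(1) True] assms(2) by (rule order_trans)
    then show ?thesis by simp
  qed (use assms(1) in \<open>auto simp: Hinf_def\<close>)
qed

private lemma D_bdd: "\<phi> \<in> D \<Longrightarrow> bdd_above ((\<lambda>u. cmod (\<phi> u)) ` {u\<in>V. N u \<le> 1})"
proof -
  assume "\<phi> \<in> D"
  then obtain C where C: "\<forall>u\<in>V. cmod (\<phi> u) \<le> C * N u" unfolding dual_of_def by blast
  show ?thesis
    unfolding bdd_above_def
  proof (intro exI ballI)
    fix x assume "x \<in> (\<lambda>u. cmod (\<phi> u)) ` {u\<in>V. N u \<le> 1}"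
    then obtain u where u: "u \<in> V" "N u \<le> 1" "x = cmod (\<phi> u)" by auto
    have "x \<le> C * N u" using u C by auto
    also have "\<dots> \<le> \<bar>C\<bar> * N u" using N_nonneg[OF u(1)] by (intro mult_right_mono) auto
    also have "\<dots> \<le> \<bar>C\<bar> * 1" using u by (intro mult_left_mono) auto
    finally show "x \<le> \<bar>C\<bar>" by simp
  qed
qed

private lemma M_le:
  assumes "\<And>u. u \<in> V \<Longrightarrow> N u \<le> 1 \<Longrightarrow> cmod (\<phi> u) \<le> C"
  shows "M \<phi> \<le> C"
proof -
  have "(\<lambda>x. 0) \<in> V" "N (\<lambda>x. 0) \<le> 1"
    using is_subspaceD(1)[OF Hinf_subspace] by (auto intro!: N_le)
  then show ?thesis unfolding dual_norm_def using assms by (intro cSUP_least) auto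
qed

private lemma M_bound:
  assumes "\<phi> \<in> D" "u \<in> V"
  shows "cmod (\<phi> u) \<le> M \<phi> * N u"
proof (cases "N u \<le> 0")
  case True
  have "\<phi> u = 0"
    using N_eq_0[OF assms(2) True] is_linear_on_zero[OF Hinf_subspace] assms(1)
    unfolding dual_of_def by auto
  moreover have "N u = 0" using True N_nonneg[OF assms(2)] by simp
  ultimately show ?thesis by simp
next
  case False
  define c where "c = complex_of_real (1 / N u)"
  have c: "(\<lambda>x. c * u x) \<in> V" using is_subspaceD(3)[OF Hinf_subspace assms(2)] .
  have "N (\<lambda>x. c * u x) \<le> cmod c * N u" by (rule N_scale_le[OF assms(2)])
  also have "\<dots> = 1" using False by (simp add: c_def norm_divide)
  finally have "cmod (\<phi> (\<lambda>x. c * u x)) \<le> M \<phi>"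
    unfolding dual_norm_def using c by (intro cSUP_upper[OF _ D_bdd[OF assms(1)]]) auto
  moreover have "\<phi> (\<lambda>x. c * u x) = c * \<phi> u"
    using assms unfolding dual_of_def by (auto intro: is_linear_onD(2))
  ultimately have "cmod c * cmod (\<phi> u) \<le> M \<phi>" by (simp add: norm_mult)
  then show ?thesis using False by (simp add: c_def norm_divide field_simps)
qed

private lemma M_nonneg: "\<phi> \<in> D \<Longrightarrow> 0 \<le> M \<phi>"
proof -
  assume a: "\<phi> \<in> D"
  have "(\<lambda>x. 0) \<in> V" "N (\<lambda>x. 0) \<le> 1"
    using is_subspaceD(1)[OF Hinf_subspace] by (auto intro!: N_le)
  then have "cmod (\<phi> (\<lambda>x. 0)) \<le> M \<phi>"
    unfolding dual_norm_def by (intro cSUP_upper[OF _ D_bdd[OF a]]) auto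
  then show ?thesis using norm_ge_zero order_trans by blast
qed

private lemma D_subspace: "is_subspace D"
  unfolding is_subspace_def
proof (intro conjI ballI allI)
  show "(\<lambda>x. 0) \<in> D" unfolding dual_of_def is_linear_on_def by (auto intro!: exI[of _ 0])
next
  fix u v assume u: "u \<in> D" and v: "v \<in> D"
  have "cmod (u f + v f) \<le> (M u + M v) * N f" if "f \<in> V" for f
    using norm_triangle_ineq[of "u f" "v f"] M_bound[OF u that] M_bound[OF v that]
    by (simp add: distrib_right)
  then have "\<exists>C. \<forall>f\<in>V. cmod (u f + v f) \<le> C * N f" by blast
  then show "(\<lambda>x. u x + v x) \<in> D"
    using u v unfolding dual_of_def is_linear_on_def by (simp add: algebra_simps)
next
  fix c u assume u: "u \<in> D"
  have "cmod (c * u f) \<le> (cmod c * M u) * N f" if "f \<in> V" for f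
    using mult_left_mono[OF M_bound[OF u that], of "cmod c"] by (simp add: norm_mult mult.assoc)
  then have "\<exists>C. \<forall>f\<in>V. cmod (c * u f) \<le> C * N f" by blast
  then show "(\<lambda>x. c * u x) \<in> D"
    using u unfolding dual_of_def is_linear_on_def by (simp add: algebra_simps)
qed

private lemma M_add_le: "u \<in> D \<Longrightarrow> v \<in> D \<Longrightarrow> M (\<lambda>x. u x + v x) \<le> M u + M v"
proof (rule M_le)
  fix f assume a: "u \<in> D" "v \<in> D" "f \<in> V" "N f \<le> 1"
  have "cmod (u f + v f) \<le> M u * N f + M v * N f"
    using norm_triangle_ineq[of "u f" "v f"] M_bound[OF a(1,3)] M_bound[OF a(2,3)] by simp
  also have "\<dots> \<le> M u * 1 + M v * 1"
    using a M_nonneg by (intro add_mono mult_left_mono) auto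
  finally show "cmod (u f + v f) \<le> M u + M v" by simp
qed

private lemma M_scale_le: "u \<in> D \<Longrightarrow> M (\<lambda>x. c * u x) \<le> cmod c * M u"
proof (rule M_le)
  fix f assume a: "u \<in> D" "f \<in> V" "N f \<le> 1"
  have "cmod (u f) \<le> M u * 1"
    using M_bound[OF a(1,2)] mult_left_mono[OF a(3) M_nonneg[OF a(1)]] by simp
  then show "cmod (c * u f) \<le> cmod c * M u" by (simp add: norm_mult mult_left_mono)
qed

private lemma ev_D: "z \<in> strip \<beta> \<Longrightarrow> evl z \<in> D"
  unfolding dual_of_def is_linear_on_def eval_on_def
  using is_subspaceD[OF Hinf_subspace] Hinf_norm_bound[of _ \<beta> z]
  by (auto intro!: exI[of _ 1])

private lemma ev_M: "z \<in> strip \<beta> \<Longrightarrow> M (evl z) \<le> 1"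
  by (rule M_le) (use Hinf_norm_bound[of _ \<beta> z] in \<open>force simp: eval_on_def\<close>)

private lemma span_D: "cspan (evl ` strip \<beta>) \<subseteq> D"
  using ev_D by (intro cspan_subset D_subspace) auto

private lemma Y_D: "Y \<subseteq> D"
  unfolding Hinf_predual_def norm_closure_in_dual_def by auto

private lemma span_Y: "cspan (evl ` strip \<beta>) \<subseteq> Y"
proof
  fix \<phi> assume a: "\<phi> \<in> cspan (evl ` strip \<beta>)"
  have "M (\<lambda>u. \<phi> u - \<phi> u) \<le> 0" by (rule M_le) auto
  then show "\<phi> \<in> Y"
    unfolding Hinf_predual_def norm_closure_in_dual_def using a span_D
    by (auto intro!: bexI[of _ \<phi>] elim: le_less_trans)
qed

private lemma ev_Y: "z \<in> strip \<beta> \<Longrightarrow> evl z \<in> Y"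
  using span_Y cspan_base[of "evl z"] by blast

private lemma Y_approx:
  assumes "\<phi> \<in> Y" "\<epsilon> > 0"
  obtains \<psi> where "\<psi> \<in> cspan (evl ` strip \<beta>)" "M (\<lambda>u. \<phi> u - \<psi> u) < \<epsilon>"
  using assms unfolding Hinf_predual_def norm_closure_in_dual_def by auto

private lemma Y_I:
  assumes "\<phi> \<in> D" "\<And>\<epsilon>. \<epsilon> > 0 \<Longrightarrow> \<exists>\<psi>\<in>Y. M (\<lambda>u. \<phi> u - \<psi> u) < \<epsilon>"
  shows "\<phi> \<in> Y"
  unfolding Hinf_predual_def norm_closure_in_dual_def
proof (intro CollectI conjI allI impI)
  fix \<epsilon> :: real assume "\<epsilon> > 0"
  then obtain \<psi> where p: "\<psi> \<in> Y" "M (\<lambda>u. \<phi> u - \<psi> u) < \<epsilon>/2"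
    using assms(2)[of "\<epsilon>/2"] by auto
  obtain \<eta> where c: "\<eta> \<in> cspan (evl ` strip \<beta>)" "M (\<lambda>u. \<psi> u - \<eta> u) < \<epsilon>/2"
    using Y_approx[OF p(1), of "\<epsilon>/2"] \<open>\<epsilon> > 0\<close> by auto
  have "M (\<lambda>u. (\<phi> u - \<psi> u) + (\<psi> u - \<eta> u)) \<le> M (\<lambda>u. \<phi> u - \<psi> u) + M (\<lambda>u. \<psi> u - \<eta> u)"
    using assms(1) p(1) c(1) Y_D span_D by (intro M_add_le is_subspace_diff[OF D_subspace]) auto
  then show "\<exists>\<psi>\<in>cspan (evl ` strip \<beta>). M (\<lambda>u. \<phi> u - \<psi> u) < \<epsilon>"
    using c p by (intro bexI[of _ \<eta>]) auto
qed (use assms(1) in auto)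

private lemma Y_subspace: "is_subspace Y"
  unfolding is_subspace_def
proof (intro conjI ballI allI)
  show "(\<lambda>x. 0) \<in> Y"
    using span_Y is_subspaceD(1)[OF is_subspace_cspan] by blast
next
  fix u v assume u: "u \<in> Y" and v: "v \<in> Y"
  have uv: "u \<in> D" "v \<in> D" using u v Y_D by auto
  show "(\<lambda>x. u x + v x) \<in> Y"
  proof (rule Y_I)
    show "(\<lambda>x. u x + v x) \<in> D" using is_subspaceD(2)[OF D_subspace uv] .
    fix \<epsilon> :: real assume e: "\<epsilon> > 0"
    obtain p where p: "p \<in> cspan (evl ` strip \<beta>)" "M (\<lambda>x. u x - p x) < \<epsilon>/2"
      using Y_approx[OF u, of "\<epsilon>/2"] e by auto
    obtain q where q: "q \<in> cspan (evl ` strip \<beta>)" "M (\<lambda>x. v x - q x) < \<epsilon>/2"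
      using Y_approx[OF v, of "\<epsilon>/2"] e by auto
    have "M (\<lambda>x. (u x - p x) + (v x - q x)) \<le> M (\<lambda>x. u x - p x) + M (\<lambda>x. v x - q x)"
      using uv p(1) q(1) span_D by (intro M_add_le is_subspace_diff[OF D_subspace]) auto
    then have "M (\<lambda>x. u x + v x - (p x + q x)) < \<epsilon>" using p q by (simp add: algebra_simps)
    moreover have "(\<lambda>x. p x + q x) \<in> Y"
      using is_subspaceD(2)[OF is_subspace_cspan p(1) q(1)] span_Y by blast
    ultimately show "\<exists>\<psi>\<in>Y. M (\<lambda>x. u x + v x - \<psi> x) < \<epsilon>"
      by (intro bexI[of _ "\<lambda>x. p x + q x"]) auto
  qed
next
  fix c u assume u: "u \<in> Y"
  have uD: "u \<in> D" using u Y_D by auto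
  show "(\<lambda>x. c * u x) \<in> Y"
  proof (rule Y_I)
    show "(\<lambda>x. c * u x) \<in> D" using is_subspaceD(3)[OF D_subspace uD] .
    fix \<epsilon> :: real assume e: "\<epsilon> > 0"
    have e': "\<epsilon> / (cmod c + 1) > 0" using e by (auto intro!: divide_pos_pos add_nonneg_pos)
    obtain p where p: "p \<in> cspan (evl ` strip \<beta>)" "M (\<lambda>x. u x - p x) < \<epsilon> / (cmod c + 1)"
      using Y_approx[OF u e'] by auto
    have dD: "(\<lambda>x. u x - p x) \<in> D"
      using uD p(1) span_D by (intro is_subspace_diff[OF D_subspace]) auto
    have "M (\<lambda>x. c * (u x - p x)) \<le> cmod c * M (\<lambda>x. u x - p x)" by (rule M_scale_le[OF dD])
    also have "\<dots> \<le> (cmod c + 1) * M (\<lambda>x. u x - p x)"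
      using M_nonneg[OF dD] by (intro mult_right_mono) auto
    also have "\<dots> < (cmod c + 1) * (\<epsilon> / (cmod c + 1))"
      using p(2) by (intro mult_strict_left_mono add_nonneg_pos) auto
    also have "\<dots> = \<epsilon>" using e' by (simp add: add_nonneg_eq_0_iff)
    finally have "M (\<lambda>x. c * u x - c * p x) < \<epsilon>" by (simp add: algebra_simps)
    moreover have "(\<lambda>x. c * p x) \<in> Y"
      using is_subspaceD(3)[OF is_subspace_cspan p(1)] span_Y by blast
    ultimately show "\<exists>\<psi>\<in>Y. M (\<lambda>x. c * u x - \<psi> x) < \<epsilon>"
      by (intro bexI[of _ "\<lambda>x. c * p x"]) auto
  qed
qed

private lemma Y_closed: "norm_closure_in_dual V N Y \<subseteq> Y"
  using Y_I unfolding norm_closure_in_dual_def by blast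

private lemma eval_Y_dual:
  assumes "f \<in> V"
  shows "eval_on Y f \<in> dual_of Y M"
proof -
  have "cmod (\<phi> f) \<le> N f * M \<phi>" if "\<phi> \<in> Y" for \<phi>
    using M_bound[of \<phi> f] that Y_D assms by (auto simp: mult.commute)
  then show ?thesis
    unfolding dual_of_def is_linear_on_def eval_on_def
    using is_subspaceD[OF Y_subspace] by (auto intro!: exI[of _ "N f"])
qed

private lemma eval_Y_norm:
  assumes f: "f \<in> V"
  shows "dual_norm Y M (eval_on Y f) = N f"
proof -
  have le: "cmod (eval_on Y f \<phi>) \<le> N f" if "\<phi> \<in> Y" "M \<phi> \<le> 1" for \<phi>
  proof -
    have "cmod (\<phi> f) \<le> M \<phi> * N f" using M_bound[of \<phi> f] that Y_D f by auto
    also have "\<dots> \<le> 1 * N f" using that N_nonneg[OF f] by (intro mult_right_mono) auto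
    finally show ?thesis using that by (simp add: eval_on_def)
  qed
  have bdd: "bdd_above ((\<lambda>\<phi>. cmod (eval_on Y f \<phi>)) ` {\<phi>\<in>Y. M \<phi> \<le> 1})"
    unfolding bdd_above_def using le by (intro exI[of _ "N f"]) auto
  show ?thesis
  proof (rule antisym)
    have "evl (of_real (\<beta>/2) * \<i>) \<in> {\<phi>\<in>Y. M \<phi> \<le> 1}"
      using ev_Y[OF mid_in_strip] ev_M[OF mid_in_strip] by auto
    then show "dual_norm Y M (eval_on Y f) \<le> N f"
      unfolding dual_norm_def[of Y] using le by (intro cSUP_least) auto
    show "N f \<le> dual_norm Y M (eval_on Y f)"
    proof (rule N_le)
      fix z assume z: "z \<in> strip \<beta>"
      have "cmod (eval_on Y f (evl z)) \<le> dual_norm Y M (eval_on Y f)"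
        unfolding dual_norm_def[of Y] using ev_Y[OF z] ev_M[OF z]
        by (intro cSUP_upper[OF _ bdd]) auto
      then show "cmod (f z) \<le> dual_norm Y M (eval_on Y f)"
        using ev_Y[OF z] f by (simp add: eval_on_def)
    qed
  qed
qed

private lemma taylor_estimate:
  assumes z: "z \<in> strip \<beta>"
  obtains r where "r > 0" "ball z r \<subseteq> strip \<beta>"
    "\<And>f. f \<in> V \<Longrightarrow> cmod (deriv f z) \<le> N f / r"
    "\<And>f w. f \<in> V \<Longrightarrow> w \<in> ball z r \<Longrightarrow>
        cmod (f w - f z - (w - z) * deriv f z) \<le> (2 * N f / r\<^sup>2) * (cmod (w - z))\<^sup>2"
proof -
  obtain e where e: "e > 0" "cball z e \<subseteq> strip \<beta>"
    using open_contains_cball[of "strip \<beta>"] open_strip z by auto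
  define r where "r = e / 2"
  have r: "r > 0" using e by (simp add: r_def)
  have sub: "cball x r \<subseteq> strip \<beta>" if "x \<in> ball z r" for x
  proof
    fix y assume "y \<in> cball x r"
    then have "dist z y \<le> e" using that dist_triangle[of z y x] by (simp add: r_def)
    then show "y \<in> strip \<beta>" using e by auto
  qed
  have cauchy: "cmod ((deriv ^^ n) f x) \<le> fact n * N f / r ^ n"
    if "f \<in> V" "x \<in> ball z r" for f n x
  proof (rule Cauchy_inequality)
    have h: "f holomorphic_on strip \<beta>" using that unfolding Hinf_def by auto
    show "f holomorphic_on ball x r"
      using h sub[OF that(2)] ball_subset_cball by (blast intro: holomorphic_on_subset)
    show "continuous_on (cball x r) f"
      using h sub[OF that(2)] by (meson holomorphic_on_imp_continuous_on holomorphic_on_subset)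
    show "cmod (f y) \<le> N f" if "cmod (x - y) = r" for y
      using Hinf_norm_bound[OF \<open>f \<in> V\<close>, of y] sub[OF \<open>x \<in> ball z r\<close>] that by (auto simp: dist_norm)
  qed (use r in auto)
  show thesis
  proof
    show "r > 0" by fact
    show "ball z r \<subseteq> strip \<beta>"
      using sub[of z] r ball_subset_cball by auto
    show "cmod (deriv f z) \<le> N f / r" if "f \<in> V" for f
      using cauchy[OF that, of z 1] r by simp
    show "cmod (f w - f z - (w - z) * deriv f z) \<le> (2 * N f / r\<^sup>2) * (cmod (w - z))\<^sup>2"
      if f: "f \<in> V" and w: "w \<in> ball z r" for f w
    proof -
      have h: "f holomorphic_on strip \<beta>" using f unfolding Hinf_def by auto
      have "cmod ((\<lambda>n. (deriv ^^ n) f) 0 w - (\<Sum>i\<le>1. (deriv ^^ i) f z * (w - z) ^ i / fact i))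
          \<le> (2 * N f / r\<^sup>2) * cmod (w - z) ^ Suc 1 / fact 1"
      proof (rule complex_Taylor[where S = "ball z r"])
        fix i :: nat and x assume "x \<in> ball z r"
        then have x: "x \<in> strip \<beta>" using sub[of x] r by auto
        have "((deriv ^^ i) f) field_differentiable (at x)"
          using holomorphic_higher_deriv[OF h open_strip] open_strip x
          by (metis holomorphic_on_open field_differentiable_def)
        then show "((deriv ^^ i) f has_field_derivative (deriv ^^ Suc i) f x) (at x within ball z r)"
          by (simp add: DERIV_deriv_iff_field_differentiable has_field_derivative_at_within)
      next
        fix x assume "x \<in> ball z r"
        from cauchy[OF f this, of 2]
        show "cmod ((deriv ^^ Suc 1) f x) \<le> 2 * N f / r\<^sup>2" by (simp add: numeral_2_eq_2)
      qed (use r w in auto)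
      then show ?thesis by (simp add: power2_eq_square mult.commute diff_diff_eq)
    qed
  qed
qed

private lemma eval_Y_surj:
  assumes L: "\<Lambda> \<in> dual_of Y M"
  shows "\<exists>f\<in>V. \<Lambda> = eval_on Y f"
proof -
  obtain C0 where C0: "\<forall>\<phi>\<in>Y. cmod (\<Lambda> \<phi>) \<le> C0 * M \<phi>" using L unfolding dual_of_def by blast
  define C where "C = \<bar>C0\<bar>"
  have C: "cmod (\<Lambda> \<phi>) \<le> C * M \<phi>" if "\<phi> \<in> Y" for \<phi>
  proof -
    have "C0 * M \<phi> \<le> C * M \<phi>"
      using M_nonneg[of \<phi>] that Y_D by (intro mult_right_mono) (auto simp: C_def)
    then show ?thesis using C0 that by force
  qed
  have C_nn: "C \<ge> 0" by (simp add: C_def)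
  have lin: "is_linear_on Y \<Lambda>" using L unfolding dual_of_def by auto
  define F where "F z = (if z \<in> strip \<beta> then \<Lambda> (evl z) else 0)" for z
  have Fb: "cmod (F z) \<le> C" if "z \<in> strip \<beta>" for z
  proof -
    have "cmod (\<Lambda> (evl z)) \<le> C * M (evl z)" using C[OF ev_Y[OF that]] .
    also have "\<dots> \<le> C * 1" using ev_M[OF that] C_nn by (intro mult_left_mono) auto
    finally show ?thesis using that by (simp add: F_def)
  qed
  have "\<exists>D'. (F has_field_derivative D') (at z)" if z: "z \<in> strip \<beta>" for z
  proof -
    obtain r where r: "r > 0" "ball z r \<subseteq> strip \<beta>"
      and d1: "\<And>f. f \<in> V \<Longrightarrow> cmod (deriv f z) \<le> N f / r"
      and d2: "\<And>f w. f \<in> V \<Longrightarrow> w \<in> ball z r \<Longrightarrow>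
        cmod (f w - f z - (w - z) * deriv f z) \<le> (2 * N f / r\<^sup>2) * (cmod (w - z))\<^sup>2"
      using taylor_estimate[OF z] by metis
    define d where "d f = (if f \<in> V then deriv f z else 0)" for f
    have fd: "f field_differentiable (at z)" if "f \<in> V" for f
      using that z open_strip unfolding Hinf_def
      by (auto intro: holomorphic_on_imp_differentiable_at)
    have dD: "d \<in> D"
      unfolding dual_of_def is_linear_on_def
    proof (intro CollectI conjI ballI allI impI)
      fix u v assume "u \<in> V" "v \<in> V"
      then show "d (\<lambda>x. u x + v x) = d u + d v"
        using is_subspaceD(2)[OF Hinf_subspace] fd by (simp add: d_def)
    next
      fix c u assume "u \<in> V"
      then show "d (\<lambda>x. c * u x) = c * d u"
        using is_subspaceD(3)[OF Hinf_subspace] fd by (simp add: d_def)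
    next
      show "\<exists>C. \<forall>u\<in>V. cmod (d u) \<le> C * N u"
        using d1 by (intro exI[of _ "1/r"]) (auto simp: d_def)
    qed (auto simp: d_def)
    define R where "R w = (\<lambda>f. (evl w f - evl z f) - (w - z) * d f)" for w
    have RM: "M (R w) \<le> (2 / r\<^sup>2) * (cmod (w - z))\<^sup>2" if w: "w \<in> ball z r" for w
    proof (rule M_le)
      fix f assume f: "f \<in> V" "N f \<le> 1"
      have "cmod (R w f) \<le> (2 * N f / r\<^sup>2) * (cmod (w - z))\<^sup>2"
        using d2[OF f(1) w] f by (simp add: R_def eval_on_def d_def)
      also have "\<dots> \<le> (2 * 1 / r\<^sup>2) * (cmod (w - z))\<^sup>2"
        using f r by (intro mult_right_mono divide_right_mono) auto
      finally show "cmod (R w f) \<le> (2 / r\<^sup>2) * (cmod (w - z))\<^sup>2" by simp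
    qed
    have RD: "R w \<in> D" if w: "w \<in> ball z r" for w
      unfolding R_def using w r z dD
      by (intro is_subspace_diff[OF D_subspace] is_subspaceD(3)[OF D_subspace] ev_D) auto
    have dY: "d \<in> Y"
    proof (rule Y_I[OF dD])
      fix \<epsilon> :: real assume e: "\<epsilon> > 0"
      define h where "h = min (r / 2) (\<epsilon> * r\<^sup>2 / 4)"
      have h: "h > 0" "h < r" "h \<le> \<epsilon> * r\<^sup>2 / 4" using e r by (auto simp: h_def min_less_iff_disj)
      define w where "w = z + of_real h"
      have w: "w \<in> ball z r" "w - z = of_real h" using h by (auto simp: w_def dist_norm)
      define \<psi> where "\<psi> = (\<lambda>f. (1 / (w - z)) * (evl w f - evl z f))"
      have pY: "\<psi> \<in> Y"
        unfolding \<psi>_def using w r z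
        by (intro is_subspaceD(3)[OF Y_subspace] is_subspace_diff[OF Y_subspace] ev_Y) auto
      have eq: "(\<lambda>u. d u - \<psi> u) = (\<lambda>u. (- 1 / (w - z)) * R w u)"
        using h by (auto simp: \<psi>_def R_def w(2) field_simps)
      have "M (\<lambda>u. d u - \<psi> u) \<le> cmod (- 1 / (w - z)) * M (R w)"
        unfolding eq by (rule M_scale_le[OF RD[OF w(1)]])
      also have "\<dots> \<le> cmod (- 1 / (w - z)) * ((2 / r\<^sup>2) * (cmod (w - z))\<^sup>2)"
        by (intro mult_left_mono RM w) auto
      also have "\<dots> = 2 * h / r\<^sup>2"
        using h by (simp add: w(2) norm_divide power2_eq_square)
      also have "\<dots> \<le> 2 * (\<epsilon> * r\<^sup>2 / 4) / r\<^sup>2"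
        using h r by (intro divide_right_mono mult_left_mono) auto
      also have "\<dots> < \<epsilon>" using e r by simp
      finally show "\<exists>\<psi>\<in>Y. M (\<lambda>u. d u - \<psi> u) < \<epsilon>" using pY by blast
    qed
    have est: "cmod (F w - F z - (w - z) * \<Lambda> d) \<le> (C * (2 / r\<^sup>2)) * (cmod (w - z))\<^sup>2"
      if w: "w \<in> ball z r" for w
    proof -
      have ws: "w \<in> strip \<beta>" using w r by auto
      have y1: "(\<lambda>f. evl w f - evl z f) \<in> Y"
        using ws z by (intro is_subspace_diff[OF Y_subspace] ev_Y)
      have y2: "(\<lambda>f. (w - z) * d f) \<in> Y" by (rule is_subspaceD(3)[OF Y_subspace dY])
      have "\<Lambda> (R w) = \<Lambda> (\<lambda>f. evl w f - evl z f) - \<Lambda> (\<lambda>f. (w - z) * d f)"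
        unfolding R_def by (rule is_linear_on_diff[OF Y_subspace lin y1 y2])
      also have "\<Lambda> (\<lambda>f. evl w f - evl z f) = \<Lambda> (evl w) - \<Lambda> (evl z)"
        by (rule is_linear_on_diff[OF Y_subspace lin ev_Y[OF ws] ev_Y[OF z]])
      also have "\<Lambda> (\<lambda>f. (w - z) * d f) = (w - z) * \<Lambda> d"
        by (rule is_linear_onD(2)[OF lin dY])
      finally have eq: "\<Lambda> (R w) = F w - F z - (w - z) * \<Lambda> d" using ws z by (simp add: F_def)
      have "R w \<in> Y" unfolding R_def by (rule is_subspace_diff[OF Y_subspace y1 y2])
      then have "cmod (\<Lambda> (R w)) \<le> C * M (R w)" by (rule C)
      also have "\<dots> \<le> C * ((2 / r\<^sup>2) * (cmod (w - z))\<^sup>2)"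
        using RM[OF w] C_nn by (intro mult_left_mono) auto
      finally show ?thesis by (simp add: eq mult.assoc)
    qed
    have "((\<lambda>w. (F w - F z) / (w - z)) \<longlongrightarrow> \<Lambda> d) (at z)"
    proof (rule LIM_zero_cancel, rule Lim_null_comparison)
      show "\<forall>\<^sub>F w in at z. norm ((F w - F z) / (w - z) - \<Lambda> d) \<le> (C * (2 / r\<^sup>2)) * cmod (w - z)"
        unfolding eventually_at
      proof (intro exI[of _ r] conjI ballI impI)
        fix w assume "w \<noteq> z \<and> dist w z < r"
        then have w: "w \<noteq> z" "w \<in> ball z r" by (auto simp: dist_commute)
        have "(F w - F z) / (w - z) - \<Lambda> d = (F w - F z - (w - z) * \<Lambda> d) / (w - z)"
          using w(1) by (simp add: field_simps)
        then have "cmod ((F w - F z) / (w - z) - \<Lambda> d) \<le> (C * (2 / r\<^sup>2)) * (cmod (w - z))\<^sup>2 / cmod (w - z)"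
          using divide_right_mono[OF est[OF w(2)] norm_ge_zero[of "w - z"]]
          by (simp only: norm_divide)
        then show "cmod ((F w - F z) / (w - z) - \<Lambda> d) \<le> (C * (2 / r\<^sup>2)) * cmod (w - z)"
          using w(1) by (simp add: power2_eq_square)
      qed (use r in auto)
      show "((\<lambda>w. (C * (2 / r\<^sup>2)) * cmod (w - z)) \<longlongrightarrow> 0) (at z)"
        by (rule tendsto_mult_right_zero) (auto intro!: tendsto_eq_intros)
    qed
    then show ?thesis unfolding has_field_derivative_iff by blast
  qed
  then have "F holomorphic_on strip \<beta>" using holomorphic_on_open[OF open_strip] by blast
  then have FV: "F \<in> V"
    unfolding Hinf_def bounded_iff using Fb by (auto simp: F_def)
  have "\<Lambda> \<phi> = \<phi> F" if p: "\<phi> \<in> Y" for \<phi>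
  proof -
    define E where "E \<psi> = \<Lambda> \<psi> - \<psi> F" for \<psi>
    have "cspan (evl ` strip \<beta>) \<subseteq> {\<psi>\<in>Y. E \<psi> = 0}"
    proof (rule cspan_subset)
      show "is_subspace {\<psi> \<in> Y. E \<psi> = 0}"
        using is_subspaceD[OF Y_subspace] is_linear_on_zero[OF Y_subspace lin] lin
        unfolding is_subspace_def is_linear_on_def E_def by simp
      show "evl ` strip \<beta> \<subseteq> {\<psi> \<in> Y. E \<psi> = 0}"
        using ev_Y FV by (auto simp: E_def F_def eval_on_def[of V])
    qed
    then have E0: "\<Lambda> \<psi> = \<psi> F" "\<psi> \<in> Y" if "\<psi> \<in> cspan (evl ` strip \<beta>)" for \<psi>
      using that by (auto simp: E_def)
    have "cmod (\<Lambda> \<phi> - \<phi> F) \<le> 0 + \<epsilon>" if e: "\<epsilon> > 0" for \<epsilon>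
    proof -
      define K where "K = C + N F + 1"
      have K: "K > 0" using C_nn N_nonneg[OF FV] by (simp add: K_def)
      obtain \<psi> where s: "\<psi> \<in> cspan (evl ` strip \<beta>)" "M (\<lambda>u. \<phi> u - \<psi> u) < \<epsilon> / K"
        using Y_approx[OF p, of "\<epsilon> / K"] e K by auto
      define m where "m = M (\<lambda>u. \<phi> u - \<psi> u)"
      have dY: "(\<lambda>u. \<phi> u - \<psi> u) \<in> Y" by (rule is_subspace_diff[OF Y_subspace p E0(2)[OF s(1)]])
      have dD: "(\<lambda>u. \<phi> u - \<psi> u) \<in> D" using dY Y_D by auto
      have "\<Lambda> \<phi> - \<phi> F = \<Lambda> (\<lambda>u. \<phi> u - \<psi> u) - (\<phi> F - \<psi> F)"
        using is_linear_on_diff[OF Y_subspace lin p E0(2)[OF s(1)]] E0(1)[OF s(1)] by simp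
      then have "cmod (\<Lambda> \<phi> - \<phi> F) \<le> cmod (\<Lambda> (\<lambda>u. \<phi> u - \<psi> u)) + cmod (\<phi> F - \<psi> F)"
        using norm_triangle_ineq4[of "\<Lambda> (\<lambda>u. \<phi> u - \<psi> u)" "\<phi> F - \<psi> F"] by presburger
      also have "\<dots> \<le> C * m + m * N F"
        using C[OF dY] M_bound[OF dD FV] by (simp add: m_def)
      also have "\<dots> \<le> K * m"
        using M_nonneg[OF dD] by (simp add: K_def m_def algebra_simps)
      also have "\<dots> \<le> K * (\<epsilon> / K)" using s(2) K by (intro mult_left_mono) (auto simp: m_def)
      finally show ?thesis using K by simp
    qed
    then have "cmod (\<Lambda> \<phi> - \<phi> F) \<le> 0" by (rule field_le_epsilon)
    then show ?thesis by simp
  qed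
  moreover have "\<Lambda> \<phi> = 0" if "\<phi> \<notin> Y" for \<phi> using L that unfolding dual_of_def by auto
  ultimately have "\<Lambda> = eval_on Y F" by (auto simp: eval_on_def)
  then show ?thesis using FV by blast
qed

lemma is_predual_Hinf_predual: "is_predual (Hinf \<beta>) (Hinf_norm \<beta>) (Hinf_predual \<beta>)"
  unfolding is_predual_def
proof (intro conjI ballI)
  show "bij_betw (eval_on Y) V (dual_of Y M)"
    unfolding bij_betw_def
  proof (intro conjI inj_onI)
    fix f g assume fg: "f \<in> V" "g \<in> V" "eval_on Y f = eval_on Y g"
    show "f = g"
    proof
      fix z
      show "f z = g z"
      proof (cases "z \<in> strip \<beta>")
        case True
        then show ?thesis
          using fun_cong[OF fg(3), of "evl z"] ev_Y[OF True] fg(1,2) by (simp add: eval_on_def)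
      next
        case False
        then show ?thesis using fg(1,2) unfolding Hinf_def by auto
      qed
    qed
  next
    show "eval_on Y ` V = dual_of Y M" using eval_Y_dual eval_Y_surj by auto
  qed
qed (use Y_D Y_subspace Y_closed eval_Y_norm in auto)

end

end

theory Submission
  imports Defs
begin

text \<open>
  On the midline \<open>\<beta> \<i> / 2 + \<real>\<close> the function \<open>Hinf_g \<beta> t\<close> is \<open>x \<mapsto> exp (i t x)\<close>, so the
  functional \<open>\<omega>\<^sub>\<mu>\<close> of a probability measure \<open>\<mu>\<close> on the midline takes the value \<open>char \<mu> t\<close> at
  \<open>Hinf_g \<beta> t\<close>. A state \<open>\<omega>\<close> makes \<open>t \<mapsto> \<omega> (Hinf_g \<beta> t)\<close> positive definite, and weak continuity
  makes it continuous. By Bochner's theorem (\<open>Bochner\<close>) it is \<open>char \<mu>\<close> for some \<open>\<mu>\<close>, so \<open>\<omega>\<close> and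
  \<open>\<omega>\<^sub>\<mu>\<close> agree on all \<open>Hinf_g \<beta> t\<close>. Conversely every continuous normalised positive definite
  function gives such a \<open>\<mu>\<close>, and \<open>\<omega>\<^sub>\<mu>\<close> is a weakly continuous state because it is a norm limit
  of combinations of point evaluations (\<open>midline_functional_in_predual\<close>).

  What remains, both for \<open>\<omega> = \<omega>\<^sub>\<mu>\<close> and for the weak density of the span, is that an element \<open>\<phi>\<close>
  of the predual that vanishes on all \<open>Hinf_g \<beta> t\<close> vanishes
  (\<open>predual_zero_if_kills_exponentials\<close>). For this, any \<open>f \<in> Hinf \<beta>\<close> is multiplied by a
  Gaussian, to make it integrable on the midline, and averaged over real translations with a
  Gaussian weight. The result is a superposition \<open>\<integral> a(t) Hinf_g \<beta> t dt\<close>: this is an identity of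
  Fourier analysis on the midline, and extends to the strip by the identity theorem. The element
  \<open>\<phi>\<close> may be taken under such integrals (\<open>Hinf_integral_exists\<close>, which rests on \<open>Hinf \<beta>\<close> being
  the dual of its predual) and is continuous under bounded pointwise limits, so \<open>\<phi> f = 0\<close>.
  Passing from a trivial annihilator to density, and from weak continuity to membership in the
  predual, is finite-dimensional linear algebra.

  Bochner's theorem is proved with Gaussians as well: positivity of the Gaussian-regularised
  Fourier transform of \<open>\<phi>\<close> gives probability measures whose characteristic functions converge to
  \<open>\<phi>\<close>, and continuity of \<open>\<phi>\<close> at \<open>0\<close> makes them tight (\<open>char_limit_exists\<close>).
\<close>

section \<open>Limits of characteristic functions\<close>

text \<open>
  Fubini's theorem applies because on a product of two probability measures every bounded
  measurable integrand is integrable.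
\<close>

lemma Fubini_bounded:
  fixes f :: "real \<Rightarrow> real \<Rightarrow> complex"
  assumes M: "real_distribution M" and N: "real_distribution N"
    and f: "(\<lambda>p. f (fst p) (snd p)) \<in> borel_measurable (borel \<Otimes>\<^sub>M borel)"
    and B: "\<And>x y. cmod (f x y) \<le> B"
  shows "(\<integral>y. (\<integral>x. f x y \<partial>M) \<partial>N) = (\<integral>x. (\<integral>y. f x y \<partial>N) \<partial>M)"
proof -
  interpret M: real_distribution M by fact
  interpret N: real_distribution N by fact
  interpret P: pair_prob_space M N ..
  have "integrable (M \<Otimes>\<^sub>M N) (case_prod f)"
  proof (rule P.integrable_const_bound[of _ B])
    show "case_prod f \<in> borel_measurable (M \<Otimes>\<^sub>M N)"
      using f by (simp add: case_prod_beta' cong: measurable_cong_sets sets_pair_measure_cong)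
  qed (use B in auto)
  then show ?thesis by (rule P.Fubini_integral)
qed

text \<open>
  Both sides are the double integral of \<open>exp (i d s x)\<close>. For Gaussian \<open>N\<close> the right-hand side
  is an average of \<open>exp (- (d x)\<^sup>2 / 2)\<close>, so that a Gaussian average of the characteristic
  function near \<open>0\<close> measures how much mass of \<open>M\<close> lies far out.
\<close>

lemma integral_char_swap:
  assumes M: "real_distribution M" and N: "real_distribution N"
  shows "(\<integral>s. char M (d * s) \<partial>N) = (\<integral>x. char N (d * x) \<partial>M)"
proof -
  have "(\<integral>s. (\<integral>x. iexp (d * s * x) \<partial>M) \<partial>N) = (\<integral>x. (\<integral>s. iexp (d * s * x) \<partial>N) \<partial>M)"
  proof (rule Fubini_bounded[OF M N, of _ 1])
    show "(\<lambda>p. iexp (d * snd p * fst p)) \<in> borel_measurable (borel \<Otimes>\<^sub>M borel)"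
      unfolding borel_prod by (intro borel_measurable_continuous_onI continuous_intros)
  qed (simp del: of_real_mult)
  then show ?thesis unfolding char_def by (simp add: mult_ac)
qed

text \<open>
  The function \<open>1 - exp (- (d x)\<^sup>2 / 2)\<close> is nonnegative, and at least \<open>1 - exp (-1/2)\<close> as soon
  as \<open>\<bar>d x\<bar> \<ge> 1\<close>; its mean over \<open>M\<close> is the right-hand side by the exchange of integrals above.
\<close>

lemma tail_le_char_gaussian_average:
  assumes M: "real_distribution M" and d: "d > 0"
  shows "(1 - exp (-1/2)) * measure M {x. \<bar>x\<bar> \<ge> 1 / d}
          \<le> 1 - Re (\<integral>s. char M (d * s) \<partial>std_normal_distribution)"
proof -
  interpret M: real_distribution M by fact
  have int: "integrable M (\<lambda>x. exp (- (d * x)\<^sup>2 / 2))"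
    by (rule M.integrable_const_bound[of _ 1]) auto
  have "(\<integral>s. char M (d * s) \<partial>std_normal_distribution) = (\<integral>x. complex_of_real (exp (- (d * x)\<^sup>2 / 2)) \<partial>M)"
    by (simp add: integral_char_swap[OF M real_dist_normal_dist] char_std_normal_distribution)
  then have "1 - Re (\<integral>s. char M (d * s) \<partial>std_normal_distribution) = (\<integral>x. 1 - exp (- (d * x)\<^sup>2 / 2) \<partial>M)"
    using int M.prob_space by (simp add: integral_complex_of_real del: of_real_exp M.space_eq_univ)
  also have "\<dots> \<ge> (\<integral>x. (1 - exp (-1/2)) * indicator {x. \<bar>x\<bar> \<ge> 1 / d} x \<partial>M)"
  proof (rule integral_mono)
    fix x
    have "1 \<le> (d * x)\<^sup>2" if "\<bar>x\<bar> \<ge> 1 / d"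
    proof -
      have "1 \<le> \<bar>d * x\<bar>" using that d by (simp add: abs_mult field_simps)
      then show ?thesis by (metis abs_ge_zero one_le_power power2_abs)
    qed
    then show "(1 - exp (-1/2)) * indicator {x. \<bar>x\<bar> \<ge> 1 / d} x \<le> 1 - exp (- (d * x)\<^sup>2 / 2)"
      by (auto simp: indicator_def)
  qed (auto intro!: int M.integrable_const_bound[of _ 1] simp: M.emeasure_eq_measure)
  finally show ?thesis by (simp add: M.emeasure_eq_measure)
qed

lemma gaussian_average_tendsto:
  fixes f :: "nat \<Rightarrow> real \<Rightarrow> complex"
  assumes [measurable]: "\<And>n. f n \<in> borel_measurable borel" and lim: "\<And>s. (\<lambda>n. f n s) \<longlonglongrightarrow> g s"
    and B: "\<And>n s. cmod (f n s) \<le> B"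
  shows "(\<lambda>n. \<integral>s. f n s \<partial>std_normal_distribution) \<longlonglongrightarrow> (\<integral>s. g s \<partial>std_normal_distribution)"
proof -
  interpret N: real_distribution std_normal_distribution by (rule real_dist_normal_dist)
  have [measurable]: "g \<in> borel_measurable borel"
    by (rule borel_measurable_LIMSEQ_metric[OF assms(1) lim])
  show ?thesis
    by (rule integral_dominated_convergence[where w = "\<lambda>_. B"]) (auto intro!: lim B)
qed

text \<open>
  Levy's continuity theorem in the form that produces the limit law. Continuity of the limit at
  \<open>0\<close> makes its Gaussian averages at small scale close to \<open>1\<close>, the tail estimate turns this into
  tightness, and a weak limit point of the sequence then has the required characteristic
  function.
\<close>

theorem char_limit_exists:
  fixes \<mu> :: "nat \<Rightarrow> real measure" and \<phi> :: "real \<Rightarrow> complex"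
  assumes real: "\<And>n. real_distribution (\<mu> n)"
    and lim: "\<And>t. (\<lambda>n. char (\<mu> n) t) \<longlonglongrightarrow> \<phi> t" and cont: "isCont \<phi> 0"
  shows "\<exists>M. real_distribution M \<and> char M = \<phi>"
proof -
  interpret \<mu>: real_distribution "\<mu> n" for n by fact
  interpret N: real_distribution std_normal_distribution by (rule real_dist_normal_dist)
  have phi0: "\<phi> 0 = 1" using lim[of 0] by (simp add: \<mu>.char_zero LIMSEQ_const_iff)
  have bd: "cmod (\<phi> t) \<le> 1" for t
    by (rule Lim_norm_ubound[OF _ lim[of t]]) (auto simp: \<mu>.cmod_char_le_1)
  have [measurable]: "\<phi> \<in> borel_measurable borel"
    by (rule borel_measurable_LIMSEQ_metric[OF _ lim]) measurable
  have "\<exists>a b. a < b \<and> (\<forall>n. 1 - \<epsilon> < measure (\<mu> n) {a<..b})" if e: "\<epsilon> > 0" for \<epsilon>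
  proof -
    define c :: real where "c = 1 - exp (-1/2)"
    have c: "c > 0" by (simp add: c_def)
    have "(\<lambda>k. \<phi> (1 / real (Suc k) * s)) \<longlonglongrightarrow> 1" for s
    proof -
      have "(\<lambda>k. 1 / real (Suc k) * s) \<longlonglongrightarrow> 0 * s"
        by (intro tendsto_intros LIMSEQ_Suc lim_1_over_n)
      from isCont_tendsto_compose[OF cont, of "\<lambda>k. 1 / real (Suc k) * s"] this
      show ?thesis by (simp add: phi0)
    qed
    then have "(\<lambda>k. \<integral>s. \<phi> (1 / real (Suc k) * s) \<partial>std_normal_distribution) \<longlonglongrightarrow> (\<integral>s. 1 \<partial>std_normal_distribution)"
      by (intro gaussian_average_tendsto[where B = 1]) (auto intro: bd)
    then have "(\<lambda>k. 1 - Re (\<integral>s. \<phi> (1 / real (Suc k) * s) \<partial>std_normal_distribution)) \<longlonglongrightarrow> 1 - Re 1"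
      using N.prob_space by (intro tendsto_intros) (simp del: N.space_eq_univ)
    then have "eventually (\<lambda>k. 1 - Re (\<integral>s. \<phi> (1 / real (Suc k) * s) \<partial>std_normal_distribution) < c * \<epsilon>) sequentially"
      using c e by (intro order_tendstoD) auto
    then obtain k where k: "1 - Re (\<integral>s. \<phi> (1 / real (Suc k) * s) \<partial>std_normal_distribution) < c * \<epsilon>"
      by (auto simp: eventually_sequentially)
    define d where "d = 1 / real (Suc k)"
    have d: "d > 0" by (simp add: d_def)
    have "(\<lambda>n. \<integral>s. char (\<mu> n) (d * s) \<partial>std_normal_distribution) \<longlonglongrightarrow> (\<integral>s. \<phi> (d * s) \<partial>std_normal_distribution)"
      by (intro gaussian_average_tendsto[where B = 1] lim) (auto intro: \<mu>.cmod_char_le_1)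
    then have "(\<lambda>n. 1 - Re (\<integral>s. char (\<mu> n) (d * s) \<partial>std_normal_distribution))
        \<longlonglongrightarrow> 1 - Re (\<integral>s. \<phi> (d * s) \<partial>std_normal_distribution)"
      by (intro tendsto_intros)
    then have "eventually (\<lambda>n. 1 - Re (\<integral>s. char (\<mu> n) (d * s) \<partial>std_normal_distribution) < c * \<epsilon>) sequentially"
      using k by (intro order_tendstoD) (auto simp: d_def)
    then obtain N where N: "\<And>n. n \<ge> N \<Longrightarrow> 1 - Re (\<integral>s. char (\<mu> n) (d * s) \<partial>std_normal_distribution) < c * \<epsilon>"
      by (auto simp: eventually_sequentially)
    \<comment> \<open>The tail estimate is uniform only for \<open>n \<ge> N\<close>; the finitely many earlier measures are
       handled one by one, using that each is concentrated on a large interval.\<close>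
    have late: "1 - \<epsilon> < measure (\<mu> n) {-R<..R}" if "n \<ge> N" "R \<ge> 1 / d" for n R
    proof -
      have "c * measure (\<mu> n) {x. \<bar>x\<bar> \<ge> 1 / d} < c * \<epsilon>"
        using tail_le_char_gaussian_average[OF real d, of n, folded c_def] N[OF that(1)] by (rule le_less_trans)
      then have "measure (\<mu> n) {x. \<bar>x\<bar> \<ge> 1 / d} < \<epsilon>" using c by simp
      moreover have "measure (\<mu> n) (UNIV - {x. \<bar>x\<bar> \<ge> 1 / d}) = 1 - measure (\<mu> n) {x. \<bar>x\<bar> \<ge> 1 / d}"
        using \<mu>.prob_compl[of "{x. \<bar>x\<bar> \<ge> 1 / d}" n] by simp
      moreover have "measure (\<mu> n) (UNIV - {x. \<bar>x\<bar> \<ge> 1 / d}) \<le> measure (\<mu> n) {-R<..R}"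
        using that(2) by (intro \<mu>.finite_measure_mono) auto
      ultimately show ?thesis by linarith
    qed
    have "eventually (\<lambda>R. 1 - \<epsilon> < measure (\<mu> n) {- real R<..real R}) sequentially" for n
    proof -
      have inc: "incseq (\<lambda>R. {- real R<..real R})" by (auto simp: incseq_def)
      have "(\<Union>R. {- real R<..real R}) = UNIV"
        by (auto, metis leI le_less_trans less_imp_le minus_less_iff reals_Archimedean2)
      then have "(\<lambda>R. measure (\<mu> n) {- real R<..real R}) \<longlonglongrightarrow> 1"
        using \<mu>.finite_Lim_measure_incseq[OF _ inc, of n] \<mu>.prob_space[of n]
        by (simp add: image_subset_iff)
      then show ?thesis using e by (intro order_tendstoD) auto
    qed
    then have "eventually (\<lambda>R. \<forall>n\<in>{..<N}. 1 - \<epsilon> < measure (\<mu> n) {- real R<..real R}) sequentially"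
      by (intro eventually_ball_finite) auto
    moreover have "eventually (\<lambda>R. real R \<ge> 1 / d) sequentially"
      by (rule eventually_sequentiallyI[of "nat \<lceil>1 / d\<rceil>"]) linarith
    ultimately have "eventually (\<lambda>R. (\<forall>n\<in>{..<N}. 1 - \<epsilon> < measure (\<mu> n) {- real R<..real R}) \<and> real R \<ge> 1 / d) sequentially"
      by eventually_elim auto
    then obtain R :: nat where R: "\<forall>n\<in>{..<N}. 1 - \<epsilon> < measure (\<mu> n) {- real R<..real R}" "real R \<ge> 1 / d"
      by (auto simp: eventually_sequentially)
    have "1 - \<epsilon> < measure (\<mu> n) {- real R<..real R}" for n
      using R late[of n R] by (cases "n < N") auto
    moreover have "- real R < real R" using R(2) d by (smt (verit) divide_pos_pos)
    ultimately show ?thesis by blast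
  qed
  then have "tight \<mu>" unfolding tight_def using real by auto
  from tight_imp_convergent_subsubsequence[OF this strict_mono_id]
  obtain r M where r: "strict_mono r" "real_distribution M" "weak_conv_m (\<mu> \<circ> id \<circ> r) M" by blast
  have "char M t = \<phi> t" for t
  proof (rule LIMSEQ_unique)
    show "(\<lambda>n. char ((\<mu> \<circ> id \<circ> r) n) t) \<longlonglongrightarrow> char M t"
      using r real by (intro levy_continuity1) (auto simp: o_def)
    show "(\<lambda>n. char ((\<mu> \<circ> id \<circ> r) n) t) \<longlonglongrightarrow> \<phi> t"
      using LIMSEQ_subseq_LIMSEQ[OF lim r(1), of t] by (simp add: o_def)
  qed
  then show ?thesis using r(2) by auto
qed

section \<open>Bochner's theorem\<close>

text \<open>
  The definition sums over a family of points indexed by \<open>{..<n}\<close>; for the integrals below it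
  is more convenient to sum over a finite set of points.
\<close>

lemma positive_definite_finite_sum:
  assumes "positive_definite \<phi>" "finite A"
  shows "(\<Sum>a\<in>A. \<Sum>b\<in>A. c a * cnj (c b) * \<phi> (a - b)) \<in> \<real>\<^sub>\<ge>\<^sub>0"
proof -
  obtain h where h: "bij_betw h {0..<card A} A" using ex_bij_betw_nat_finite[OF assms(2)] by blast
  have "(\<Sum>a\<in>A. \<Sum>b\<in>A. c a * cnj (c b) * \<phi> (a - b))
      = (\<Sum>j<card A. \<Sum>k<card A. c (h j) * cnj (c (h k)) * \<phi> (h j - h k))"
    by (simp add: sum.reindex_bij_betw[OF h, symmetric] atLeast0LessThan)
  then show ?thesis using assms(1) unfolding positive_definite_def by auto
qed

text \<open>
  Everything comes from the \<open>2 \<times> 2\<close> matrix of the points \<open>0\<close> and \<open>t\<close> with coefficients \<open>1\<close> and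
  \<open>z\<close>: the choices \<open>z = 1\<close> and \<open>z = \<i>\<close> give the symmetry, and the unimodular \<open>z\<close> that turns \<open>z *
  \<phi> t\<close> into \<open>- cmod (\<phi> t)\<close> gives the bound.
\<close>

lemma positive_definite_minus_and_bound:
  assumes "positive_definite \<phi>" "\<phi> 0 = 1"
  shows "\<phi> (- t) = cnj (\<phi> t)" "cmod (\<phi> t) \<le> 1"
proof -
  have two: "1 + cmod z ^ 2 + z * \<phi> t + cnj z * \<phi> (- t) \<in> \<real>\<^sub>\<ge>\<^sub>0" for z
  proof -
    have "(\<Sum>j<(2::nat). \<Sum>k<(2::nat). (if j = 0 then 1 else z) * cnj (if k = 0 then 1 else z)
        * \<phi> ((if j = 0 then 0 else t) - (if k = (0::nat) then 0 else t))) \<in> \<real>\<^sub>\<ge>\<^sub>0"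
      using assms(1)[unfolded positive_definite_def, rule_format,
          of "\<lambda>j. if j = 0 then 1 else z" "\<lambda>j. if j = 0 then 0 else t" 2] .
    then show ?thesis
      by (simp add: numeral_2_eq_2 assms(2) complex_norm_square[symmetric] algebra_simps del: cnj.simps)
  qed
  have 1: "Im (\<phi> t) + Im (\<phi> (- t)) = 0" using two[of 1] by (simp add: complex_nonneg_Reals_iff)
  have 2: "Re (\<phi> t) - Re (\<phi> (- t)) = 0" using two[of \<i>] by (simp add: complex_nonneg_Reals_iff)
  show c: "\<phi> (- t) = cnj (\<phi> t)" using 1 2 by (simp add: complex_eq_iff)
  show "cmod (\<phi> t) \<le> 1"
  proof (cases "\<phi> t = 0")
    case False
    define z where "z = - cnj (\<phi> t) / cmod (\<phi> t)"
    have "cmod z = 1" using False by (simp add: z_def norm_divide)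
    moreover have "z * \<phi> t = - cmod (\<phi> t)"
      using False complex_norm_square[of "\<phi> t"]
      by (simp add: z_def power2_eq_square field_simps)
    moreover from this have "cnj z * \<phi> (- t) = - cmod (\<phi> t)"
      unfolding c by (metis complex_cnj_mult complex_cnj_complex_of_real complex_cnj_minus)
    ultimately show ?thesis using two[of z] by (simp add: complex_nonneg_Reals_iff)
  qed simp
qed

lemma integral_comp_simple_function:
  fixes g :: "real \<Rightarrow> complex"
  assumes "real_distribution N" and r: "simple_function N r"
  shows "(\<integral>x. g (r x) \<partial>N) = (\<Sum>a\<in>range r. of_real (measure N (r -` {a})) * g a)"
proof -
  interpret N: real_distribution N by fact
  have fin: "finite (range r)" and m: "\<And>a. a \<in> range r \<Longrightarrow> r -` {a} \<in> sets borel"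
    using r unfolding simple_function_def by auto
  have "(\<integral>x. g (r x) \<partial>N) = (\<integral>x. (\<Sum>a\<in>range r. indicator (r -` {a}) x *\<^sub>R g a) \<partial>N)"
  proof (rule Bochner_Integration.integral_cong[OF refl])
    fix x
    have "(\<Sum>a\<in>range r. indicator (r -` {a}) x *\<^sub>R g a) = (\<Sum>a\<in>range r. if a = r x then g a else 0)"
      by (intro sum.cong) auto
    then show "g (r x) = (\<Sum>a\<in>range r. indicator (r -` {a}) x *\<^sub>R g a)" using fin by simp
  qed
  also have "\<dots> = (\<Sum>a\<in>range r. \<integral>x. indicator (r -` {a}) x *\<^sub>R g a \<partial>N)"
    using m by (intro Bochner_Integration.integral_sum integrable_scaleR_left) (auto simp: N.emeasure_eq_measure)
  also have "\<dots> = (\<Sum>a\<in>range r. of_real (measure N (r -` {a})) * g a)"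
    using m by (intro sum.cong) (auto simp: N.emeasure_eq_measure scaleR_conv_of_real)
  finally show ?thesis .
qed

text \<open>
  Rounding the variable to finitely many values replaces an integral by a finite sum. This is
  used for double integrals of positive definite functions, and later to approximate the
  functional of a measure on the midline by point evaluations.
\<close>

lemma simple_approximation_of_identity:
  assumes "real_distribution N"
  obtains r :: "nat \<Rightarrow> real \<Rightarrow> real" where
    "\<And>n. simple_function N (r n)" "\<And>x. (\<lambda>n. r n x) \<longlonglongrightarrow> x"
proof -
  interpret N: real_distribution N by fact
  have "(\<lambda>x. x) \<in> borel_measurable N" by simp
  from borel_measurable_implies_sequence_metric[OF this, of 0]
  obtain F where "\<And>i. simple_function N (F i)" "\<And>x. (\<lambda>i. F i x) \<longlonglongrightarrow> x" by auto
  then show thesis by (rule that)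
qed

text \<open>
  If both variables are rounded to the values of a simple function, the double integral is a
  finite sum of the shape in the definition of positive definiteness, with the coefficient at
  \<open>a\<close> weighted by the mass of \<open>a\<close>. Dominated convergence removes the rounding.
\<close>

lemma positive_definite_double_integral:
  assumes pd: "positive_definite \<phi>" and phi0: "\<phi> 0 = 1" and cont: "continuous_on UNIV \<phi>"
    and N: "real_distribution N" and c: "continuous_on UNIV c" "\<And>x. cmod (c x) \<le> 1"
  shows "(\<integral>s. (\<integral>t. c s * cnj (c t) * \<phi> (s - t) \<partial>N) \<partial>N) \<in> \<real>\<^sub>\<ge>\<^sub>0"
proof -
  interpret N: real_distribution N by fact
  obtain r where r: "\<And>n. simple_function N (r n)" and lim: "\<And>x. (\<lambda>n. r n x) \<longlonglongrightarrow> x"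
    using simple_approximation_of_identity[OF N] by blast
  have [measurable]: "r n \<in> borel_measurable borel" for n
    using borel_measurable_simple_function[OF r] by simp
  have [measurable]: "c \<in> borel_measurable borel" "\<phi> \<in> borel_measurable borel"
    using c(1) cont by (auto intro: borel_measurable_continuous_onI)
  have [measurable]: "cnj \<in> borel_measurable borel"
    by (intro borel_measurable_continuous_onI continuous_intros)
  define G where "G s t = c s * cnj (c t) * \<phi> (s - t)" for s t
  have GB: "cmod (G s t) \<le> 1" for s t
    using mult_mono[OF mult_mono[OF c(2)[of s] c(2)[of t]] positive_definite_minus_and_bound(2)[OF pd phi0, of "s - t"]]
    by (simp add: G_def norm_mult)
  have Gm: "(\<lambda>t. G s (f t)) \<in> borel_measurable borel" if [measurable]: "f \<in> borel_measurable borel" for s f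
    unfolding G_def by measurable
  have IB: "cmod (\<integral>t. G s (f t) \<partial>N) \<le> 1" for s f
  proof (cases "integrable N (\<lambda>t. G s (f t))")
    case True
    have "cmod (\<integral>t. G s (f t) \<partial>N) \<le> (\<integral>t. cmod (G s (f t)) \<partial>N)" by (rule integral_norm_bound)
    also have "\<dots> \<le> (\<integral>t. 1 \<partial>N)" using True by (intro integral_mono GB) auto
    finally show ?thesis using N.prob_space by simp
  qed (simp add: not_integrable_integral_eq)
  have inner: "(\<lambda>n. \<integral>t. G (r n s) (r n t) \<partial>N) \<longlonglongrightarrow> (\<integral>t. G s t \<partial>N)" for s
  proof (rule integral_dominated_convergence[where w = "\<lambda>_. 1"])
    have ic: "isCont c x" "isCont \<phi> x" for x using c(1) cont by (auto simp: continuous_on_eq_continuous_at)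
    have "(\<lambda>n. G (r n s) (r n t)) \<longlonglongrightarrow> G s t" for t
      unfolding G_def by (intro tendsto_intros isCont_tendsto_compose[OF ic(1)] isCont_tendsto_compose[OF ic(2)] lim)
    then show "AE t in N. (\<lambda>n. G (r n s) (r n t)) \<longlonglongrightarrow> G s t" by simp
  qed (use GB Gm[of "\<lambda>x. x" s] Gm[of "r n" "r n s" for n] in auto)
  have meas: "(\<lambda>s. \<integral>t. G (r n s) (r n t) \<partial>N) \<in> borel_measurable N" for n
    unfolding G_def by measurable
  have "(\<lambda>n. \<integral>s. (\<integral>t. G (r n s) (r n t) \<partial>N) \<partial>N) \<longlonglongrightarrow> (\<integral>s. (\<integral>t. G s t \<partial>N) \<partial>N)"
  proof (rule integral_dominated_convergence[where w = "\<lambda>_. 1"])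
    show "(\<lambda>s. \<integral>t. G s t \<partial>N) \<in> borel_measurable N" unfolding G_def by measurable
  qed (use inner IB meas in auto)
  moreover have "(\<integral>s. (\<integral>t. G (r n s) (r n t) \<partial>N) \<partial>N) \<in> \<real>\<^sub>\<ge>\<^sub>0" for n
  proof -
    define p where "p a = complex_of_real (measure N (r n -` {a}))" for a
    have "(\<integral>s. (\<integral>t. G (r n s) (r n t) \<partial>N) \<partial>N)
        = (\<Sum>a\<in>range (r n). p a * (\<Sum>b\<in>range (r n). p b * G a b))"
      unfolding p_def
      by (subst integral_comp_simple_function[OF N r, of "\<lambda>s. \<integral>t. G s (r n t) \<partial>N"],
          subst integral_comp_simple_function[OF N r], rule refl)
    also have "\<dots> = (\<Sum>a\<in>range (r n). \<Sum>b\<in>range (r n). (p a * c a) * cnj (p b * c b) * \<phi> (a - b))"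
      by (simp add: sum_distrib_left G_def p_def mult_ac)
    also have "\<dots> \<in> \<real>\<^sub>\<ge>\<^sub>0"
      using r[of n] unfolding simple_function_def
      by (intro positive_definite_finite_sum[OF pd]) auto
    finally show ?thesis .
  qed
  ultimately show ?thesis
    unfolding G_def by (rule closed_sequentially[OF closed_nonneg_Reals_complex, rotated])
qed

text \<open>
  Both laws have characteristic function \<open>exp (- y\<^sup>2)\<close>, and characteristic functions determine
  laws.
\<close>

lemma distr_diff_std_normal:
  "distr (std_normal_distribution \<Otimes>\<^sub>M std_normal_distribution) borel (\<lambda>p. fst p - snd p)
    = distr std_normal_distribution borel (\<lambda>s. sqrt 2 * s)" (is "?L = ?R")
proof (rule Levy_uniqueness)
  let ?N = std_normal_distribution
  interpret N: real_distribution ?N by (rule real_dist_normal_dist)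
  interpret P: pair_prob_space ?N ?N ..
  show "real_distribution ?L" by (rule P.real_distribution_distr) simp
  show "real_distribution ?R" by (rule N.real_distribution_distr) simp
  have int: "integrable ?N (\<lambda>x. iexp (y * x))" for y
    by (rule N.integrable_const_bound[of _ 1]) auto
  have "char ?L y = char ?R y" for y
  proof -
    have "char ?L y = (\<integral>p. iexp (y * (fst p - snd p)) \<partial>(?N \<Otimes>\<^sub>M ?N))"
      unfolding char_def by (subst integral_distr) auto
    also have "\<dots> = (\<integral>s. (\<integral>t. iexp (y * (s - t)) \<partial>?N) \<partial>?N)"
    proof (subst P.integral_fst'[symmetric])
      show "integrable (?N \<Otimes>\<^sub>M ?N) (\<lambda>p. iexp (y * (fst p - snd p)))"
        by (rule P.integrable_const_bound[of _ 1]) (auto simp del: of_real_mult of_real_diff)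
    qed simp
    also have "\<dots> = (\<integral>s. iexp (y * s) * char ?N (- y) \<partial>?N)"
    proof (rule Bochner_Integration.integral_cong[OF refl])
      fix s
      have "(\<integral>t. iexp (y * (s - t)) \<partial>?N) = (\<integral>t. iexp (y * s) * iexp (- y * t) \<partial>?N)"
        by (intro Bochner_Integration.integral_cong refl) (simp add: exp_add[symmetric] algebra_simps)
      also have "\<dots> = iexp (y * s) * char ?N (- y)"
        unfolding char_def by (rule Bochner_Integration.integral_mult_right) (rule int)
      finally show "(\<integral>t. iexp (y * (s - t)) \<partial>?N) = iexp (y * s) * char ?N (- y)" .
    qed
    also have "\<dots> = char ?N y * char ?N (- y)"
      unfolding char_def[of _ y] by (rule Bochner_Integration.integral_mult_left) (rule int)
    also have "\<dots> = of_real (exp (- (sqrt 2 * y)\<^sup>2 / 2))"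
      by (simp add: char_std_normal_distribution power_mult_distrib exp_add[symmetric] of_real_mult[symmetric]
          del: of_real_mult of_real_exp)
    also have "\<dots> = char ?N (sqrt 2 * y)" by (simp add: char_std_normal_distribution)
    also have "\<dots> = char ?R y"
      unfolding char_def by (subst integral_distr) (auto simp: mult_ac)
    finally show ?thesis .
  qed
  then show "char ?L = char ?R" by auto
qed

text \<open>
  The Fourier transform of \<open>\<phi>\<close> times a Gaussian is nonnegative, because it is a double integral
  of \<open>c s * cnj (c t) * \<phi> (s - t)\<close> with \<open>c\<close> a character: the difference of two independent
  normal variables is again normal.
\<close>

lemma positive_definite_gaussian_transform:
  assumes pd: "positive_definite \<phi>" and phi0: "\<phi> 0 = 1" and cont: "continuous_on UNIV \<phi>"
  shows "(\<integral>s. \<phi> (\<tau> * s) * iexp (- (\<tau> * s * x)) \<partial>std_normal_distribution) \<in> \<real>\<^sub>\<ge>\<^sub>0"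
proof -
  let ?N = std_normal_distribution
  interpret N: real_distribution ?N by (rule real_dist_normal_dist)
  interpret P: pair_prob_space ?N ?N ..
  \<comment> \<open>The difference of two independent standard normal variables has standard deviation
     \<open>sqrt 2\<close>, which is divided out in advance.\<close>
  define \<theta> where "\<theta> = \<tau> / sqrt 2"
  define h where "h u = \<phi> (\<theta> * u) * iexp (- (\<theta> * u * x))" for u
  have hc: "continuous_on UNIV h"
    unfolding h_def by (intro continuous_intros continuous_on_compose2[OF cont]) auto
  then have [measurable]: "h \<in> borel_measurable borel" by (rule borel_measurable_continuous_onI)
  have hB: "cmod (h u) \<le> 1" for u
    using positive_definite_minus_and_bound(2)[OF pd phi0] by (simp add: h_def norm_mult del: of_real_mult of_real_minus)
  have pd': "positive_definite (\<lambda>u. \<phi> (\<theta> * u))"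
    unfolding positive_definite_def
  proof (intro allI)
    fix n :: nat and t :: "nat \<Rightarrow> real" and c :: "nat \<Rightarrow> complex"
    show "(\<Sum>j<n. \<Sum>k<n. c j * cnj (c k) * \<phi> (\<theta> * (t j - t k))) \<in> \<real>\<^sub>\<ge>\<^sub>0"
      using pd[unfolded positive_definite_def, rule_format, of c "\<lambda>j. \<theta> * t j" n] by (simp add: right_diff_distrib)
  qed
  have "(\<integral>s. (\<integral>t. iexp (- (\<theta> * s * x)) * cnj (iexp (- (\<theta> * t * x))) * \<phi> (\<theta> * (s - t)) \<partial>?N) \<partial>?N) \<in> \<real>\<^sub>\<ge>\<^sub>0"
    by (rule positive_definite_double_integral[OF pd' _ _ real_dist_normal_dist])
       (auto intro!: continuous_intros continuous_on_compose2[OF cont] simp: phi0 simp del: of_real_mult of_real_minus)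
  also have "(\<lambda>s t. iexp (- (\<theta> * s * x)) * cnj (iexp (- (\<theta> * t * x))) * \<phi> (\<theta> * (s - t))) = (\<lambda>s t. h (s - t))"
    by (intro ext) (simp add: h_def exp_cnj exp_add[symmetric] algebra_simps)
  also have "(\<integral>s. (\<integral>t. h (s - t) \<partial>?N) \<partial>?N) = (\<integral>p. h (fst p - snd p) \<partial>(?N \<Otimes>\<^sub>M ?N))"
  proof (subst P.integral_fst'[symmetric])
    show "integrable (?N \<Otimes>\<^sub>M ?N) (\<lambda>p. h (fst p - snd p))"
      by (rule P.integrable_const_bound[of _ 1]) (auto simp: hB)
  qed simp
  also have "\<dots> = (\<integral>u. h u \<partial>distr (?N \<Otimes>\<^sub>M ?N) borel (\<lambda>p. fst p - snd p))"
    by (subst integral_distr) auto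
  also have "\<dots> = (\<integral>s. h (sqrt 2 * s) \<partial>?N)"
    unfolding distr_diff_std_normal by (subst integral_distr) auto
  also have "(\<lambda>s. h (sqrt 2 * s)) = (\<lambda>s. \<phi> (\<tau> * s) * iexp (- (\<tau> * s * x)))"
    by (simp add: h_def \<theta>_def)
  finally show ?thesis .
qed

text \<open>
  The substitution \<open>\<tau> s = t + \<delta> v\<close>. On the left the factor centred at \<open>t\<close> is the kernel and the
  standard normal density is the weight; on the right they have exchanged roles.
\<close>

lemma gaussian_change_of_variables:
  fixes \<phi> :: "real \<Rightarrow> complex"
  assumes [measurable]: "\<phi> \<in> borel_measurable borel" and pos: "\<delta> > 0" "\<tau> > 0"
  shows "(\<integral>s. \<phi> (\<tau> * s) * of_real (exp (- ((t - \<tau> * s) / \<delta>)\<^sup>2 / 2)) \<partial>std_normal_distribution)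
    = of_real (\<delta> / \<tau>) * (\<integral>v. \<phi> (t + \<delta> * v) * of_real (exp (- ((t + \<delta> * v) / \<tau>)\<^sup>2 / 2)) \<partial>std_normal_distribution)"
    (is "?L = _ * ?R")
proof -
  define F where "F s = std_normal_density s *\<^sub>R (\<phi> (\<tau> * s) * of_real (exp (- ((t - \<tau> * s) / \<delta>)\<^sup>2 / 2)))" for s
  have "?L = (\<integral>s. F s \<partial>lborel)"
    unfolding F_def by (subst integral_density) (auto simp: normal_density_nonneg)
  also have "\<dots> = \<bar>\<delta> / \<tau>\<bar> *\<^sub>R (\<integral>v. F (t / \<tau> + (\<delta> / \<tau>) * v) \<partial>lborel)"
    using pos by (intro lborel_integral_real_affine) auto
  also have "(\<lambda>v. F (t / \<tau> + (\<delta> / \<tau>) * v))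
      = (\<lambda>v. std_normal_density v *\<^sub>R (\<phi> (t + \<delta> * v) * of_real (exp (- ((t + \<delta> * v) / \<tau>)\<^sup>2 / 2))))"
  proof
    fix v
    have 1: "\<tau> * (t / \<tau> + (\<delta> / \<tau>) * v) = t + \<delta> * v" using pos by (simp add: field_simps)
    have 2: "t / \<tau> + (\<delta> / \<tau>) * v = (t + \<delta> * v) / \<tau>" using pos by (simp add: field_simps)
    have 3: "(t - (t + \<delta> * v)) / \<delta> = - v" using pos by simp
    show "F (t / \<tau> + (\<delta> / \<tau>) * v)
      = std_normal_density v *\<^sub>R (\<phi> (t + \<delta> * v) * of_real (exp (- ((t + \<delta> * v) / \<tau>)\<^sup>2 / 2)))"
      unfolding F_def 1 3 unfolding 2 std_normal_density_def
      by (simp add: scaleR_conv_of_real mult_ac del: of_real_exp)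
  qed
  also have "(\<integral>v. std_normal_density v *\<^sub>R (\<phi> (t + \<delta> * v) * of_real (exp (- ((t + \<delta> * v) / \<tau>)\<^sup>2 / 2))) \<partial>lborel) = ?R"
    by (subst integral_density) (auto simp: normal_density_nonneg)
  finally show ?thesis using pos by (simp add: scaleR_conv_of_real)
qed

text \<open>
  For small \<open>\<delta>\<close> and large \<open>\<tau>\<close> the function \<open>A\<close> is a regularisation of \<open>\<phi>\<close>: it is \<open>\<phi>\<close> times a
  wide Gaussian, convolved with a narrow one. The nonnegative transform of
  \<open>positive_definite_gaussian_transform\<close>, weighted with a Gaussian density, defines a finite
  measure, and an exchange of integrals shows that its characteristic function is a multiple of
  \<open>A\<close>.
\<close>

lemma gaussian_regularisation_is_char:
  assumes pd: "positive_definite \<phi>" and phi0: "\<phi> 0 = 1" and cont: "continuous_on UNIV \<phi>"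
    and pos: "\<delta> > 0" "\<tau> > 0"
  defines "A \<equiv> \<lambda>t. \<integral>v. \<phi> (t + \<delta> * v) * of_real (exp (- ((t + \<delta> * v) / \<tau>)\<^sup>2 / 2)) \<partial>std_normal_distribution"
  assumes A0: "A 0 \<noteq> 0"
  shows "\<exists>\<mu>. real_distribution \<mu> \<and> (\<forall>t. char \<mu> t = A t / A 0)"
proof -
  let ?N = std_normal_distribution
  interpret N: real_distribution ?N by (rule real_dist_normal_dist)
  have [measurable]: "\<phi> \<in> borel_measurable borel" using cont by (rule borel_measurable_continuous_onI)
  note bd = positive_definite_minus_and_bound(2)[OF pd phi0]
  define q where "q y = (\<integral>s. \<phi> (\<tau> * s) * iexp (- (\<tau> * s * (y / \<delta>))) \<partial>?N)" for y
  define B where "B t = (\<integral>s. \<phi> (\<tau> * s) * of_real (exp (- ((t - \<tau> * s) / \<delta>)\<^sup>2 / 2)) \<partial>?N)" for t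
  have qnn: "q y \<in> \<real>\<^sub>\<ge>\<^sub>0" for y unfolding q_def by (rule positive_definite_gaussian_transform[OF pd phi0 cont])
  have qre: "q y = of_real (Re (q y))" "Re (q y) \<ge> 0" for y
    using qnn[of y] by (auto simp: complex_nonneg_Reals_iff complex_eq_iff)
  have [measurable]: "q \<in> borel_measurable borel" unfolding q_def by measurable
  have qB: "cmod (q y) \<le> 1" for y
  proof -
    have int: "integrable ?N (\<lambda>s. \<phi> (\<tau> * s) * iexp (- (\<tau> * s * (y / \<delta>))))"
      by (rule N.integrable_const_bound[of _ 1]) (auto simp: norm_mult bd simp del: of_real_mult of_real_minus)
    have "cmod (q y) \<le> (\<integral>s. 1 \<partial>?N)"
      unfolding q_def
      by (intro order_trans[OF integral_norm_bound] integral_mono integrable_norm int)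
         (auto simp: norm_mult bd simp del: of_real_mult of_real_minus)
    then show ?thesis using N.prob_space by simp
  qed
  have qint: "integrable ?N q" by (rule N.integrable_const_bound[of _ 1]) (auto simp: qB)
  have BA: "B t = of_real (\<delta> / \<tau>) * A t" for t
    unfolding B_def A_def by (rule gaussian_change_of_variables) (use pos in auto)
  have Bq: "(\<integral>y. q y * iexp (t * (y / \<delta>)) \<partial>?N) = B t" for t
  proof -
    have "(\<integral>y. q y * iexp (t * (y / \<delta>)) \<partial>?N)
        = (\<integral>y. (\<integral>s. \<phi> (\<tau> * s) * iexp ((t - \<tau> * s) / \<delta> * y) \<partial>?N) \<partial>?N)"
      unfolding q_def
    proof (intro Bochner_Integration.integral_cong refl, subst Bochner_Integration.integral_mult_left[symmetric])
      fix y
      show "integrable ?N (\<lambda>s. \<phi> (\<tau> * s) * iexp (- (\<tau> * s * (y / \<delta>))))"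
        by (rule N.integrable_const_bound[of _ 1]) (auto simp: norm_mult bd simp del: of_real_mult of_real_minus)
      show "(\<integral>s. \<phi> (\<tau> * s) * iexp (- (\<tau> * s * (y / \<delta>))) * iexp (t * (y / \<delta>)) \<partial>?N)
          = (\<integral>s. \<phi> (\<tau> * s) * iexp ((t - \<tau> * s) / \<delta> * y) \<partial>?N)"
        by (intro Bochner_Integration.integral_cong refl)
           (simp add: mult.assoc exp_add[symmetric] diff_divide_distrib algebra_simps)
    qed
    also have "\<dots> = (\<integral>s. (\<integral>y. \<phi> (\<tau> * s) * iexp ((t - \<tau> * s) / \<delta> * y) \<partial>?N) \<partial>?N)"
    proof (rule Fubini_bounded[of _ _ _ 1])
      show "(\<lambda>p. \<phi> (\<tau> * fst p) * iexp ((t - \<tau> * fst p) / \<delta> * snd p)) \<in> borel_measurable (borel \<Otimes>\<^sub>M borel)"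
        by measurable
    qed (auto simp: norm_mult bd real_dist_normal_dist simp del: of_real_mult)
    also have "\<dots> = (\<integral>s. \<phi> (\<tau> * s) * char ?N ((t - \<tau> * s) / \<delta>) \<partial>?N)"
      unfolding char_def by (intro Bochner_Integration.integral_cong refl Bochner_Integration.integral_mult_right)
         (rule N.integrable_const_bound[of _ 1], auto simp del: of_real_mult)
    also have "\<dots> = B t" by (simp add: B_def char_std_normal_distribution)
    finally show ?thesis .
  qed
  define Z where "Z = (\<integral>y. Re (q y) \<partial>?N)"
  have ZB: "of_real Z = B 0"
  proof -
    have "complex_of_real Z = (\<integral>y. q y \<partial>?N)"
      unfolding Z_def integral_complex_of_real[symmetric] using qre(1) by simp
    then show ?thesis using Bq[of 0] by simp
  qed
  have "Z \<ge> 0" unfolding Z_def using qre(2) by (intro integral_nonneg_AE) auto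
  moreover have "Z \<noteq> 0" using ZB BA[of 0] A0 pos by auto
  ultimately have Z: "Z > 0" by simp
  define D where "D = density ?N (\<lambda>y. ennreal (Re (q y) / Z))"
  have iR: "integrable ?N (\<lambda>y. Re (q y) / Z)" using qint by auto
  interpret D: prob_space D
  proof
    have "emeasure D (space D) = (\<integral>\<^sup>+y. ennreal (Re (q y) / Z) \<partial>?N)"
      unfolding D_def by (subst emeasure_density) auto
    also have "\<dots> = ennreal (\<integral>y. Re (q y) / Z \<partial>?N)"
      using qre(2) Z by (intro nn_integral_eq_integral iR) auto
    also have "(\<integral>y. Re (q y) / Z \<partial>?N) = 1" using Z by (simp add: Z_def[symmetric])
    finally show "emeasure D (space D) = 1" by simp
  qed
  have mD: "(\<lambda>y. y / \<delta>) \<in> borel_measurable D" unfolding D_def by measurable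
  define \<mu> where "\<mu> = distr D borel (\<lambda>y. y / \<delta>)"
  have "char \<mu> t = A t / A 0" for t
  proof -
    have "char \<mu> t = (\<integral>y. iexp (t * (y / \<delta>)) \<partial>D)"
      unfolding char_def \<mu>_def using mD by (subst integral_distr) auto
    also have "\<dots> = (\<integral>y. (Re (q y) / Z) *\<^sub>R iexp (t * (y / \<delta>)) \<partial>?N)"
      unfolding D_def using qre(2) Z by (subst integral_density) auto
    also have "\<dots> = (\<integral>y. q y * iexp (t * (y / \<delta>)) / of_real Z \<partial>?N)"
    proof (intro Bochner_Integration.integral_cong refl)
      fix y
      show "(Re (q y) / Z) *\<^sub>R iexp (t * (y / \<delta>)) = q y * iexp (t * (y / \<delta>)) / of_real Z"
        by (subst qre(1)) (simp add: scaleR_conv_of_real)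
    qed
    also have "\<dots> = B t / of_real Z" by (simp add: Bq[symmetric])
    also have "\<dots> = A t / A 0" using pos unfolding ZB BA by simp
    finally show ?thesis .
  qed
  moreover have "real_distribution \<mu>" unfolding \<mu>_def by (rule D.real_distribution_distr[OF mD])
  ultimately show ?thesis by blast
qed

text \<open>
  The regularisations with \<open>\<delta> = 1 / (n + 1)\<close> and \<open>\<tau> = n + 1\<close> are characteristic functions up to
  normalisation and converge pointwise to \<open>\<phi>\<close>, so the existence form of the continuity theorem
  applies.
\<close>

theorem Bochner:
  assumes pd: "positive_definite \<phi>" and phi0: "\<phi> 0 = 1" and cont: "continuous_on UNIV \<phi>"
  shows "\<exists>\<mu>. real_distribution \<mu> \<and> char \<mu> = \<phi>"
proof -
  interpret N: real_distribution std_normal_distribution by (rule real_dist_normal_dist)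
  have [measurable]: "\<phi> \<in> borel_measurable borel" using cont by (rule borel_measurable_continuous_onI)
  have ic: "isCont \<phi> t" for t using cont by (auto simp: continuous_on_eq_continuous_at)
  note bd = positive_definite_minus_and_bound(2)[OF pd phi0]
  define \<delta> where "\<delta> n = 1 / real (Suc n)" for n
  define A where "A n t = (\<integral>v. \<phi> (t + \<delta> n * v) * of_real (exp (- ((t + \<delta> n * v) / real (Suc n))\<^sup>2 / 2)) \<partial>std_normal_distribution)"
    for n t
  have d0: "\<delta> \<longlonglongrightarrow> 0" unfolding \<delta>_def by (intro LIMSEQ_Suc lim_1_over_n)
  have A: "(\<lambda>n. A n t) \<longlonglongrightarrow> \<phi> t" for t
  proof -
    have "(\<lambda>n. A n t) \<longlonglongrightarrow> (\<integral>v. \<phi> t \<partial>std_normal_distribution)"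
      unfolding A_def
    proof (rule gaussian_average_tendsto[where B = 1])
      fix v
      have l1: "(\<lambda>n. t + \<delta> n * v) \<longlonglongrightarrow> t + 0 * v" by (intro tendsto_intros d0)
      have "(\<lambda>n. - ((t + \<delta> n * v) * \<delta> n)\<^sup>2 / 2) \<longlonglongrightarrow> - ((t + 0 * v) * 0)\<^sup>2 / 2"
        by (intro tendsto_intros d0) auto
      then have "(\<lambda>n. complex_of_real (exp (- ((t + \<delta> n * v) / real (Suc n))\<^sup>2 / 2))) \<longlonglongrightarrow> of_real (exp 0)"
        by (intro tendsto_of_real tendsto_exp) (simp add: \<delta>_def)
      moreover have "(\<lambda>n. \<phi> (t + \<delta> n * v)) \<longlonglongrightarrow> \<phi> t"
        by (rule isCont_tendsto_compose[OF ic]) (use l1 in simp)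
      ultimately have "(\<lambda>n. \<phi> (t + \<delta> n * v) * complex_of_real (exp (- ((t + \<delta> n * v) / real (Suc n))\<^sup>2 / 2))) \<longlonglongrightarrow> \<phi> t * of_real (exp 0)"
        by (intro tendsto_mult) auto
      then show "(\<lambda>n. \<phi> (t + \<delta> n * v) * complex_of_real (exp (- ((t + \<delta> n * v) / real (Suc n))\<^sup>2 / 2))) \<longlonglongrightarrow> \<phi> t"
        by simp
    next
      fix n v
      have "cmod (\<phi> (t + \<delta> n * v)) * exp (- ((t + \<delta> n * v) / real (Suc n))\<^sup>2 / 2) \<le> 1 * 1"
        by (intro mult_mono bd) auto
      then show "cmod (\<phi> (t + \<delta> n * v) * complex_of_real (exp (- ((t + \<delta> n * v) / real (Suc n))\<^sup>2 / 2))) \<le> 1"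
        by (simp only: norm_mult norm_of_real abs_exp_cancel mult_1)
    qed measurable
    then show ?thesis using N.prob_space by simp
  qed
  have "eventually (\<lambda>n. A n 0 \<noteq> 0) sequentially"
    using A[of 0] by (intro tendsto_imp_eventually_ne) (auto simp: phi0)
  \<comment> \<open>The normalisation divides by \<open>A n 0\<close>, which tends to \<open>\<phi> 0 = 1\<close> and so is nonzero from some
     index on; the sequence starts there.\<close>
  then obtain n0 where n0: "\<And>n. n \<ge> n0 \<Longrightarrow> A n 0 \<noteq> 0" by (auto simp: eventually_sequentially)
  have "\<exists>\<mu>. real_distribution \<mu> \<and> (\<forall>t. char \<mu> t = A (n + n0) t / A (n + n0) 0)" for n
    unfolding A_def
    by (rule gaussian_regularisation_is_char[OF pd phi0 cont]) (use n0[of "n + n0"] in \<open>auto simp: \<delta>_def A_def\<close>)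
  then obtain \<mu> where mu: "\<And>n. real_distribution (\<mu> n)" "\<And>n t. char (\<mu> n) t = A (n + n0) t / A (n + n0) 0"
    by metis
  show ?thesis
  proof (rule char_limit_exists[OF mu(1) _ ic])
    fix t
    have "(\<lambda>n. A (n + n0) t / A (n + n0) 0) \<longlonglongrightarrow> \<phi> t / \<phi> 0"
      by (intro tendsto_divide LIMSEQ_ignore_initial_segment A) (simp add: phi0)
    then show "(\<lambda>n. char (\<mu> n) t) \<longlonglongrightarrow> \<phi> t" by (simp add: mu(2) phi0)
  qed
qed

section \<open>Linear functionals and weak topologies\<close>

lemma is_subspace_indexed_sum:
  assumes "is_subspace V" "\<And>i. i \<in> I \<Longrightarrow> f i \<in> V"
  shows "(\<lambda>x. \<Sum>i\<in>I. c i * f i x) \<in> V"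
  using assms(2)
proof (induction I rule: infinite_finite_induct)
  case (insert i I)
  then show ?case
    using is_subspaceD(2)[OF assms(1) is_subspaceD(3)[OF assms(1), of "f i" "c i"]] by simp
qed (use is_subspaceD(1)[OF assms(1)] in auto)

lemma is_linear_on_indexed_sum:
  assumes "is_subspace V" "is_linear_on V \<phi>" "\<And>i. i \<in> I \<Longrightarrow> f i \<in> V"
  shows "\<phi> (\<lambda>x. \<Sum>i\<in>I. c i * f i x) = (\<Sum>i\<in>I. c i * \<phi> (f i))"
  using assms(3)
proof (induction I rule: infinite_finite_induct)
  case (insert i I)
  have 1: "(\<lambda>x. c i * f i x) \<in> V" using insert by (intro is_subspaceD(3)[OF assms(1)]) auto
  have 2: "(\<lambda>x. \<Sum>i\<in>I. c i * f i x) \<in> V" using insert by (intro is_subspace_indexed_sum[OF assms(1)]) auto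
  have "\<phi> (\<lambda>x. c i * f i x + (\<Sum>i\<in>I. c i * f i x)) = \<phi> (\<lambda>x. c i * f i x) + \<phi> (\<lambda>x. \<Sum>i\<in>I. c i * f i x)"
    by (rule is_linear_onD(1)[OF assms(2) 1 2])
  also have "\<phi> (\<lambda>x. c i * f i x) = c i * \<phi> (f i)"
    using insert by (intro is_linear_onD(2)[OF assms(2)]) auto
  finally show ?case using insert by simp
qed (use is_linear_on_zero[OF assms(1,2)] in auto)

lemma is_subspace_dual_of: "is_subspace (dual_of V N)"
  unfolding is_subspace_def
proof (intro conjI ballI allI)
  show "(\<lambda>x. 0) \<in> dual_of V N" unfolding dual_of_def is_linear_on_def by (auto intro!: exI[of _ 0])
next
  fix u v assume u: "u \<in> dual_of V N" and v: "v \<in> dual_of V N"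
  obtain C D where CD: "\<And>f. f \<in> V \<Longrightarrow> cmod (u f) \<le> C * N f" "\<And>f. f \<in> V \<Longrightarrow> cmod (v f) \<le> D * N f"
    using u v unfolding dual_of_def by blast
  have "cmod (u f + v f) \<le> (C + D) * N f" if "f \<in> V" for f
    using norm_triangle_ineq[of "u f" "v f"] CD[OF that] by (simp add: distrib_right)
  then have "\<exists>C. \<forall>f\<in>V. cmod (u f + v f) \<le> C * N f" by blast
  then show "(\<lambda>x. u x + v x) \<in> dual_of V N"
    using u v unfolding dual_of_def is_linear_on_def by (simp add: algebra_simps)
next
  fix c u assume u: "u \<in> dual_of V N"
  obtain C where C: "\<And>f. f \<in> V \<Longrightarrow> cmod (u f) \<le> C * N f"
    using u unfolding dual_of_def by blast
  have "cmod (c * u f) \<le> (cmod c * C) * N f" if "f \<in> V" for f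
    using mult_left_mono[OF C[OF that], of "cmod c"] by (simp add: norm_mult mult.assoc)
  then have "\<exists>C. \<forall>f\<in>V. cmod (c * u f) \<le> C * N f" by blast
  then show "(\<lambda>x. c * u x) \<in> dual_of V N"
    using u unfolding dual_of_def is_linear_on_def by (simp add: algebra_simps)
qed

text \<open>
  Induction on the number of functionals: on the kernel of one of them the remaining ones
  suffice, and a vector outside this kernel determines the coefficient of the functional that
  was set aside.
\<close>

lemma linear_combination_if_common_kernel:
  assumes "finite \<Phi>" "is_subspace V" "\<And>\<phi>. \<phi> \<in> \<Phi> \<Longrightarrow> is_linear_on V \<phi>" "is_linear_on V \<omega>"
    and "\<And>f. f \<in> V \<Longrightarrow> (\<And>\<phi>. \<phi> \<in> \<Phi> \<Longrightarrow> \<phi> f = 0) \<Longrightarrow> \<omega> f = 0"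
  shows "\<exists>c. \<forall>f\<in>V. \<omega> f = (\<Sum>\<phi>\<in>\<Phi>. c \<phi> * \<phi> f)"
  using assms
proof (induction \<Phi> arbitrary: V rule: finite_induct)
  case empty
  then show ?case by simp
next
  case (insert \<phi>\<^sub>0 \<Phi>)
  note V = insert.prems(1) and lin = insert.prems(2) and lin\<omega> = insert.prems(3)
  define W where "W = {f\<in>V. \<phi>\<^sub>0 f = 0}"
  have lin0: "is_linear_on V \<phi>\<^sub>0" by (rule lin) simp
  have W: "is_subspace W"
    using is_subspaceD[OF V] is_linear_onD[OF lin0] is_linear_on_zero[OF V lin0]
    unfolding is_subspace_def W_def by simp
  have sub: "is_linear_on W \<phi>" if "is_linear_on V \<phi>" for \<phi>
    using that unfolding is_linear_on_def W_def by simp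
  have "\<exists>c. \<forall>f\<in>W. \<omega> f = (\<Sum>\<phi>\<in>\<Phi>. c \<phi> * \<phi> f)"
  proof (rule insert.IH[OF W])
    show "is_linear_on W \<phi>" if "\<phi> \<in> \<Phi>" for \<phi> using sub lin that by simp
    show "\<omega> f = 0" if "f \<in> W" "\<And>\<phi>. \<phi> \<in> \<Phi> \<Longrightarrow> \<phi> f = 0" for f
      using insert.prems(4)[of f] that by (auto simp: W_def)
  qed (rule sub[OF lin\<omega>])
  then obtain c where c: "\<And>f. f \<in> W \<Longrightarrow> \<omega> f = (\<Sum>\<phi>\<in>\<Phi>. c \<phi> * \<phi> f)" by blast
  show ?case
  proof (cases "W = V")
    case True
    show ?thesis
      using c insert.hyps True
      by (intro exI[of _ "c(\<phi>\<^sub>0 := 0)"]) (auto intro!: sum.cong)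
  next
    case False
    then obtain e where e: "e \<in> V" "\<phi>\<^sub>0 e \<noteq> 0" unfolding W_def by blast
    define k where "k = (\<omega> e - (\<Sum>\<phi>\<in>\<Phi>. c \<phi> * \<phi> e)) / \<phi>\<^sub>0 e"
    have "\<omega> f = k * \<phi>\<^sub>0 f + (\<Sum>\<phi>\<in>\<Phi>. c \<phi> * \<phi> f)" if f: "f \<in> V" for f
    proof -
      define a where "a = \<phi>\<^sub>0 f / \<phi>\<^sub>0 e"
      have ae: "(\<lambda>x. a * e x) \<in> V" by (rule is_subspaceD(3)[OF V e(1)])
      have ev: "\<phi> (\<lambda>x. f x - a * e x) = \<phi> f - a * \<phi> e" if "is_linear_on V \<phi>" for \<phi>
        using is_linear_on_diff[OF V that f ae] is_linear_onD(2)[OF that e(1)] by simp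
      have "(\<lambda>x. f x - a * e x) \<in> W"
        using is_subspace_diff[OF V f ae] ev[OF lin0] e(2) by (simp add: W_def a_def)
      from c[OF this] have "\<omega> f - a * \<omega> e = (\<Sum>\<phi>\<in>\<Phi>. c \<phi> * (\<phi> f - a * \<phi> e))"
        using ev[OF lin\<omega>] ev[OF lin] by simp
      also have "\<dots> = (\<Sum>\<phi>\<in>\<Phi>. c \<phi> * \<phi> f) - a * (\<Sum>\<phi>\<in>\<Phi>. c \<phi> * \<phi> e)"
        by (simp add: right_diff_distrib sum_subtractf sum_distrib_left mult.left_commute)
      finally have "\<omega> f = (\<Sum>\<phi>\<in>\<Phi>. c \<phi> * \<phi> f) + a * (\<omega> e - (\<Sum>\<phi>\<in>\<Phi>. c \<phi> * \<phi> e))"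
        unfolding right_diff_distrib diff_eq_eq by (simp only: diff_add_eq add_diff_eq)
      also have "a * (\<omega> e - (\<Sum>\<phi>\<in>\<Phi>. c \<phi> * \<phi> e)) = k * \<phi>\<^sub>0 f" by (simp add: a_def k_def)
      finally show ?thesis by simp
    qed
    moreover have "(\<Sum>\<phi>\<in>\<Phi>. c \<phi> * \<phi> f) = (\<Sum>\<phi>\<in>\<Phi>. (c(\<phi>\<^sub>0 := k)) \<phi> * \<phi> f)" for f
      using insert.hyps by (intro sum.cong) auto
    ultimately show ?thesis
      using insert.hyps by (intro exI[of _ "c(\<phi>\<^sub>0 := k)"]) simp
  qed
qed

text \<open>
  A linear subspace of a finite-dimensional space that every annihilating functional fails to
  separate from a point contains the point; here the space is the image of \<open>V\<close> under the
  functionals in \<open>\<Phi>\<close>. The induction sets one functional \<open>\<phi>\<^sub>0\<close> aside. If it does not vanish on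
  \<open>S\<close>, a vector \<open>e \<in> S\<close> with \<open>\<phi>\<^sub>0 e = 1\<close> moves \<open>f\<close> into its kernel, and the hypothesis for the
  other functionals is recovered by adding the multiple of \<open>\<phi>\<^sub>0\<close> that kills \<open>e\<close>.
\<close>

lemma interpolation_in_subspace:
  assumes "finite \<Phi>" "is_subspace V" "\<And>\<phi>. \<phi> \<in> \<Phi> \<Longrightarrow> is_linear_on V \<phi>" "is_subspace S" "S \<subseteq> V" "f \<in> V"
    and "\<And>c. (\<And>h. h \<in> S \<Longrightarrow> (\<Sum>\<phi>\<in>\<Phi>. c \<phi> * \<phi> h) = 0) \<Longrightarrow> (\<Sum>\<phi>\<in>\<Phi>. c \<phi> * \<phi> f) = 0"
  shows "\<exists>h\<in>S. \<forall>\<phi>\<in>\<Phi>. \<phi> h = \<phi> f"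
  using assms
proof (induction \<Phi> arbitrary: S f rule: finite_induct)
  case empty
  then show ?case using is_subspaceD(1) by auto
next
  case (insert \<phi>\<^sub>0 \<Phi>)
  note V = insert.prems(1) and lin = insert.prems(2) and S = insert.prems(3) and SV = insert.prems(4)
    and f = insert.prems(5) and ann = insert.prems(6)
  have lin0: "is_linear_on V \<phi>\<^sub>0" by (rule lin) simp
  have upd: "(\<Sum>\<phi>\<in>insert \<phi>\<^sub>0 \<Phi>. (c(\<phi>\<^sub>0 := k)) \<phi> * \<phi> h) = k * \<phi>\<^sub>0 h + (\<Sum>\<phi>\<in>\<Phi>. c \<phi> * \<phi> h)" for c k h
  proof -
    have "(\<Sum>\<phi>\<in>\<Phi>. (c(\<phi>\<^sub>0 := k)) \<phi> * \<phi> h) = (\<Sum>\<phi>\<in>\<Phi>. c \<phi> * \<phi> h)"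
      using insert.hyps by (intro sum.cong) auto
    then show ?thesis using insert.hyps by simp
  qed
  show ?case
  proof (cases "\<forall>h\<in>S. \<phi>\<^sub>0 h = 0")
    case True
    have "\<phi>\<^sub>0 f = 0" using ann[of "(\<lambda>_. 0)(\<phi>\<^sub>0 := 1)"] True unfolding upd by simp
    moreover have "\<exists>h\<in>S. \<forall>\<phi>\<in>\<Phi>. \<phi> h = \<phi> f"
    proof (rule insert.IH[OF V _ S SV f])
      show "(\<Sum>\<phi>\<in>\<Phi>. c \<phi> * \<phi> f) = 0" if "\<And>h. h \<in> S \<Longrightarrow> (\<Sum>\<phi>\<in>\<Phi>. c \<phi> * \<phi> h) = 0" for c
        using ann[of "c(\<phi>\<^sub>0 := 0)"] that unfolding upd by simp
    qed (simp add: lin)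
    ultimately show ?thesis using True by auto
  next
    case False
    then obtain e0 where e0: "e0 \<in> S" "\<phi>\<^sub>0 e0 \<noteq> 0" by blast
    define e where "e = (\<lambda>x. (1 / \<phi>\<^sub>0 e0) * e0 x)"
    have eS: "e \<in> S" unfolding e_def by (rule is_subspaceD(3)[OF S e0(1)])
    have e1: "\<phi>\<^sub>0 e = 1"
      using is_linear_onD(2)[OF lin0, of e0 "1 / \<phi>\<^sub>0 e0"] e0 SV by (auto simp: e_def)
    have eV: "e \<in> V" using eS SV by auto
    have ev: "\<phi> (\<lambda>x. g x + a * e x) = \<phi> g + a * \<phi> e" if "is_linear_on V \<phi>" "g \<in> V" for \<phi> g a
      using is_linear_onD(1)[OF that is_subspaceD(3)[OF V eV]] is_linear_onD(2)[OF that(1) eV] by simp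
    have addV: "(\<lambda>x. g x + a * e x) \<in> V" if "g \<in> V" for g a
      by (rule is_subspaceD(2)[OF V that is_subspaceD(3)[OF V eV]])
    have addS: "(\<lambda>x. g x + a * e x) \<in> S" if "g \<in> S" for g a
      by (rule is_subspaceD(2)[OF S that is_subspaceD(3)[OF S eS]])
    define W where "W = {h\<in>S. \<phi>\<^sub>0 h = 0}"
    define g where "g = (\<lambda>x. f x + (- \<phi>\<^sub>0 f) * e x)"
    have gV: "g \<in> V" unfolding g_def by (rule addV[OF f])
    have "\<exists>h\<in>W. \<forall>\<phi>\<in>\<Phi>. \<phi> h = \<phi> g"
    proof (rule insert.IH[OF V _ _ _ gV])
      show "is_subspace W"
        using is_subspaceD[OF S] is_linear_onD[OF lin0] is_linear_on_zero[OF V lin0] SV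
        unfolding is_subspace_def W_def by (simp add: subset_iff)
      show "W \<subseteq> V" using SV by (auto simp: W_def)
      fix c assume c: "\<And>h. h \<in> W \<Longrightarrow> (\<Sum>\<phi>\<in>\<Phi>. c \<phi> * \<phi> h) = 0"
      \<comment> \<open>the coefficient of \<open>\<phi>\<^sub>0\<close> for which the extended combination vanishes at \<open>e\<close>\<close>
      define k where "k = - (\<Sum>\<phi>\<in>\<Phi>. c \<phi> * \<phi> e)"
      have split: "(\<Sum>\<phi>\<in>\<Phi>. c \<phi> * \<phi> (\<lambda>x. h x + a * e x)) = (\<Sum>\<phi>\<in>\<Phi>. c \<phi> * \<phi> h) - a * k" if "h \<in> V" for h a
      proof -
        have "(\<Sum>\<phi>\<in>\<Phi>. c \<phi> * \<phi> (\<lambda>x. h x + a * e x)) = (\<Sum>\<phi>\<in>\<Phi>. c \<phi> * \<phi> h + a * (c \<phi> * \<phi> e))"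
        proof (rule sum.cong[OF refl])
          fix \<phi> assume "\<phi> \<in> \<Phi>"
          then show "c \<phi> * \<phi> (\<lambda>x. h x + a * e x) = c \<phi> * \<phi> h + a * (c \<phi> * \<phi> e)"
            using ev[OF lin that, of \<phi> a] by (simp add: algebra_simps)
        qed
        then show ?thesis by (simp add: sum.distrib sum_distrib_left k_def)
      qed
      have "k * \<phi>\<^sub>0 h + (\<Sum>\<phi>\<in>\<Phi>. c \<phi> * \<phi> h) = 0" if h: "h \<in> S" for h
      proof -
        have hV: "h \<in> V" using h SV by auto
        have "(\<lambda>x. h x + (- \<phi>\<^sub>0 h) * e x) \<in> W"
          using addS[OF h, of "- \<phi>\<^sub>0 h"] ev[OF lin0 hV, of "- \<phi>\<^sub>0 h"] e1 unfolding W_def by simp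
        from c[OF this] show ?thesis using split[OF hV, of "- \<phi>\<^sub>0 h"] by (simp add: add.commute mult.commute)
      qed
      then have "k * \<phi>\<^sub>0 f + (\<Sum>\<phi>\<in>\<Phi>. c \<phi> * \<phi> f) = 0" using ann[of "c(\<phi>\<^sub>0 := k)"] unfolding upd by simp
      then show "(\<Sum>\<phi>\<in>\<Phi>. c \<phi> * \<phi> g) = 0" using split[OF f, of "- \<phi>\<^sub>0 f"] by (simp add: g_def add.commute mult.commute)
    qed (simp add: lin)
    then obtain h where h: "h \<in> S" "\<phi>\<^sub>0 h = 0" "\<And>\<phi>. \<phi> \<in> \<Phi> \<Longrightarrow> \<phi> h = \<phi> g" by (auto simp: W_def)
    have hV: "h \<in> V" using h SV by auto
    have "\<phi> (\<lambda>x. h x + \<phi>\<^sub>0 f * e x) = \<phi> f" if "\<phi> \<in> insert \<phi>\<^sub>0 \<Phi>" for \<phi>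
    proof (cases "\<phi> = \<phi>\<^sub>0")
      case True
      then show ?thesis using ev[OF lin0 hV] h(2) e1 by simp
    next
      case False
      then have "\<phi> h = \<phi> f - \<phi>\<^sub>0 f * \<phi> e"
        using h(3)[of \<phi>] ev[OF lin[OF that] f, of "- \<phi>\<^sub>0 f"] that by (simp add: g_def)
      then show ?thesis using ev[OF lin[OF that] hV] by simp
    qed
    then show ?thesis using addS[OF h(1)] by blast
  qed
qed

lemma weak_topology_neighbourhood:
  assumes "openin (weak_topology V Y) T" "f \<in> T"
  shows "\<exists>\<Phi> e. finite \<Phi> \<and> \<Phi> \<subseteq> Y \<and> e > 0 \<and> {g\<in>V. \<forall>\<phi>\<in>\<Phi>. cmod (\<phi> g - \<phi> f) < e} \<subseteq> T"
proof -
  have "generate_topology_on {{f\<in>V. \<phi> f \<in> U} | \<phi> U. \<phi> \<in> Y \<and> open U} T"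
    using assms(1) unfolding weak_topology_def openin_topology_generated_by_iff .
  then show ?thesis using assms(2)
  proof induction
    case Empty
    then show ?case by simp
  next
    case (Int A B)
    then obtain \<Phi> e \<Psi> d where
      "finite \<Phi>" "\<Phi> \<subseteq> Y" "e > 0" "{g\<in>V. \<forall>\<phi>\<in>\<Phi>. cmod (\<phi> g - \<phi> f) < e} \<subseteq> A"
      "finite \<Psi>" "\<Psi> \<subseteq> Y" "d > 0" "{g\<in>V. \<forall>\<phi>\<in>\<Psi>. cmod (\<phi> g - \<phi> f) < d} \<subseteq> B" by auto
    then show ?case by (intro exI[of _ "\<Phi> \<union> \<Psi>"] exI[of _ "min e d"]) auto
  next
    case (UN K)
    then obtain k where "k \<in> K" "f \<in> k" by blast
    then show ?case using UN.IH[of k] by blast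
  next
    case (Basis s)
    then obtain \<phi> U where s: "s = {f\<in>V. \<phi> f \<in> U}" "\<phi> \<in> Y" "open U" by blast
    then obtain e where "e > 0" "ball (\<phi> f) e \<subseteq> U" using Basis by (auto simp: open_contains_ball)
    then show ?case using s
      by (intro exI[of _ "{\<phi>}"] exI[of _ e]) (auto simp: dist_norm norm_minus_commute subset_iff)
  qed
qed

lemma topspace_weak_topology: "Y \<noteq> {} \<Longrightarrow> topspace (weak_topology V Y) = V"
  unfolding weak_topology_def topology_generated_by_topspace by blast

lemma continuous_map_weak_topology:
  assumes "\<phi> \<in> Y" "\<And>f. f \<in> V \<Longrightarrow> \<omega> f = \<phi> f"
  shows "continuous_map (weak_topology V Y) euclidean \<omega>"
proof -
  have top: "topspace (weak_topology V Y) = V" using assms(1) by (intro topspace_weak_topology) auto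
  have "openin (weak_topology V Y) {f\<in>V. \<omega> f \<in> U}" if "open U" for U
  proof -
    have "{f\<in>V. \<omega> f \<in> U} = {f\<in>V. \<phi> f \<in> U}" using assms(2) by auto
    then show ?thesis unfolding weak_topology_def using that assms(1) by (auto intro!: topology_generated_by_Basis)
  qed
  then show ?thesis unfolding continuous_map_def top by auto
qed

text \<open>
  A weakly continuous functional is bounded by \<open>1\<close> on a neighbourhood given by finitely many
  elements of \<open>Y\<close>. On their common kernel it is bounded on all multiples of each vector, so it
  vanishes there, and it is a linear combination of them.
\<close>

lemma weakly_continuous_linear_in_span:
  assumes V: "is_subspace V" and Y: "is_subspace Y" "\<And>\<phi>. \<phi> \<in> Y \<Longrightarrow> is_linear_on V \<phi>"
    and lin: "is_linear_on V \<omega>" and cont: "continuous_map (weak_topology V Y) euclidean \<omega>"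
  shows "\<exists>\<phi>\<in>Y. \<forall>f\<in>V. \<omega> f = \<phi> f"
proof -
  have top: "topspace (weak_topology V Y) = V" using is_subspaceD(1)[OF Y(1)] by (intro topspace_weak_topology) auto
  define z where "z = (\<lambda>x::'a. 0::complex)"
  have z: "z \<in> V" "\<omega> z = 0" "\<And>\<phi>. \<phi> \<in> Y \<Longrightarrow> \<phi> z = 0"
    unfolding z_def using is_subspaceD(1)[OF V] is_linear_on_zero[OF V] lin Y(2) by auto
  have "openin (weak_topology V Y) {f\<in>V. \<omega> f \<in> ball 0 1}"
    using cont openin_continuous_map_preimage[of "weak_topology V Y" euclidean \<omega> "ball 0 1"] unfolding top by simp
  from weak_topology_neighbourhood[OF this, of z] z obtain \<Phi> e where
    P: "finite \<Phi>" "\<Phi> \<subseteq> Y" "e > 0" "{g\<in>V. \<forall>\<phi>\<in>\<Phi>. cmod (\<phi> g - \<phi> z) < e} \<subseteq> {f\<in>V. \<omega> f \<in> ball 0 1}" by auto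
  have "\<exists>c. \<forall>f\<in>V. \<omega> f = (\<Sum>\<phi>\<in>\<Phi>. c \<phi> * \<phi> f)"
  proof (rule linear_combination_if_common_kernel[OF P(1) V _ lin])
    show "is_linear_on V \<phi>" if "\<phi> \<in> \<Phi>" for \<phi> using that P(2) Y(2) by auto
    fix f assume f: "f \<in> V" "\<And>\<phi>. \<phi> \<in> \<Phi> \<Longrightarrow> \<phi> f = 0"
    show "\<omega> f = 0"
    proof (rule ccontr)
      assume ne: "\<omega> f \<noteq> 0"
      \<comment> \<open>The multiple of \<open>f\<close> at which \<open>\<omega>\<close> has the value \<open>1\<close> lies in the neighbourhood on which
         \<open>\<omega>\<close> is smaller than \<open>1\<close>.\<close>
      define g where "g = (\<lambda>x. (1 / \<omega> f) * f x)"
      have gV: "g \<in> V" unfolding g_def by (rule is_subspaceD(3)[OF V f(1)])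
      have "cmod (\<phi> g - \<phi> z) < e" if "\<phi> \<in> \<Phi>" for \<phi>
        using is_linear_onD(2)[OF Y(2) f(1), of \<phi> "1 / \<omega> f"] f(2)[OF that] z(3)[of \<phi>] that P(2,3)
        by (auto simp: g_def)
      then have "g \<in> {f\<in>V. \<omega> f \<in> ball 0 1}" using gV by (intro subsetD[OF P(4)]) auto
      moreover have "\<omega> g = 1" using is_linear_onD(2)[OF lin f(1), of "1 / \<omega> f"] ne by (simp add: g_def)
      ultimately show False by simp
    qed
  qed
  then obtain c where c: "\<And>f. f \<in> V \<Longrightarrow> \<omega> f = (\<Sum>\<phi>\<in>\<Phi>. c \<phi> * \<phi> f)" by blast
  moreover have "(\<lambda>f. \<Sum>\<phi>\<in>\<Phi>. c \<phi> * \<phi> f) \<in> Y" using P(2) by (intro is_subspace_indexed_sum[OF Y(1)]) auto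
  ultimately show ?thesis by (intro bexI[of _ "\<lambda>f. \<Sum>\<phi>\<in>\<Phi>. c \<phi> * \<phi> f"] ballI)
qed

text \<open>
  The Hahn-Banach criterion for density. For a weak topology it amounts to finite-dimensional
  interpolation: a vector of \<open>S\<close> that agrees with \<open>f\<close> on finitely many functionals lies in every
  neighbourhood of \<open>f\<close> that they define.
\<close>

lemma weakly_dense_if_annihilator_trivial:
  assumes V: "is_subspace V" and Y: "is_subspace Y" "\<And>\<phi>. \<phi> \<in> Y \<Longrightarrow> is_linear_on V \<phi>"
    and S: "is_subspace S" "S \<subseteq> V"
    and ann: "\<And>\<phi> f. \<phi> \<in> Y \<Longrightarrow> (\<And>h. h \<in> S \<Longrightarrow> \<phi> h = 0) \<Longrightarrow> f \<in> V \<Longrightarrow> \<phi> f = 0"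
  shows "weak_topology V Y closure_of S = V"
proof
  have top: "topspace (weak_topology V Y) = V" using is_subspaceD(1)[OF Y(1)] by (intro topspace_weak_topology) auto
  show "weak_topology V Y closure_of S \<subseteq> V" using closure_of_subset_topspace[of "weak_topology V Y" S] top by simp
  show "V \<subseteq> weak_topology V Y closure_of S"
  proof
    fix f assume f: "f \<in> V"
    show "f \<in> weak_topology V Y closure_of S"
      unfolding in_closure_of top
    proof (intro conjI f allI impI, elim conjE)
      fix T assume "f \<in> T" "openin (weak_topology V Y) T"
      from weak_topology_neighbourhood[OF this(2,1)] obtain \<Phi> e where
        P: "finite \<Phi>" "\<Phi> \<subseteq> Y" "e > 0" "{g\<in>V. \<forall>\<phi>\<in>\<Phi>. cmod (\<phi> g - \<phi> f) < e} \<subseteq> T" by auto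
      have "\<exists>h\<in>S. \<forall>\<phi>\<in>\<Phi>. \<phi> h = \<phi> f"
      proof (rule interpolation_in_subspace[OF P(1) V _ S f])
        show "is_linear_on V \<phi>" if "\<phi> \<in> \<Phi>" for \<phi> using that P(2) Y(2) by auto
        fix c assume c: "\<And>h. h \<in> S \<Longrightarrow> (\<Sum>\<phi>\<in>\<Phi>. c \<phi> * \<phi> h) = 0"
        have "(\<lambda>f. \<Sum>\<phi>\<in>\<Phi>. c \<phi> * \<phi> f) \<in> Y" using P(2) by (intro is_subspace_indexed_sum[OF Y(1)]) auto
        from ann[OF this c f] show "(\<Sum>\<phi>\<in>\<Phi>. c \<phi> * \<phi> f) = 0" by simp
      qed
      then obtain h where h: "h \<in> S" "\<And>\<phi>. \<phi> \<in> \<Phi> \<Longrightarrow> \<phi> h = \<phi> f" by blast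
      have "cmod (\<phi> h - \<phi> f) < e" if "\<phi> \<in> \<Phi>" for \<phi> using h(2)[OF that] P(3) by simp
      then have "h \<in> T" using h(1) S(2) by (intro subsetD[OF P(4)]) auto
      then show "\<exists>y. y \<in> S \<and> y \<in> T" using h(1) by blast
    qed
  qed
qed

section \<open>Bounded holomorphic functions on the strip and their predual\<close>

text \<open>
  The parametrisation of the fixed line of \<open>strip_refl \<beta>\<close>.
\<close>

definition midline :: "real \<Rightarrow> real \<Rightarrow> complex" where
  "midline \<beta> x = of_real \<beta> * \<i> / 2 + of_real x"

lemma Re_midline [simp]: "Re (midline \<beta> x) = x" and Im_midline [simp]: "Im (midline \<beta> x) = \<beta> / 2"
  by (simp_all add: midline_def)

lemma midline_diff: "midline \<beta> (x - y) = midline \<beta> x - of_real y"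
  by (simp add: midline_def)

lemma midline_in_strip: "\<beta> > 0 \<Longrightarrow> midline \<beta> x \<in> strip \<beta>"
  by (simp add: strip_def)

lemma midline_functional_eq: "midline_functional \<beta> \<mu> F = (\<integral>x. F (midline \<beta> x) \<partial>\<mu>)"
  by (simp add: midline_functional_def midline_def)

lemma HinfI:
  assumes "f holomorphic_on strip \<beta>" "\<And>z. z \<in> strip \<beta> \<Longrightarrow> cmod (f z) \<le> B" "\<And>z. z \<notin> strip \<beta> \<Longrightarrow> f z = 0"
  shows "f \<in> Hinf \<beta>"
  using assms unfolding Hinf_def bounded_iff by auto

lemma HinfD:
  assumes "f \<in> Hinf \<beta>"
  shows "f holomorphic_on strip \<beta>" "\<And>z. z \<notin> strip \<beta> \<Longrightarrow> f z = 0"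
  using assms unfolding Hinf_def by auto

lemma is_subspace_Hinf: "is_subspace (Hinf \<beta>)"
  unfolding is_subspace_def
proof (intro conjI ballI allI)
  show "(\<lambda>x. 0) \<in> Hinf \<beta>" by (rule HinfI[of _ _ 0]) auto
next
  fix u v assume uv: "u \<in> Hinf \<beta>" "v \<in> Hinf \<beta>"
  show "(\<lambda>x. u x + v x) \<in> Hinf \<beta>"
    by (rule HinfI[of _ _ "Hinf_norm \<beta> u + Hinf_norm \<beta> v"])
       (use HinfD[OF uv(1)] HinfD[OF uv(2)] in \<open>auto intro!: holomorphic_intros norm_triangle_mono Hinf_norm_bound uv\<close>)
next
  fix c u assume u: "u \<in> Hinf \<beta>"
  show "(\<lambda>x. c * u x) \<in> Hinf \<beta>"
    by (rule HinfI[of _ _ "cmod c * Hinf_norm \<beta> u"])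
       (use HinfD[OF u] in \<open>auto intro!: holomorphic_intros mult_left_mono Hinf_norm_bound u simp: norm_mult\<close>)
qed

lemma Hinf_norm_le:
  assumes "\<beta> > 0" "\<And>z. z \<in> strip \<beta> \<Longrightarrow> cmod (f z) \<le> C"
  shows "Hinf_norm \<beta> f \<le> C"
  unfolding Hinf_norm_def using midline_in_strip[OF assms(1), of 0] assms(2) by (intro cSUP_least) auto

lemma Hinf_norm_nonneg:
  assumes "\<beta> > 0" "f \<in> Hinf \<beta>"
  shows "0 \<le> Hinf_norm \<beta> f"
  using norm_ge_zero Hinf_norm_bound[OF assms(2) midline_in_strip[OF assms(1), of 0]] by (rule order_trans)

lemma predual_subspace: "\<beta> > 0 \<Longrightarrow> is_subspace (Hinf_predual \<beta>)"
  and predual_subset_dual: "\<beta> > 0 \<Longrightarrow> Hinf_predual \<beta> \<subseteq> dual_of (Hinf \<beta>) (Hinf_norm \<beta>)"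
  and predual_bij: "\<beta> > 0 \<Longrightarrow> bij_betw (eval_on (Hinf_predual \<beta>)) (Hinf \<beta>)
      (dual_of (Hinf_predual \<beta>) (dual_norm (Hinf \<beta>) (Hinf_norm \<beta>)))"
  using is_predual_Hinf_predual unfolding is_predual_def by auto

lemma predual_linear: "\<beta> > 0 \<Longrightarrow> \<phi> \<in> Hinf_predual \<beta> \<Longrightarrow> is_linear_on (Hinf \<beta>) \<phi>"
  using predual_subset_dual unfolding dual_of_def by auto

text \<open>
  Scaling to the unit ball needs \<open>Hinf_norm \<beta> f \<noteq> 0\<close>; in the other case the estimate that
  defines the dual already forces \<open>\<phi> f = 0\<close>.
\<close>

lemma cmod_le_dual_norm:
  assumes b: "\<beta> > 0" and p: "\<phi> \<in> dual_of (Hinf \<beta>) (Hinf_norm \<beta>)" and f: "f \<in> Hinf \<beta>"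
  shows "cmod (\<phi> f) \<le> dual_norm (Hinf \<beta>) (Hinf_norm \<beta>) \<phi> * Hinf_norm \<beta> f"
proof -
  obtain C where C: "\<And>f. f \<in> Hinf \<beta> \<Longrightarrow> cmod (\<phi> f) \<le> C * Hinf_norm \<beta> f" and lin: "is_linear_on (Hinf \<beta>) \<phi>"
    using p unfolding dual_of_def by auto
  show ?thesis
  proof (cases "Hinf_norm \<beta> f = 0")
    case True
    then show ?thesis using C[OF f] by simp
  next
    case False
    then have pos: "Hinf_norm \<beta> f > 0" using Hinf_norm_nonneg[OF b f] by simp
    define g where "g = (\<lambda>z. of_real (1 / Hinf_norm \<beta> f) * f z)"
    have g: "g \<in> Hinf \<beta>" unfolding g_def by (rule is_subspaceD(3)[OF is_subspace_Hinf f])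
    have "Hinf_norm \<beta> g \<le> 1"
      using pos Hinf_norm_bound[OF f] by (intro Hinf_norm_le[OF b]) (auto simp: g_def norm_divide)
    moreover have "bdd_above ((\<lambda>u. cmod (\<phi> u)) ` {u\<in>Hinf \<beta>. Hinf_norm \<beta> u \<le> 1})"
    proof (rule bdd_aboveI2)
      fix u assume u: "u \<in> {u\<in>Hinf \<beta>. Hinf_norm \<beta> u \<le> 1}"
      have "cmod (\<phi> u) \<le> C * Hinf_norm \<beta> u" using C u by auto
      also have "\<dots> \<le> \<bar>C\<bar> * 1" using u Hinf_norm_nonneg[OF b] by (intro mult_mono) auto
      finally show "cmod (\<phi> u) \<le> \<bar>C\<bar>" by simp
    qed
    ultimately have "cmod (\<phi> g) \<le> dual_norm (Hinf \<beta>) (Hinf_norm \<beta>) \<phi>"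
      unfolding dual_norm_def using g by (intro cSUP_upper) auto
    also have "\<phi> g = of_real (1 / Hinf_norm \<beta> f) * \<phi> f"
      unfolding g_def by (rule is_linear_onD(2)[OF lin f])
    finally show ?thesis using pos by (simp add: norm_divide field_simps)
  qed
qed

lemma eval_on_in_dual: "z \<in> strip \<beta> \<Longrightarrow> eval_on (Hinf \<beta>) z \<in> dual_of (Hinf \<beta>) (Hinf_norm \<beta>)"
  unfolding dual_of_def is_linear_on_def eval_on_def
  using is_subspaceD[OF is_subspace_Hinf] Hinf_norm_bound[of _ \<beta> z] by (auto intro!: exI[of _ 1])

text \<open>
  The definition of the predual with the dual norm spelled out: up to an error controlled by
  the norm of \<open>f\<close>, questions about \<open>\<phi> f\<close> become questions about the values of \<open>f\<close> at finitely
  many points.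
\<close>

lemma predual_approx:
  assumes b: "\<beta> > 0" and p: "\<phi> \<in> Hinf_predual \<beta>" and e: "\<epsilon> > 0"
  obtains T c where "finite T" "T \<subseteq> strip \<beta>"
    "\<And>f. f \<in> Hinf \<beta> \<Longrightarrow> cmod (\<phi> f - (\<Sum>z\<in>T. c z * f z)) \<le> \<epsilon> * Hinf_norm \<beta> f"
proof -
  let ?ev = "eval_on (Hinf \<beta>)" and ?D = "dual_of (Hinf \<beta>) (Hinf_norm \<beta>)"
  obtain \<psi> where s: "\<psi> \<in> cspan (?ev ` strip \<beta>)"
    and le: "dual_norm (Hinf \<beta>) (Hinf_norm \<beta>) (\<lambda>u. \<phi> u - \<psi> u) < \<epsilon>"
    using p e unfolding Hinf_predual_def norm_closure_in_dual_def by auto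
  have "cspan (?ev ` strip \<beta>) \<subseteq> ?D"
    using eval_on_in_dual by (intro cspan_subset is_subspace_dual_of) auto
  then have D: "(\<lambda>u. \<phi> u - \<psi> u) \<in> ?D"
    using s predual_subset_dual[OF b] p by (intro is_subspace_diff[OF is_subspace_dual_of]) auto
  obtain S k where S: "\<psi> = (\<lambda>f. \<Sum>u\<in>S. k u * u f)" "finite S" "S \<subseteq> ?ev ` strip \<beta>"
    using s unfolding cspan_def by blast
  obtain T where T: "T \<subseteq> strip \<beta>" "inj_on ?ev T" "S = ?ev ` T"
    using S(3) unfolding subset_image_inj by blast
  show thesis
  proof (rule that[of T "\<lambda>z. k (?ev z)"])
    show "finite T" using S(2) T(2,3) finite_image_iff by blast
    fix f assume f: "f \<in> Hinf \<beta>"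
    have "\<psi> f = (\<Sum>z\<in>T. k (?ev z) * f z)"
      using f unfolding S(1) T(3) sum.reindex[OF T(2)] by (simp add: eval_on_def)
    then have "cmod (\<phi> f - (\<Sum>z\<in>T. k (?ev z) * f z))
        \<le> dual_norm (Hinf \<beta>) (Hinf_norm \<beta>) (\<lambda>u. \<phi> u - \<psi> u) * Hinf_norm \<beta> f"
      using cmod_le_dual_norm[OF b D f] by simp
    also have "\<dots> \<le> \<epsilon> * Hinf_norm \<beta> f"
      using le Hinf_norm_nonneg[OF b f] by (intro mult_right_mono) auto
    finally show "cmod (\<phi> f - (\<Sum>z\<in>T. k (?ev z) * f z)) \<le> \<epsilon> * Hinf_norm \<beta> f" .
  qed (rule T(1))
qed

lemma in_predualI:
  assumes b: "\<beta> > 0" and lin: "is_linear_on (Hinf \<beta>) \<phi>" and out: "\<And>f. f \<notin> Hinf \<beta> \<Longrightarrow> \<phi> f = 0"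
    and approx: "\<And>\<epsilon>. \<epsilon> > 0 \<Longrightarrow> \<exists>T c. finite T \<and> T \<subseteq> strip \<beta> \<and>
      (\<forall>f\<in>Hinf \<beta>. cmod (\<phi> f - (\<Sum>z\<in>T. c z * f z)) \<le> \<epsilon> * Hinf_norm \<beta> f)"
  shows "\<phi> \<in> Hinf_predual \<beta>"
  unfolding Hinf_predual_def norm_closure_in_dual_def
proof (intro CollectI conjI allI impI)
  obtain T c where T: "finite T" "T \<subseteq> strip \<beta>"
    and le: "\<And>f. f\<in>Hinf \<beta> \<Longrightarrow> cmod (\<phi> f - (\<Sum>z\<in>T. c z * f z)) \<le> 1 * Hinf_norm \<beta> f"
    using approx[of 1] by auto
  have "cmod (\<phi> f) \<le> (1 + (\<Sum>z\<in>T. cmod (c z))) * Hinf_norm \<beta> f" if f: "f \<in> Hinf \<beta>" for f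
  proof -
    have "cmod (\<Sum>z\<in>T. c z * f z) \<le> (\<Sum>z\<in>T. cmod (c z) * Hinf_norm \<beta> f)"
      using T(2) by (intro sum_norm_le) (auto simp: norm_mult intro!: mult_left_mono Hinf_norm_bound f)
    then show ?thesis
      using le[OF f] norm_triangle_sub[of "\<phi> f" "\<Sum>z\<in>T. c z * f z"]
      by (simp add: distrib_right sum_distrib_right)
  qed
  then show "\<phi> \<in> dual_of (Hinf \<beta>) (Hinf_norm \<beta>)" unfolding dual_of_def using lin out by blast
next
  let ?ev = "eval_on (Hinf \<beta>)"
  fix \<epsilon> :: real assume e: "\<epsilon> > 0"
  obtain T c where T: "finite T" "T \<subseteq> strip \<beta>"
    and le: "\<And>f. f\<in>Hinf \<beta> \<Longrightarrow> cmod (\<phi> f - (\<Sum>z\<in>T. c z * f z)) \<le> \<epsilon> / 2 * Hinf_norm \<beta> f"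
    using approx[of "\<epsilon> / 2"] e by auto
  define \<psi> where "\<psi> = (\<lambda>f. \<Sum>z\<in>T. c z * ?ev z f)"
  have "\<psi> \<in> cspan (?ev ` strip \<beta>)"
    unfolding \<psi>_def using T(2) by (intro is_subspace_indexed_sum is_subspace_cspan cspan_base) auto
  moreover have "dual_norm (Hinf \<beta>) (Hinf_norm \<beta>) (\<lambda>u. \<phi> u - \<psi> u) \<le> \<epsilon> / 2"
    unfolding dual_norm_def
  proof (rule cSUP_least)
    have "(\<lambda>x. 0) \<in> Hinf \<beta>" "Hinf_norm \<beta> (\<lambda>x. 0) \<le> 1"
      using is_subspaceD(1)[OF is_subspace_Hinf] by (auto intro!: Hinf_norm_le[OF b])
    then show "{u \<in> Hinf \<beta>. Hinf_norm \<beta> u \<le> 1} \<noteq> {}" by blast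
    fix u assume u: "u \<in> {u \<in> Hinf \<beta>. Hinf_norm \<beta> u \<le> 1}"
    then have "cmod (\<phi> u - \<psi> u) \<le> \<epsilon> / 2 * Hinf_norm \<beta> u"
      using le[of u] by (simp add: \<psi>_def eval_on_def)
    also have "\<dots> \<le> \<epsilon> / 2 * 1" using u e by (intro mult_left_mono) auto
    finally show "cmod (\<phi> u - \<psi> u) \<le> \<epsilon> / 2" by simp
  qed
  ultimately show "\<exists>\<psi>\<in>cspan (?ev ` strip \<beta>). dual_norm (Hinf \<beta>) (Hinf_norm \<beta>) (\<lambda>u. \<phi> u - \<psi> u) < \<epsilon>"
    using e by (intro bexI[of _ \<psi>]) auto
qed

text \<open>
  Elements of the predual see bounded pointwise limits, because they are uniformly approximated
  on bounded sets by combinations of point evaluations.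
\<close>

lemma predual_bounded_pointwise_limit:
  assumes b: "\<beta> > 0" and p: "\<phi> \<in> Hinf_predual \<beta>"
    and F: "\<And>n. F n \<in> Hinf \<beta>" "\<And>n. Hinf_norm \<beta> (F n) \<le> B" and f: "f \<in> Hinf \<beta>"
    and lim: "\<And>z. z \<in> strip \<beta> \<Longrightarrow> (\<lambda>n. F n z) \<longlonglongrightarrow> f z"
  shows "(\<lambda>n. \<phi> (F n)) \<longlonglongrightarrow> \<phi> f"
proof (rule LIMSEQ_I)
  fix r :: real assume r: "r > 0"
  define K where "K = B + Hinf_norm \<beta> f + 1"
  have K: "K > 0"
    using Hinf_norm_nonneg[OF b F(1)[of 0]] F(2)[of 0] Hinf_norm_nonneg[OF b f] by (simp add: K_def)
  obtain T c where T: "finite T" "T \<subseteq> strip \<beta>"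
    and le: "\<And>f. f\<in>Hinf \<beta> \<Longrightarrow> cmod (\<phi> f - (\<Sum>z\<in>T. c z * f z)) \<le> r / (2 * K) * Hinf_norm \<beta> f"
    using predual_approx[OF b p, of "r / (2 * K)"] r K by auto
  have "(\<lambda>n. \<Sum>z\<in>T. c z * F n z) \<longlonglongrightarrow> (\<Sum>z\<in>T. c z * f z)"
    using T(2) by (intro tendsto_intros lim) auto
  then obtain N where N: "\<And>n. n \<ge> N \<Longrightarrow> cmod ((\<Sum>z\<in>T. c z * F n z) - (\<Sum>z\<in>T. c z * f z)) < r / 2"
    using LIMSEQ_D[of "\<lambda>n. \<Sum>z\<in>T. c z * F n z" "\<Sum>z\<in>T. c z * f z" "r / 2"] r by auto
  show "\<exists>no. \<forall>n\<ge>no. norm (\<phi> (F n) - \<phi> f) < r"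
  proof (intro exI allI impI)
    fix n assume n: "n \<ge> N"
    have "cmod (\<phi> (F n) - (\<Sum>z\<in>T. c z * F n z)) + cmod (\<phi> f - (\<Sum>z\<in>T. c z * f z))
        \<le> r / (2 * K) * (B + Hinf_norm \<beta> f)"
      using le[OF F(1)[of n]] le[OF f] mult_left_mono[OF F(2)[of n], of "r / (2 * K)"] r K by (simp add: distrib_left)
    also have "\<dots> \<le> r / (2 * K) * K" using r K by (intro mult_left_mono) (auto simp: K_def)
    also have "\<dots> = r / 2" using K by simp
    finally have "cmod (\<phi> (F n) - (\<Sum>z\<in>T. c z * F n z)) + cmod (\<phi> f - (\<Sum>z\<in>T. c z * f z)) \<le> r / 2" .
    moreover have eq: "\<phi> (F n) - \<phi> f = (\<phi> (F n) - (\<Sum>z\<in>T. c z * F n z)) - (\<phi> f - (\<Sum>z\<in>T. c z * f z))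
        + ((\<Sum>z\<in>T. c z * F n z) - (\<Sum>z\<in>T. c z * f z))" by simp
    have "cmod (\<phi> (F n) - \<phi> f) \<le> cmod (\<phi> (F n) - (\<Sum>z\<in>T. c z * F n z)) + cmod (\<phi> f - (\<Sum>z\<in>T. c z * f z))
        + cmod ((\<Sum>z\<in>T. c z * F n z) - (\<Sum>z\<in>T. c z * f z))"
      unfolding eq by (rule order_trans[OF norm_triangle_ineq add_right_mono[OF norm_triangle_ineq4]])
    ultimately show "norm (\<phi> (F n) - \<phi> f) < r" using N[OF n] by simp
  qed
qed

lemma predual_measurable:
  assumes b: "\<beta> > 0" and p: "\<phi> \<in> Hinf_predual \<beta>" and F: "\<And>s. F s \<in> Hinf \<beta>"
    and m: "\<And>z. z \<in> strip \<beta> \<Longrightarrow> (\<lambda>s. F s z) \<in> borel_measurable M"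
  shows "(\<lambda>s. \<phi> (F s)) \<in> borel_measurable M"
proof -
  have "\<exists>T c. finite T \<and> T \<subseteq> strip \<beta> \<and>
      (\<forall>f\<in>Hinf \<beta>. cmod (\<phi> f - (\<Sum>z\<in>T. c z * f z)) \<le> 1 / real (Suc n) * Hinf_norm \<beta> f)" for n
    by (rule predual_approx[OF b p, of "1 / real (Suc n)"]) auto
  then obtain T c where T: "\<And>n. finite (T n)" "\<And>n. T n \<subseteq> strip \<beta>"
    and le: "\<And>n f. f\<in>Hinf \<beta> \<Longrightarrow> cmod (\<phi> f - (\<Sum>z\<in>T n. c n z * f z)) \<le> 1 / real (Suc n) * Hinf_norm \<beta> f"
    by metis
  show ?thesis
  proof (rule borel_measurable_LIMSEQ_metric)
    show "(\<lambda>s. \<Sum>z\<in>T n. c n z * F s z) \<in> borel_measurable M" for n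
      using T(2)[of n] by (intro borel_measurable_sum borel_measurable_times m borel_measurable_const) auto
    fix s
    show "(\<lambda>n. \<Sum>z\<in>T n. c n z * F s z) \<longlonglongrightarrow> \<phi> (F s)"
    proof (rule LIM_zero_cancel, rule Lim_null_comparison)
      show "\<forall>\<^sub>F n in sequentially. norm ((\<Sum>z\<in>T n. c n z * F s z) - \<phi> (F s)) \<le> 1 / real (Suc n) * Hinf_norm \<beta> (F s)"
        using le[OF F] by (simp add: norm_minus_commute)
      show "(\<lambda>n. 1 / real (Suc n) * Hinf_norm \<beta> (F s)) \<longlonglongrightarrow> 0"
        by (intro tendsto_mult_left_zero LIMSEQ_Suc lim_1_over_n)
    qed
  qed
qed

text \<open>
  Integrals of families of bounded holomorphic functions. The functional \<open>\<phi> \<mapsto> \<integral> \<phi> (F s)\<close> is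
  bounded on the predual, and \<open>Hinf \<beta>\<close> is the full dual of the predual. So this functional is
  evaluation at some \<open>H \<in> Hinf \<beta>\<close>: duality gives at once that the pointwise integral is
  holomorphic and that elements of the predual may be taken under the integral.
\<close>

lemma Hinf_integral_exists:
  assumes b: "\<beta> > 0" and F: "\<And>s. F s \<in> Hinf \<beta>"
    and m: "\<And>z. z \<in> strip \<beta> \<Longrightarrow> (\<lambda>s. F s z) \<in> borel_measurable M"
    and w: "integrable M w" "\<And>s. Hinf_norm \<beta> (F s) \<le> w s"
  obtains H where "H \<in> Hinf \<beta>"
    "\<And>\<phi>. \<phi> \<in> Hinf_predual \<beta> \<Longrightarrow> integrable M (\<lambda>s. \<phi> (F s)) \<and> \<phi> H = (\<integral>s. \<phi> (F s) \<partial>M)"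
    "\<And>z. z \<in> strip \<beta> \<Longrightarrow> H z = (\<integral>s. F s z \<partial>M)"
proof -
  let ?Y = "Hinf_predual \<beta>" and ?M = "dual_norm (Hinf \<beta>) (Hinf_norm \<beta>)"
  have le: "cmod (\<phi> (F s)) \<le> ?M \<phi> * w s" if p: "\<phi> \<in> ?Y" for \<phi> s
  proof -
    have D: "\<phi> \<in> dual_of (Hinf \<beta>) (Hinf_norm \<beta>)" using p predual_subset_dual[OF b] by auto
    \<comment> \<open>A supremum over a set of reals need not be nonnegative; the constant function \<open>1\<close>, which has
       positive norm, shows that this one is.\<close>
    have "0 \<le> ?M \<phi>"
    proof -
      have "Hinf_one \<beta> \<in> Hinf \<beta>"
        by (rule HinfI[of _ _ 1]) (auto simp: Hinf_one_def intro: holomorphic_transform[OF holomorphic_on_const])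
      moreover have "Hinf_norm \<beta> (Hinf_one \<beta>) > 0"
        using Hinf_norm_bound[OF calculation midline_in_strip[OF b, of 0]] midline_in_strip[OF b, of 0]
        by (simp add: Hinf_one_def)
      ultimately show ?thesis
        using order_trans[OF norm_ge_zero cmod_le_dual_norm[OF b D, of "Hinf_one \<beta>"]] by (simp add: zero_le_mult_iff)
    qed
    then show ?thesis using cmod_le_dual_norm[OF b D F[of s]] mult_left_mono[OF w(2)[of s]] by fastforce
  qed
  have int: "integrable M (\<lambda>s. \<phi> (F s))" if p: "\<phi> \<in> ?Y" for \<phi>
  proof (rule Bochner_Integration.integrable_bound)
    show "integrable M (\<lambda>s. ?M \<phi> * w s)" using w(1) by simp
    show "(\<lambda>s. \<phi> (F s)) \<in> borel_measurable M" by (rule predual_measurable[OF b p F m])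
    show "AE s in M. norm (\<phi> (F s)) \<le> norm (?M \<phi> * w s)"
      by (intro AE_I2 order_trans[OF le[OF p]]) simp
  qed
  define \<Lambda> where "\<Lambda> \<phi> = (if \<phi> \<in> ?Y then \<integral>s. \<phi> (F s) \<partial>M else 0)" for \<phi>
  have "\<Lambda> \<in> dual_of ?Y ?M"
    unfolding dual_of_def is_linear_on_def
  proof (intro CollectI conjI ballI allI impI)
    show "\<Lambda> (\<lambda>x. u x + v x) = \<Lambda> u + \<Lambda> v" if "u \<in> ?Y" "v \<in> ?Y" for u v
      using that is_subspaceD(2)[OF predual_subspace[OF b]] int by (simp add: \<Lambda>_def)
    show "\<Lambda> (\<lambda>x. c * u x) = c * \<Lambda> u" if "u \<in> ?Y" for c u
      using that is_subspaceD(3)[OF predual_subspace[OF b]] int by (simp add: \<Lambda>_def)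
    show "\<exists>C. \<forall>u\<in>?Y. cmod (\<Lambda> u) \<le> C * ?M u"
    proof (intro exI[of _ "\<integral>s. w s \<partial>M"] ballI)
      fix u assume u: "u \<in> ?Y"
      have "cmod (\<integral>s. u (F s) \<partial>M) \<le> (\<integral>s. ?M u * w s \<partial>M)"
        by (intro order_trans[OF integral_norm_bound] integral_mono integrable_norm int u le) (use w(1) in auto)
      then show "cmod (\<Lambda> u) \<le> (\<integral>s. w s \<partial>M) * ?M u" using u w(1) by (simp add: \<Lambda>_def mult.commute)
    qed
  qed (simp add: \<Lambda>_def)
  then have "\<Lambda> \<in> eval_on ?Y ` Hinf \<beta>"
    by (simp only: bij_betw_imp_surj_on[OF predual_bij[OF b]])
  then obtain H where H: "\<Lambda> = eval_on ?Y H" "H \<in> Hinf \<beta>" by (rule imageE)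
  have pH: "\<phi> H = (\<integral>s. \<phi> (F s) \<partial>M)" if "\<phi> \<in> ?Y" for \<phi>
    using fun_cong[OF H(1), of \<phi>] that by (simp add: eval_on_def \<Lambda>_def)
  have "eval_on (Hinf \<beta>) z \<in> ?Y" if z: "z \<in> strip \<beta>" for z
  proof (rule in_predualI[OF b])
    show "is_linear_on (Hinf \<beta>) (eval_on (Hinf \<beta>) z)" "\<And>f. f \<notin> Hinf \<beta> \<Longrightarrow> eval_on (Hinf \<beta>) z f = 0"
      using eval_on_in_dual[OF z] unfolding dual_of_def by auto
    fix \<epsilon> :: real assume "\<epsilon> > 0"
    then show "\<exists>T c. finite T \<and> T \<subseteq> strip \<beta> \<and>
      (\<forall>f\<in>Hinf \<beta>. cmod (eval_on (Hinf \<beta>) z f - (\<Sum>z\<in>T. c z * f z)) \<le> \<epsilon> * Hinf_norm \<beta> f)"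
      using z Hinf_norm_nonneg[OF b] by (intro exI[of _ "{z}"] exI[of _ "\<lambda>_. 1"]) (simp add: eval_on_def)
  qed
  from pH[OF this] have "H z = (\<integral>s. F s z \<partial>M)" if "z \<in> strip \<beta>" for z
    using that H(2) F by (simp add: eval_on_def)
  then show thesis using that[OF H(2)] int pH by simp
qed

lemma connected_strip: "connected (strip \<beta>)"
proof -
  have "strip \<beta> = {z. 0 < Im z} \<inter> {z. Im z < \<beta>}" unfolding strip_def by auto
  then show ?thesis by (simp add: convex_connected convex_Int convex_halfspace_Im_gt convex_halfspace_Im_lt)
qed

text \<open>
  The identity theorem: the midline has accumulation points in the connected strip.
\<close>

lemma Hinf_eq_if_eq_on_midline:
  assumes b: "\<beta> > 0" and f: "f \<in> Hinf \<beta>" and g: "g \<in> Hinf \<beta>"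
    and eq: "\<And>x. f (midline \<beta> x) = g (midline \<beta> x)"
  shows "f = g"
proof
  fix w
  have lp: "midline \<beta> 0 islimpt range (midline \<beta>)"
  proof (rule islimptI)
    fix T assume T: "midline \<beta> 0 \<in> T" "open T"
    then obtain e where e: "e > 0" "ball (midline \<beta> 0) e \<subseteq> T" by (auto simp: open_contains_ball)
    have "dist (midline \<beta> 0) (midline \<beta> (e/2)) = e / 2" using e(1) by (simp add: midline_def dist_norm)
    then have "midline \<beta> (e/2) \<in> T" using e by (intro subsetD[OF e(2)]) auto
    moreover have "midline \<beta> (e/2) \<noteq> midline \<beta> 0" using e(1) by (auto simp: complex_eq_iff)
    ultimately show "\<exists>y\<in>range (midline \<beta>). y \<in> T \<and> y \<noteq> midline \<beta> 0" by blast
  qed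
  show "f w = g w"
  proof (cases "w \<in> strip \<beta>")
    case True
    have "f w - g w = 0"
    proof (rule analytic_continuation[where f = "\<lambda>z. f z - g z", OF _ open_strip connected_strip])
      show "(\<lambda>z. f z - g z) holomorphic_on strip \<beta>" by (intro holomorphic_intros HinfD(1) f g)
      show "range (midline \<beta>) \<subseteq> strip \<beta>" "midline \<beta> 0 \<in> strip \<beta>" using midline_in_strip[OF b] by auto
    qed (use lp eq True in auto)
    then show ?thesis by simp
  qed (simp add: HinfD(2)[OF f] HinfD(2)[OF g])
qed

lemma continuous_on_Hinf_horizontal:
  assumes f: "f \<in> Hinf \<beta>"
  shows "continuous_on UNIV (\<lambda>x. f (z + of_real x))"
proof (cases "z \<in> strip \<beta>")
  case True
  then show ?thesis
    by (intro continuous_on_compose2[OF holomorphic_on_imp_continuous_on[OF HinfD(1)[OF f]]] continuous_intros)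
       (auto simp: strip_def)
next
  case False
  then show ?thesis by (subst HinfD(2)[OF f]) (auto simp: strip_def)
qed

lemma continuous_on_Hinf_midline:
  assumes "f \<in> Hinf \<beta>"
  shows "continuous_on UNIV (\<lambda>x. f (midline \<beta> x))"
  using continuous_on_Hinf_horizontal[OF assms, of "of_real \<beta> * \<i> / 2"] by (simp add: midline_def)

lemma Hinf_translate:
  assumes b: "\<beta> > 0" and f: "f \<in> Hinf \<beta>"
  shows "(\<lambda>z. f (z - of_real s)) \<in> Hinf \<beta>" "Hinf_norm \<beta> (\<lambda>z. f (z - of_real s)) \<le> Hinf_norm \<beta> f"
proof -
  have st: "z - of_real s \<in> strip \<beta> \<longleftrightarrow> z \<in> strip \<beta>" for z by (simp add: strip_def)
  show "(\<lambda>z. f (z - of_real s)) \<in> Hinf \<beta>"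
  proof (rule HinfI[of _ _ "Hinf_norm \<beta> f"])
    have "f \<circ> (\<lambda>z. z - of_real s) holomorphic_on strip \<beta>"
      using st by (intro holomorphic_on_compose_gen[OF _ HinfD(1)[OF f]] holomorphic_intros) auto
    then show "(\<lambda>z. f (z - of_real s)) holomorphic_on strip \<beta>" by (simp add: o_def)
  qed (use Hinf_norm_bound[OF f] HinfD(2)[OF f] st in auto)
  show "Hinf_norm \<beta> (\<lambda>z. f (z - of_real s)) \<le> Hinf_norm \<beta> f"
    by (rule Hinf_norm_le[OF b]) (use st Hinf_norm_bound[OF f] in auto)
qed

text \<open>
  The factor \<open>exp (- (z - midline \<beta> 0)\<^sup>2 / (2 k\<^sup>2))\<close> is bounded on the strip uniformly in \<open>k \<ge>
  1\<close>, tends to \<open>1\<close> pointwise as \<open>k\<close> grows, and on the midline is a real Gaussian, so the product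
  is integrable there.
\<close>

lemma Hinf_gaussian_damping:
  assumes b: "\<beta> > 0" and f: "f \<in> Hinf \<beta>" and k: "k \<ge> 1"
  defines "h \<equiv> \<lambda>z. f z * exp (- (z - midline \<beta> 0)\<^sup>2 / of_real (2 * k\<^sup>2))"
  shows "h \<in> Hinf \<beta>" "Hinf_norm \<beta> h \<le> Hinf_norm \<beta> f * exp (\<beta>\<^sup>2)"
    "integrable lborel (\<lambda>x. h (midline \<beta> x))"
proof -
  have le: "cmod (h z) \<le> Hinf_norm \<beta> f * exp (\<beta>\<^sup>2)" if z: "z \<in> strip \<beta>" for z
  proof -
    define y where "y = Im z - \<beta> / 2"
    have "\<bar>y\<bar> \<le> \<beta>" using z by (auto simp: y_def strip_def abs_le_iff)
    then have y2: "y\<^sup>2 \<le> \<beta>\<^sup>2" by (metis abs_le_square_iff abs_of_pos b)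
    have k2: "1 \<le> 2 * k\<^sup>2" using k one_le_power[of k 2] by linarith
    have "Re (- (z - midline \<beta> 0)\<^sup>2 / of_real (2 * k\<^sup>2)) = (y\<^sup>2 - (Re z)\<^sup>2) / (2 * k\<^sup>2)"
      by (simp add: Re_divide_of_real del: of_real_mult of_real_power) (simp add: y_def power2_eq_square minus_divide_left)
    also have "\<dots> \<le> \<beta>\<^sup>2 / (2 * k\<^sup>2)" using y2 k2 by (intro divide_right_mono) (auto intro: order_trans[of _ "y\<^sup>2"])
    also have "\<dots> \<le> \<beta>\<^sup>2 / 1" using k2 by (intro divide_left_mono) auto
    finally have "cmod (exp (- (z - midline \<beta> 0)\<^sup>2 / of_real (2 * k\<^sup>2))) \<le> exp (\<beta>\<^sup>2)" by simp
    then show ?thesis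
      unfolding h_def norm_mult using Hinf_norm_bound[OF f z] Hinf_norm_nonneg[OF b f] by (intro mult_mono) auto
  qed
  show h: "h \<in> Hinf \<beta>"
    by (rule HinfI[OF _ le]) (use HinfD[OF f] k in \<open>auto simp: h_def intro!: holomorphic_intros\<close>)
  show "Hinf_norm \<beta> h \<le> Hinf_norm \<beta> f * exp (\<beta>\<^sup>2)" by (rule Hinf_norm_le[OF b le])
  show "integrable lborel (\<lambda>x. h (midline \<beta> x))"
  proof (rule Bochner_Integration.integrable_bound)
    show "integrable lborel (\<lambda>x. Hinf_norm \<beta> f * (sqrt (2 * pi * k\<^sup>2) * normal_density 0 k x))" using k by auto
    show "(\<lambda>x. h (midline \<beta> x)) \<in> borel_measurable lborel"
      using borel_measurable_continuous_onI[OF continuous_on_Hinf_midline[OF h]] by simp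
    have "cmod (h (midline \<beta> x)) \<le> Hinf_norm \<beta> f * exp (- x\<^sup>2 / (2 * k\<^sup>2))" for x
    proof -
      have "- (midline \<beta> x - midline \<beta> 0)\<^sup>2 / of_real (2 * k\<^sup>2) = complex_of_real (- x\<^sup>2 / (2 * k\<^sup>2))"
        by (simp add: midline_def)
      then have "cmod (exp (- (midline \<beta> x - midline \<beta> 0)\<^sup>2 / of_real (2 * k\<^sup>2))) = exp (- x\<^sup>2 / (2 * k\<^sup>2))"
        by (metis norm_exp_eq_Re Re_complex_of_real)
      then show ?thesis
        unfolding h_def norm_mult using Hinf_norm_bound[OF f midline_in_strip[OF b]] by (simp add: mult_right_mono)
    qed
    then show "AE x in lborel. norm (h (midline \<beta> x)) \<le> norm (Hinf_norm \<beta> f * (sqrt (2 * pi * k\<^sup>2) * normal_density 0 k x))"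
      using k Hinf_norm_nonneg[OF b f] by (simp add: normal_density_def abs_mult)
  qed
qed

section \<open>The exponentials and the functionals that vanish on them\<close>

text \<open>
  The factor \<open>exp (t \<beta> / 2)\<close> in the definition of \<open>Hinf_g\<close> is there to make this identity true.
\<close>

lemma Hinf_g_midline: "\<beta> > 0 \<Longrightarrow> Hinf_g \<beta> t (midline \<beta> x) = iexp (t * x)"
proof -
  assume b: "\<beta> > 0"
  have "Hinf_g \<beta> t (midline \<beta> x) = exp (of_real (t * \<beta> / 2) + \<i> * of_real t * midline \<beta> x)"
    using midline_in_strip[OF b] by (simp add: Hinf_g_def exp_add flip: exp_of_real)
  also have "of_real (t * \<beta> / 2) + \<i> * of_real t * midline \<beta> x = \<i> * of_real (t * x)"
    by (simp add: complex_eq_iff)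
  finally show ?thesis .
qed

lemma cmod_Hinf_g: "z \<in> strip \<beta> \<Longrightarrow> cmod (Hinf_g \<beta> t z) = exp (t * (\<beta> / 2 - Im z))"
  by (simp add: Hinf_g_def norm_mult exp_add[symmetric] algebra_simps)

lemma Hinf_g_bound:
  assumes z: "z \<in> strip \<beta>"
  shows "cmod (Hinf_g \<beta> t z) \<le> exp (\<bar>t\<bar> * \<beta> / 2)"
proof -
  have "t * (\<beta> / 2 - Im z) \<le> \<bar>t\<bar> * \<bar>\<beta> / 2 - Im z\<bar>" by (metis abs_ge_self abs_mult)
  also have "\<bar>\<beta> / 2 - Im z\<bar> \<le> \<beta> / 2" using z by (intro abs_leI) (auto simp: strip_def)
  then have "\<bar>t\<bar> * \<bar>\<beta> / 2 - Im z\<bar> \<le> \<bar>t\<bar> * (\<beta> / 2)" by (intro mult_left_mono) auto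
  finally show ?thesis using cmod_Hinf_g[OF z] by simp
qed

lemma Hinf_g_in_Hinf: "Hinf_g \<beta> t \<in> Hinf \<beta>"
proof (rule HinfI[OF _ Hinf_g_bound])
  have "(\<lambda>z. of_real (exp (t * \<beta> / 2)) * exp (\<i> * of_real t * z)) holomorphic_on strip \<beta>"
    by (intro holomorphic_intros)
  then show "Hinf_g \<beta> t holomorphic_on strip \<beta>"
    by (rule holomorphic_transform) (simp add: Hinf_g_def)
qed (auto simp: Hinf_g_def)

text \<open>
  The norm of \<open>Hinf_g \<beta> t\<close> grows exponentially in \<open>t\<close>; the standard normal law still integrates
  it.
\<close>

lemma integrable_exp_abs_std_normal: "integrable std_normal_distribution (\<lambda>t. exp (c * \<bar>t\<bar>))"
proof (rule Bochner_Integration.integrable_bound)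
  have 1: "integrable std_normal_distribution (\<lambda>t. exp (a * t))" for a :: real
  proof -
    have "integrable lborel (\<lambda>t. exp (a\<^sup>2 / 2) * normal_density a 1 t)" by simp
    also have "(\<lambda>t. exp (a\<^sup>2 / 2) * normal_density a 1 t) = (\<lambda>t. std_normal_density t *\<^sub>R exp (a * t))"
    proof
      fix t
      have "exp (a\<^sup>2 / 2) * exp (- (t - a)\<^sup>2 / 2) = exp (- t\<^sup>2 / 2) * exp (a * t)"
        unfolding exp_add[symmetric] by (simp add: power2_eq_square field_simps)
      then show "exp (a\<^sup>2 / 2) * normal_density a 1 t = std_normal_density t *\<^sub>R exp (a * t)"
        by (simp add: normal_density_def mult.left_commute)
    qed
    finally show ?thesis by (subst integrable_density) (auto simp: normal_density_nonneg)
  qed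
  show "integrable std_normal_distribution (\<lambda>t. exp (c * t) + exp (- c * t))"
    by (intro Bochner_Integration.integrable_add 1)
  show "AE t in std_normal_distribution. norm (exp (c * \<bar>t\<bar>)) \<le> norm (exp (c * t) + exp (- c * t))"
  proof (intro AE_I2)
    fix t
    have "exp (c * \<bar>t\<bar>) \<le> exp (c * t) + exp (- c * t)" by (cases "t \<ge> 0") auto
    then show "norm (exp (c * \<bar>t\<bar>)) \<le> norm (exp (c * t) + exp (- c * t))"
      by (simp only: real_norm_def abs_exp_cancel)
  qed
qed measurable

text \<open>
  A convolution with a Gaussian is a superposition of exponentials, since the Gaussian is
  itself a Gaussian average of exponentials. For integrable \<open>f\<close> the coefficient is a multiple of
  the Fourier transform of \<open>f\<close>.
\<close>

lemma gaussian_smoothing_on_midline: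
  fixes f :: "real \<Rightarrow> complex"
  assumes f: "integrable lborel f" and s: "\<sigma> > 0"
  defines "a \<equiv> \<lambda>t. of_real (1 / (\<sigma> * sqrt (2 * pi))) * (\<integral>x. f x * iexp (- (t / \<sigma> * x)) \<partial>lborel)"
  shows "(\<integral>v. f (u - \<sigma> * v) \<partial>std_normal_distribution) = (\<integral>t. a t * iexp (t / \<sigma> * u) \<partial>std_normal_distribution)"
proof -
  let ?N = std_normal_distribution
  interpret N: real_distribution ?N by (rule real_dist_normal_dist)
  interpret P: pair_sigma_finite lborel ?N ..
  have [measurable]: "f \<in> borel_measurable borel" using borel_measurable_integrable[OF f] by simp
  define k where "k = 1 / (\<sigma> * sqrt (2 * pi))"
  define G where "G x t = of_real k * (f x * iexp (t * ((u - x) / \<sigma>)))" for x t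
  have "(\<integral>v. f (u - \<sigma> * v) \<partial>?N) = (\<integral>v. std_normal_density v *\<^sub>R f (u - \<sigma> * v) \<partial>lborel)"
    by (subst integral_density) (auto simp: normal_density_nonneg)
  \<comment> \<open>the substitution \<open>v = (u - x) / \<sigma>\<close>\<close>
  also have "\<dots> = \<bar>- 1 / \<sigma>\<bar> *\<^sub>R (\<integral>x. std_normal_density (u / \<sigma> + (- 1 / \<sigma>) * x) *\<^sub>R f (u - \<sigma> * (u / \<sigma> + (- 1 / \<sigma>) * x)) \<partial>lborel)"
    using s by (intro lborel_integral_real_affine) auto
  also have "\<dots> = (\<integral>x. (1 / \<sigma>) *\<^sub>R (std_normal_density ((u - x) / \<sigma>) *\<^sub>R f x) \<partial>lborel)"
    using s by (simp add: diff_divide_distrib right_diff_distrib flip: integral_scaleR_right)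
  also have "\<dots> = (\<integral>x. (\<integral>t. G x t \<partial>?N) \<partial>lborel)"
  proof (intro Bochner_Integration.integral_cong refl)
    fix x
    have "(\<integral>t. G x t \<partial>?N) = of_real k * (f x * (\<integral>t. iexp (((u - x) / \<sigma>) * t) \<partial>?N))"
    proof -
      have "integrable ?N (\<lambda>t. iexp (((u - x) / \<sigma>) * t))"
        by (rule N.integrable_const_bound[of _ 1]) (auto simp del: of_real_mult)
      then show ?thesis unfolding G_def by (simp add: mult.commute)
    qed
    also have "\<dots> = of_real k * (f x * char ?N ((u - x) / \<sigma>))" unfolding char_def ..
    also have "\<dots> = (1 / \<sigma>) *\<^sub>R (std_normal_density ((u - x) / \<sigma>) *\<^sub>R f x)"
      unfolding char_std_normal_distribution by (simp add: std_normal_density_def k_def scaleR_conv_of_real)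
    finally show "(1 / \<sigma>) *\<^sub>R (std_normal_density ((u - x) / \<sigma>) *\<^sub>R f x) = (\<integral>t. G x t \<partial>?N)" ..
  qed
  also have "\<dots> = (\<integral>t. (\<integral>x. G x t \<partial>lborel) \<partial>?N)"
  proof (rule P.Fubini_integral[symmetric], rule P.Fubini_integrable)
    show "case_prod G \<in> borel_measurable (lborel \<Otimes>\<^sub>M ?N)"
      unfolding G_def by measurable
    have nG: "cmod (G x t) = \<bar>k\<bar> * cmod (f x)" for x t
      by (simp add: G_def norm_mult del: of_real_mult of_real_divide)
    show "integrable lborel (\<lambda>x. \<integral>t. norm (case_prod G (x, t)) \<partial>?N)"
      using f N.prob_space by (simp add: nG)
    show "AE x in lborel. integrable ?N (\<lambda>t. case_prod G (x, t))"
    proof (intro AE_I2)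
      fix x
      show "integrable ?N (\<lambda>t. case_prod G (x, t))"
        by (rule N.integrable_const_bound[of _ "\<bar>k\<bar> * cmod (f x)"]) (simp add: nG, simp add: G_def)
    qed
  qed
  also have "\<dots> = (\<integral>t. a t * iexp (t / \<sigma> * u) \<partial>?N)"
  proof (intro Bochner_Integration.integral_cong refl)
    fix t
    have i: "integrable lborel (\<lambda>x. f x * iexp (- (t / \<sigma> * x)))"
      by (rule Bochner_Integration.integrable_bound[OF f])
         (auto simp: norm_mult simp del: of_real_mult of_real_divide of_real_minus)
    have "(\<integral>x. G x t \<partial>lborel) = (\<integral>x. (of_real k * iexp (t / \<sigma> * u)) * (f x * iexp (- (t / \<sigma> * x))) \<partial>lborel)"
    proof (intro Bochner_Integration.integral_cong refl)
      fix x
      have "t * ((u - x) / \<sigma>) = t / \<sigma> * u + - (t / \<sigma> * x)" by (simp add: field_simps diff_divide_distrib)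
      then have "iexp (t * ((u - x) / \<sigma>)) = iexp (t / \<sigma> * u) * iexp (- (t / \<sigma> * x))"
        by (metis exp_add distrib_left of_real_add)
      then show "G x t = (of_real k * iexp (t / \<sigma> * u)) * (f x * iexp (- (t / \<sigma> * x)))"
        unfolding G_def by simp
    qed
    also have "\<dots> = (of_real k * iexp (t / \<sigma> * u)) * (\<integral>x. f x * iexp (- (t / \<sigma> * x)) \<partial>lborel)"
      by (rule Bochner_Integration.integral_mult_right) (rule i)
    also have "\<dots> = a t * iexp (t / \<sigma> * u)" unfolding a_def k_def by simp
    finally show "(\<integral>x. G x t \<partial>lborel) = a t * iexp (t / \<sigma> * u)" .
  qed
  finally show ?thesis .
qed

text \<open>
  The average of the translates of \<open>f\<close> and the corresponding superposition of the \<open>Hinf_g\<close> are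
  both integrals in \<open>Hinf \<beta>\<close>. They agree on the midline by the previous lemma, hence on the
  strip. Now \<open>\<phi>\<close> may be taken under the second integral, where it vanishes.
\<close>

lemma predual_kills_gaussian_smoothing:
  assumes b: "\<beta> > 0" and p: "\<phi> \<in> Hinf_predual \<beta>" and kill: "\<And>t. \<phi> (Hinf_g \<beta> t) = 0"
    and f: "f \<in> Hinf \<beta>" and int: "integrable lborel (\<lambda>x. f (midline \<beta> x))" and s: "\<sigma> > 0"
  shows "(\<integral>v. \<phi> (\<lambda>z. f (z - of_real (\<sigma> * v))) \<partial>std_normal_distribution) = 0"
proof -
  let ?N = std_normal_distribution
  interpret N: real_distribution ?N by (rule real_dist_normal_dist)
  define a where "a t = of_real (1 / (\<sigma> * sqrt (2 * pi))) * (\<integral>x. f (midline \<beta> x) * iexp (- (t / \<sigma> * x)) \<partial>lborel)" for t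
  define K where "K = 1 / (\<sigma> * sqrt (2 * pi)) * (\<integral>x. cmod (f (midline \<beta> x)) \<partial>lborel)"
  have [measurable]: "(\<lambda>x. f (midline \<beta> x)) \<in> borel_measurable borel"
    using borel_measurable_integrable[OF int] by simp
  have [measurable]: "a \<in> borel_measurable borel" unfolding a_def by measurable
  have aK: "cmod (a t) \<le> K" for t
  proof -
    have "cmod (\<integral>x. f (midline \<beta> x) * iexp (- (t / \<sigma> * x)) \<partial>lborel) \<le> (\<integral>x. cmod (f (midline \<beta> x) * iexp (- (t / \<sigma> * x))) \<partial>lborel)"
      by (rule integral_norm_bound)
    also have "\<dots> = (\<integral>x. cmod (f (midline \<beta> x)) \<partial>lborel)"
      by (simp add: norm_mult del: of_real_mult of_real_divide of_real_minus)
    moreover have "cmod (of_real (1 / (\<sigma> * sqrt (2 * pi)))) = 1 / (\<sigma> * sqrt (2 * pi))"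
      unfolding norm_of_real using s by (intro abs_of_pos) simp
    ultimately show ?thesis
      using s unfolding a_def K_def norm_mult by (simp only:) (intro mult_left_mono, auto)
  qed
  have meas: "(\<lambda>v. f (z - of_real (\<sigma> * v))) \<in> borel_measurable ?N" for z
  proof -
    have "continuous_on UNIV (\<lambda>v. f (z + of_real (- (\<sigma> * v))))"
      by (intro continuous_on_compose2[OF continuous_on_Hinf_horizontal[OF f, of z]] continuous_intros) auto
    then show ?thesis using borel_measurable_continuous_onI by simp
  qed
  obtain H where H: "H \<in> Hinf \<beta>"
    "\<phi> H = (\<integral>v. \<phi> (\<lambda>z. f (z - of_real (\<sigma> * v))) \<partial>?N)"
    "\<And>z. z \<in> strip \<beta> \<Longrightarrow> H z = (\<integral>v. f (z - of_real (\<sigma> * v)) \<partial>?N)"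
  proof (rule Hinf_integral_exists[OF b Hinf_translate(1)[OF b f] meas _ Hinf_translate(2)[OF b f]])
    show "integrable ?N (\<lambda>v. Hinf_norm \<beta> f)" by simp
  qed (use p in auto)
  have G: "(\<lambda>z. a t * Hinf_g \<beta> (t / \<sigma>) z) \<in> Hinf \<beta>" for t
    by (rule is_subspaceD(3)[OF is_subspace_Hinf Hinf_g_in_Hinf])
  have Gn: "Hinf_norm \<beta> (\<lambda>z. a t * Hinf_g \<beta> (t / \<sigma>) z) \<le> K * exp (\<beta> / (2 * \<sigma>) * \<bar>t\<bar>)" for t
  proof (rule Hinf_norm_le[OF b])
    fix z assume "z \<in> strip \<beta>"
    from Hinf_g_bound[OF this, of "t / \<sigma>"] show "cmod (a t * Hinf_g \<beta> (t / \<sigma>) z) \<le> K * exp (\<beta> / (2 * \<sigma>) * \<bar>t\<bar>)"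
      unfolding norm_mult using s order_trans[OF norm_ge_zero aK[of t]]
      by (intro mult_mono aK) (auto simp: abs_divide mult.commute)
  qed
  obtain H' where H': "H' \<in> Hinf \<beta>"
    "\<phi> H' = (\<integral>t. \<phi> (\<lambda>z. a t * Hinf_g \<beta> (t / \<sigma>) z) \<partial>?N)"
    "\<And>z. z \<in> strip \<beta> \<Longrightarrow> H' z = (\<integral>t. a t * Hinf_g \<beta> (t / \<sigma>) z \<partial>?N)"
  proof (rule Hinf_integral_exists[OF b G _ _ Gn])
    show "(\<lambda>t. a t * Hinf_g \<beta> (t / \<sigma>) z) \<in> borel_measurable ?N" if "z \<in> strip \<beta>" for z
      using that unfolding Hinf_g_def by simp
    show "integrable ?N (\<lambda>t. K * exp (\<beta> / (2 * \<sigma>) * \<bar>t\<bar>))"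
      by (intro integrable_mult_right integrable_exp_abs_std_normal)
  qed (use p in auto)
  have "H = H'"
  proof (rule Hinf_eq_if_eq_on_midline[OF b H(1) H'(1)])
    fix u
    have "H (midline \<beta> u) = (\<integral>v. f (midline \<beta> (u - \<sigma> * v)) \<partial>?N)"
      by (simp only: H(3)[OF midline_in_strip[OF b]] midline_diff)
    also have "\<dots> = (\<integral>t. a t * iexp (t / \<sigma> * u) \<partial>?N)"
      using gaussian_smoothing_on_midline[OF int s, of u] unfolding a_def .
    also have "\<dots> = H' (midline \<beta> u)"
      by (simp only: H'(3)[OF midline_in_strip[OF b]] Hinf_g_midline[OF b])
    finally show "H (midline \<beta> u) = H' (midline \<beta> u)" .
  qed
  moreover have "\<phi> (\<lambda>z. a t * Hinf_g \<beta> (t / \<sigma>) z) = 0" for t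
    using is_linear_onD(2)[OF predual_linear[OF b p] Hinf_g_in_Hinf] kill by simp
  ultimately show ?thesis using H(2) H'(2) by simp
qed

text \<open>
  The key step. Damping \<open>f\<close> makes it integrable on the midline, and smoothing it then puts it
  into the reach of the exponentials. Both operations are undone by a bounded pointwise limit,
  which \<open>\<phi>\<close> respects.
\<close>

theorem predual_zero_if_kills_exponentials:
  assumes b: "\<beta> > 0" and p: "\<phi> \<in> Hinf_predual \<beta>" and kill: "\<And>t. \<phi> (Hinf_g \<beta> t) = 0"
    and f: "f \<in> Hinf \<beta>"
  shows "\<phi> f = 0"
proof -
  let ?N = std_normal_distribution
  interpret N: real_distribution ?N by (rule real_dist_normal_dist)
  have D: "\<phi> \<in> dual_of (Hinf \<beta>) (Hinf_norm \<beta>)" using p predual_subset_dual[OF b] by auto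
  have cont: "isCont g z" if "g \<in> Hinf \<beta>" "z \<in> strip \<beta>" for g z
    using holomorphic_on_imp_continuous_on[OF HinfD(1)[OF that(1)]] that(2) open_strip
    by (simp add: continuous_on_eq_continuous_at)
  obtain C where C: "\<And>f. f \<in> Hinf \<beta> \<Longrightarrow> cmod (\<phi> f) \<le> C * Hinf_norm \<beta> f"
    using D unfolding dual_of_def by blast
  have smooth: "\<phi> g = 0" if g: "g \<in> Hinf \<beta>" and int: "integrable lborel (\<lambda>x. g (midline \<beta> x))" for g
  proof -
    have "(\<lambda>n. \<integral>v. \<phi> (\<lambda>z. g (z - of_real (1 / real (Suc n) * v))) \<partial>?N) \<longlonglongrightarrow> (\<integral>v. \<phi> g \<partial>?N)"
    proof (rule gaussian_average_tendsto)
      fix n v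
      have "cmod (\<phi> (\<lambda>z. g (z - of_real (1 / real (Suc n) * v)))) \<le> C * Hinf_norm \<beta> (\<lambda>z. g (z - of_real (1 / real (Suc n) * v)))"
        by (rule C[OF Hinf_translate(1)[OF b g]])
      also have "\<dots> \<le> \<bar>C\<bar> * Hinf_norm \<beta> g"
        by (intro mult_mono Hinf_translate Hinf_norm_nonneg b g) auto
      finally show "cmod (\<phi> (\<lambda>z. g (z - of_real (1 / real (Suc n) * v)))) \<le> \<bar>C\<bar> * Hinf_norm \<beta> g" .
      show "(\<lambda>n. \<phi> (\<lambda>z. g (z - of_real (1 / real (Suc n) * v)))) \<longlonglongrightarrow> \<phi> g"
      proof (rule predual_bounded_pointwise_limit[OF b p Hinf_translate(1)[OF b g] Hinf_translate(2)[OF b g] g])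
        fix z assume z: "z \<in> strip \<beta>"
        have "(\<lambda>n. z - of_real (1 / real (Suc n) * v)) \<longlonglongrightarrow> z - of_real (0 * v)"
          by (intro tendsto_intros LIMSEQ_Suc lim_1_over_n)
        then show "(\<lambda>n. g (z - of_real (1 / real (Suc n) * v))) \<longlonglongrightarrow> g z"
          by (intro isCont_tendsto_compose[OF cont[OF g z]]) simp
      qed
    next
      fix n
      have "(\<lambda>v. g (z - of_real (1 / real (Suc n) * v))) \<in> borel_measurable borel" for z
      proof -
        have "continuous_on UNIV (\<lambda>v. g (z + of_real (- (1 / real (Suc n) * v))))"
          by (intro continuous_on_compose2[OF continuous_on_Hinf_horizontal[OF g, of z]] continuous_intros) auto
        then show ?thesis using borel_measurable_continuous_onI by simp
      qed
      then show "(\<lambda>v. \<phi> (\<lambda>z. g (z - of_real (1 / real (Suc n) * v)))) \<in> borel_measurable borel"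
        by (rule predual_measurable[OF b p Hinf_translate(1)[OF b g]])
    qed
    moreover have "(\<integral>v. \<phi> (\<lambda>z. g (z - of_real (1 / real (Suc n) * v))) \<partial>?N) = 0" for n
      by (rule predual_kills_gaussian_smoothing[OF b p kill g int]) simp
    ultimately have "(\<lambda>n. 0) \<longlonglongrightarrow> \<phi> g" using N.prob_space by simp
    then show ?thesis by (simp add: LIMSEQ_const_iff)
  qed
  define h where "h n = (\<lambda>z. f z * exp (- (z - midline \<beta> 0)\<^sup>2 / of_real (2 * (real (Suc n))\<^sup>2)))" for n
  have h: "h n \<in> Hinf \<beta>" "Hinf_norm \<beta> (h n) \<le> Hinf_norm \<beta> f * exp (\<beta>\<^sup>2)" "integrable lborel (\<lambda>x. h n (midline \<beta> x))" for n
    unfolding h_def by (rule Hinf_gaussian_damping[OF b f]; simp)+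
  have "(\<lambda>n. \<phi> (h n)) \<longlonglongrightarrow> \<phi> f"
  proof (rule predual_bounded_pointwise_limit[OF b p h(1,2) f])
    fix z
    have "(\<lambda>n. f z * exp (- (z - midline \<beta> 0)\<^sup>2 / 2 * of_real ((1 / real (Suc n))\<^sup>2))) \<longlonglongrightarrow> f z * exp (- (z - midline \<beta> 0)\<^sup>2 / 2 * of_real (0\<^sup>2))"
      by (intro tendsto_intros LIMSEQ_Suc lim_1_over_n)
    then show "(\<lambda>n. h n z) \<longlonglongrightarrow> f z" by (simp add: h_def power_divide mult.commute)
  qed
  then show ?thesis using smooth[OF h(1,3)] by (simp add: LIMSEQ_const_iff)
qed

section \<open>Functionals given by measures on the midline\<close>

text \<open>
  Each point of the midline has distance \<open>\<beta> / 2\<close> from the boundary, so Cauchy's inequality on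
  discs of radius \<open>\<beta> / 4\<close> bounds the derivative uniformly on the midline.
\<close>

lemma Hinf_midline_Lipschitz:
  assumes b: "\<beta> > 0" and f: "f \<in> Hinf \<beta>"
  shows "cmod (f (midline \<beta> x) - f (midline \<beta> y)) \<le> 4 / \<beta> * Hinf_norm \<beta> f * \<bar>x - y\<bar>"
proof -
  have sub: "cball (midline \<beta> x) (\<beta> / 4) \<subseteq> strip \<beta>" for x
  proof
    fix z assume "z \<in> cball (midline \<beta> x) (\<beta> / 4)"
    then have "\<bar>Im (midline \<beta> x - z)\<bar> \<le> \<beta> / 4"
      unfolding mem_cball dist_norm by (rule order_trans[OF abs_Im_le_cmod])
    then have "\<bar>\<beta> / 2 - Im z\<bar> \<le> \<beta> / 4" by (simp only: minus_complex.sel Im_midline)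
    then show "z \<in> strip \<beta>" using b unfolding strip_def mem_Collect_eq by linarith
  qed
  have "cmod ((deriv ^^ 1) f (midline \<beta> x)) \<le> fact 1 * Hinf_norm \<beta> f / (\<beta> / 4) ^ 1" for x
  proof (rule Cauchy_inequality)
    show "f holomorphic_on ball (midline \<beta> x) (\<beta> / 4)"
      using HinfD(1)[OF f] sub[of x] ball_subset_cball by (blast intro: holomorphic_on_subset)
    show "continuous_on (cball (midline \<beta> x) (\<beta> / 4)) f"
      using holomorphic_on_imp_continuous_on[OF HinfD(1)[OF f]] sub[of x] by (rule continuous_on_subset)
    show "cmod (f z) \<le> Hinf_norm \<beta> f" if "cmod (midline \<beta> x - z) = \<beta> / 4" for z
      using that sub[of x] by (intro Hinf_norm_bound[OF f]) (auto simp: dist_norm)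
  qed (use b in auto)
  then have d: "cmod (deriv f (midline \<beta> x)) \<le> 4 / \<beta> * Hinf_norm \<beta> f" for x by (simp add: mult.commute)
  have seg: "z \<in> range (midline \<beta>)" if zs: "z \<in> closed_segment (midline \<beta> x) (midline \<beta> y)" for z
  proof -
    obtain u where u: "z = (1 - u) *\<^sub>R midline \<beta> x + u *\<^sub>R midline \<beta> y" using zs unfolding closed_segment_def by auto
    have "z = midline \<beta> (Re z)" unfolding u by (simp add: complex_eq_iff algebra_simps)
    then show ?thesis by (rule range_eqI)
  qed
  have "cmod (f (midline \<beta> x) - f (midline \<beta> y)) \<le> 4 / \<beta> * Hinf_norm \<beta> f * cmod (midline \<beta> x - midline \<beta> y)"
  proof (rule field_differentiable_bound[OF convex_closed_segment])
    fix z assume "z \<in> closed_segment (midline \<beta> x) (midline \<beta> y)"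
    from seg[OF this] obtain t where z: "z = midline \<beta> t" by (rule rangeE)
    show "(f has_field_derivative deriv f z) (at z within closed_segment (midline \<beta> x) (midline \<beta> y))"
      unfolding z
      by (rule holomorphic_derivI[OF HinfD(1)[OF f] open_strip midline_in_strip[OF b]])
    show "cmod (deriv f z) \<le> 4 / \<beta> * Hinf_norm \<beta> f" unfolding z by (rule d)
  qed auto
  also have "midline \<beta> x - midline \<beta> y = of_real (x - y)" by (simp add: midline_def)
  finally show ?thesis by (simp del: of_real_diff)
qed

lemma integrable_Hinf_midline:
  assumes b: "\<beta> > 0" and \<mu>: "real_distribution \<mu>" and f: "f \<in> Hinf \<beta>"
  shows "integrable \<mu> (\<lambda>x. f (midline \<beta> x))"
proof -
  interpret \<mu>: real_distribution \<mu> by fact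
  show ?thesis
    by (rule \<mu>.integrable_const_bound[of _ "Hinf_norm \<beta> f"])
       (use borel_measurable_continuous_onI[OF continuous_on_Hinf_midline[OF f]]
         Hinf_norm_bound[OF f midline_in_strip[OF b]] in auto)
qed

lemma is_linear_on_midline_functional:
  assumes b: "\<beta> > 0" and \<mu>: "real_distribution \<mu>"
  shows "is_linear_on (Hinf \<beta>) (midline_functional \<beta> \<mu>)"
  unfolding is_linear_on_def midline_functional_eq using integrable_Hinf_midline[OF assms] by simp

text \<open>
  Replacing \<open>\<mu>\<close> by its image under a simple function \<open>r n\<close> gives a combination of point
  evaluations. By the Lipschitz estimate the error is, per unit norm of \<open>f\<close>, at most the
  integral of \<open>min 2 (4 / \<beta> * \<bar>x - r n x\<bar>)\<close>, which tends to \<open>0\<close> independently of \<open>f\<close>.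
\<close>

lemma midline_functional_in_predual:
  assumes b: "\<beta> > 0" and \<mu>: "real_distribution \<mu>"
  shows "\<exists>\<phi>\<in>Hinf_predual \<beta>. \<forall>f\<in>Hinf \<beta>. midline_functional \<beta> \<mu> f = \<phi> f"
proof -
  interpret \<mu>: real_distribution \<mu> by fact
  define \<phi> where "\<phi> f = (if f \<in> Hinf \<beta> then midline_functional \<beta> \<mu> f else 0)" for f
  obtain r where r: "\<And>n. simple_function \<mu> (r n)" and lim: "\<And>x. (\<lambda>n. r n x) \<longlonglongrightarrow> x"
    using simple_approximation_of_identity[OF \<mu>] by blast
  have [measurable]: "r n \<in> borel_measurable borel" for n
    using borel_measurable_simple_function[OF r] by simp
  define E where "E n x = min 2 (4 / \<beta> * \<bar>x - r n x\<bar>)" for n x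
  have [measurable]: "E n \<in> borel_measurable borel" for n unfolding E_def by measurable
  have EB: "0 \<le> E n x" "E n x \<le> 2" for n x using b by (auto simp: E_def)
  have intE: "integrable \<mu> (E n)" for n
    by (rule \<mu>.integrable_const_bound[of _ 2]) (use EB in auto)
  have "(\<lambda>n. \<integral>x. E n x \<partial>\<mu>) \<longlonglongrightarrow> (\<integral>x. 0 \<partial>\<mu>)"
  proof (rule integral_dominated_convergence[where w = "\<lambda>_. 2"])
    have "(\<lambda>n. E n x) \<longlonglongrightarrow> 0" for x
    proof -
      have "(\<lambda>n. E n x) \<longlonglongrightarrow> min 2 (4 / \<beta> * \<bar>x - x\<bar>)" unfolding E_def by (intro tendsto_intros lim)
      then show ?thesis by simp
    qed
    then show "AE x in \<mu>. (\<lambda>n. E n x) \<longlonglongrightarrow> 0" by simp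
  qed (use EB in auto)
  then have E0: "(\<lambda>n. \<integral>x. E n x \<partial>\<mu>) \<longlonglongrightarrow> 0" by simp
  have "\<phi> \<in> Hinf_predual \<beta>"
  proof (rule in_predualI[OF b])
    show "is_linear_on (Hinf \<beta>) \<phi>"
      using is_linear_on_midline_functional[OF assms] is_subspaceD[OF is_subspace_Hinf]
      unfolding is_linear_on_def \<phi>_def by simp
    show "\<phi> f = 0" if "f \<notin> Hinf \<beta>" for f using that by (simp add: \<phi>_def)
    fix \<epsilon> :: real assume e: "\<epsilon> > 0"
    have "eventually (\<lambda>n. (\<integral>x. E n x \<partial>\<mu>) < \<epsilon>) sequentially" by (rule order_tendstoD(2)[OF E0 e])
    then obtain n where n: "(\<integral>x. E n x \<partial>\<mu>) < \<epsilon>" by (auto simp: eventually_sequentially)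
    define T where "T = midline \<beta> ` range (r n)"
    define c where "c z = complex_of_real (measure \<mu> (r n -` {Re z}))" for z
    have "cmod (\<phi> f - (\<Sum>z\<in>T. c z * f z)) \<le> \<epsilon> * Hinf_norm \<beta> f" if f: "f \<in> Hinf \<beta>" for f
    proof -
      have inj: "inj_on (midline \<beta>) (range (r n))" by (rule inj_on_inverseI[of _ Re]) simp
      have "(\<integral>x. f (midline \<beta> (r n x)) \<partial>\<mu>) = (\<Sum>z\<in>T. c z * f z)"
        unfolding T_def c_def sum.reindex[OF inj]
        using integral_comp_simple_function[OF \<mu> r[of n], of "\<lambda>x. f (midline \<beta> x)"] by simp
      then have "\<phi> f - (\<Sum>z\<in>T. c z * f z) = (\<integral>x. f (midline \<beta> x) \<partial>\<mu>) - (\<integral>x. f (midline \<beta> (r n x)) \<partial>\<mu>)"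
        using f by (simp add: \<phi>_def midline_functional_eq)
      also have "\<dots> = (\<integral>x. f (midline \<beta> x) - f (midline \<beta> (r n x)) \<partial>\<mu>)"
      proof (rule Bochner_Integration.integral_diff[symmetric])
        have [measurable]: "(\<lambda>x. f (midline \<beta> x)) \<in> borel_measurable borel"
          by (rule borel_measurable_continuous_onI[OF continuous_on_Hinf_midline[OF f]])
        have "(\<lambda>x. f (midline \<beta> (r n x))) \<in> borel_measurable borel" by measurable
        then show "integrable \<mu> (\<lambda>x. f (midline \<beta> (r n x)))"
          by (intro \<mu>.integrable_const_bound[of _ "Hinf_norm \<beta> f"])
             (use Hinf_norm_bound[OF f midline_in_strip[OF b]] in auto)
      qed (rule integrable_Hinf_midline[OF b \<mu> f])
      finally have "cmod (\<phi> f - (\<Sum>z\<in>T. c z * f z)) \<le> (\<integral>x. cmod (f (midline \<beta> x) - f (midline \<beta> (r n x))) \<partial>\<mu>)"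
        by (simp only: integral_norm_bound)
      also have "\<dots> \<le> (\<integral>x. E n x * Hinf_norm \<beta> f \<partial>\<mu>)"
      proof (rule integral_mono')
        show "integrable \<mu> (\<lambda>x. E n x * Hinf_norm \<beta> f)" using intE by simp
        fix x
        have "cmod (f (midline \<beta> x) - f (midline \<beta> (r n x))) \<le> 2 * Hinf_norm \<beta> f"
          using norm_triangle_ineq4[of "f (midline \<beta> x)" "f (midline \<beta> (r n x))"]
            Hinf_norm_bound[OF f midline_in_strip[OF b, of x]] Hinf_norm_bound[OF f midline_in_strip[OF b, of "r n x"]] by linarith
        then show "cmod (f (midline \<beta> x) - f (midline \<beta> (r n x))) \<le> E n x * Hinf_norm \<beta> f"
          using Hinf_midline_Lipschitz[OF b f, of x "r n x"] by (simp add: E_def min_def mult.commute mult.left_commute)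
      qed (use EB Hinf_norm_nonneg[OF b f] in auto)
      also have "\<dots> \<le> \<epsilon> * Hinf_norm \<beta> f"
        using n Hinf_norm_nonneg[OF b f] intE by (auto intro: mult_right_mono)
      finally show ?thesis .
    qed
    moreover have "finite T" using r[of n] unfolding T_def simple_function_def by simp
    moreover have "T \<subseteq> strip \<beta>" using midline_in_strip[OF b] by (auto simp: T_def)
    ultimately show "\<exists>T c. finite T \<and> T \<subseteq> strip \<beta> \<and>
      (\<forall>f\<in>Hinf \<beta>. cmod (\<phi> f - (\<Sum>z\<in>T. c z * f z)) \<le> \<epsilon> * Hinf_norm \<beta> f)" by blast
  qed
  then show ?thesis by (intro bexI[of _ \<phi>]) (auto simp: \<phi>_def)
qed

section \<open>The group of exponentials and the states\<close>

lemma Hinf_mult_g: "Hinf_mult (Hinf_g \<beta> t) (Hinf_g \<beta> s) = Hinf_g \<beta> (t + s)"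
  by (auto simp: Hinf_mult_def Hinf_g_def fun_eq_iff add_divide_distrib exp_add distrib_left distrib_right mult_ac)

lemma Hinf_g_zero: "Hinf_g \<beta> 0 = Hinf_one \<beta>"
  by (auto simp: Hinf_g_def Hinf_one_def)

lemma Hinf_star_g: "Hinf_star \<beta> (Hinf_g \<beta> t) = Hinf_g \<beta> (- t)"
proof
  fix z
  show "Hinf_star \<beta> (Hinf_g \<beta> t) z = Hinf_g \<beta> (- t) z"
  proof (cases "z \<in> strip \<beta>")
    case True
    then have "strip_refl \<beta> z \<in> strip \<beta>" by (simp add: strip_def strip_refl_def)
    then have "Hinf_star \<beta> (Hinf_g \<beta> t) z = exp (cnj (of_real (t * \<beta> / 2) + \<i> * of_real t * strip_refl \<beta> z))"
      by (simp add: Hinf_star_def Hinf_g_def exp_cnj exp_add[symmetric] flip: exp_of_real)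
    also have "cnj (of_real (t * \<beta> / 2) + \<i> * of_real t * strip_refl \<beta> z) = of_real (- t * \<beta> / 2) + \<i> * of_real (- t) * z"
      by (simp add: strip_refl_def complex_eq_iff algebra_simps)
    also have "exp \<dots> = Hinf_g \<beta> (- t) z"
      using True by (simp add: Hinf_g_def exp_add[symmetric] flip: exp_of_real)
    finally show ?thesis .
  next
    case False
    then have "strip_refl \<beta> z \<notin> strip \<beta>" by (auto simp: strip_def strip_refl_def)
    then show ?thesis using False by (simp add: Hinf_star_def Hinf_g_def)
  qed
qed

text \<open>
  The supremum of \<open>exp (t (\<beta> / 2 - y))\<close> is approached at one of the two boundary lines, which
  one depending on the sign of \<open>t\<close>.
\<close>

lemma Hinf_norm_g:
  assumes b: "\<beta> > 0"
  shows "Hinf_norm \<beta> (Hinf_g \<beta> t) = exp (\<bar>t\<bar> * \<beta> / 2)"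
proof (rule antisym)
  show "Hinf_norm \<beta> (Hinf_g \<beta> t) \<le> exp (\<bar>t\<bar> * \<beta> / 2)" by (rule Hinf_norm_le[OF b Hinf_g_bound])
  have le: "exp (\<bar>t\<bar> * (\<beta> / 2 - y)) \<le> Hinf_norm \<beta> (Hinf_g \<beta> t)" if y: "0 < y" "y < \<beta>" for y
  proof -
    define z where "z = \<i> * of_real (if t \<ge> 0 then y else \<beta> - y)"
    have z: "z \<in> strip \<beta>" using y by (simp add: z_def strip_def)
    have "t * (\<beta> / 2 - Im z) = \<bar>t\<bar> * (\<beta> / 2 - y)" by (simp add: z_def algebra_simps)
    then show ?thesis using Hinf_norm_bound[OF Hinf_g_in_Hinf z, of t] cmod_Hinf_g[OF z, of t] by simp
  qed
  have "((\<lambda>y. exp (\<bar>t\<bar> * (\<beta> / 2 - y))) \<longlongrightarrow> exp (\<bar>t\<bar> * (\<beta> / 2 - 0))) (at_right 0)"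
    by (intro tendsto_intros)
  moreover have "eventually (\<lambda>y. exp (\<bar>t\<bar> * (\<beta> / 2 - y)) \<le> Hinf_norm \<beta> (Hinf_g \<beta> t)) (at_right 0)"
    using b le unfolding eventually_at_right_field by blast
  ultimately have "exp (\<bar>t\<bar> * (\<beta> / 2 - 0)) \<le> Hinf_norm \<beta> (Hinf_g \<beta> t)"
    by (rule tendsto_upperbound) simp
  then show "exp (\<bar>t\<bar> * \<beta> / 2) \<le> Hinf_norm \<beta> (Hinf_g \<beta> t)" by simp
qed

lemma star_subalgebra_span_g: "Hinf_star_subalgebra \<beta> (cspan (range (Hinf_g \<beta>)))"
proof -
  let ?A = "cspan (range (Hinf_g \<beta>))"
  note A = is_subspaceD[OF is_subspace_cspan[of "range (Hinf_g \<beta>)"]]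
  have g: "Hinf_g \<beta> t \<in> ?A" for t by (intro cspan_base) simp
  have star: "?A \<subseteq> {f. Hinf_star \<beta> f \<in> ?A}"
  proof (rule cspan_subset)
    show "is_subspace {f. Hinf_star \<beta> f \<in> ?A}" using A unfolding is_subspace_def Hinf_star_def by simp
    show "range (Hinf_g \<beta>) \<subseteq> {f. Hinf_star \<beta> f \<in> ?A}" using g by (auto simp: Hinf_star_g)
  qed
  have mult1: "?A \<subseteq> {f. Hinf_mult f (Hinf_g \<beta> t) \<in> ?A}" for t
  proof (rule cspan_subset)
    show "is_subspace {f. Hinf_mult f (Hinf_g \<beta> t) \<in> ?A}"
      using A unfolding is_subspace_def Hinf_mult_def by (simp add: distrib_right mult.assoc)
    show "range (Hinf_g \<beta>) \<subseteq> {f. Hinf_mult f (Hinf_g \<beta> t) \<in> ?A}" using g by (auto simp: Hinf_mult_g)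
  qed
  have mult: "?A \<subseteq> {h. Hinf_mult f h \<in> ?A}" if "f \<in> ?A" for f
  proof (rule cspan_subset)
    show "is_subspace {h. Hinf_mult f h \<in> ?A}"
      using A unfolding is_subspace_def Hinf_mult_def by (simp add: distrib_left mult.left_commute)
    show "range (Hinf_g \<beta>) \<subseteq> {h. Hinf_mult f h \<in> ?A}" using mult1 that by auto
  qed
  have "?A \<subseteq> Hinf \<beta>" using Hinf_g_in_Hinf by (intro cspan_subset is_subspace_Hinf) auto
  then show ?thesis
    unfolding Hinf_star_subalgebra_def using is_subspace_cspan[of "range (Hinf_g \<beta>)"] mult star by auto
qed

lemma weakly_dense_span_g:
  assumes b: "\<beta> > 0"
  shows "Hinf_weak \<beta> closure_of cspan (range (Hinf_g \<beta>)) = Hinf \<beta>"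
  unfolding Hinf_weak_def
proof (rule weakly_dense_if_annihilator_trivial)
  show "cspan (range (Hinf_g \<beta>)) \<subseteq> Hinf \<beta>" using star_subalgebra_span_g unfolding Hinf_star_subalgebra_def by blast
  fix \<phi> f
  assume p: "\<phi> \<in> Hinf_predual \<beta>" and f: "f \<in> Hinf \<beta>"
    and zero: "\<And>h. h \<in> cspan (range (Hinf_g \<beta>)) \<Longrightarrow> \<phi> h = 0"
  show "\<phi> f = 0" by (rule predual_zero_if_kills_exponentials[OF b p zero f]) (simp add: cspan_base)
qed (use is_subspace_Hinf is_subspace_cspan predual_subspace[OF b] predual_linear[OF b] in auto)

lemma strip_refl_fixed_points: "{z. strip_refl \<beta> z = z} = range (midline \<beta>)"
proof (intro equalityI subsetI)
  fix z assume "z \<in> {z. strip_refl \<beta> z = z}"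
  then have "\<beta> - Im z = Im z" by (simp add: strip_refl_def complex_eq_iff)
  then have "z = midline \<beta> (Re z)" by (simp add: complex_eq_iff)
  then show "z \<in> range (midline \<beta>)" by (rule range_eqI)
qed (auto simp: strip_refl_def complex_eq_iff)

lemma midline_functional_g: "\<beta> > 0 \<Longrightarrow> midline_functional \<beta> \<mu> (Hinf_g \<beta> t) = char \<mu> t"
  unfolding midline_functional_eq char_def by (simp only: Hinf_g_midline)

text \<open>
  On its fixed line the reflection does nothing, so \<open>f\<^sup>\<sharp> f\<close> is \<open>\<bar>f\<bar>\<^sup>2\<close> there.
\<close>

lemma state_midline_functional:
  assumes b: "\<beta> > 0" and \<mu>: "real_distribution \<mu>"
  shows "Hinf_state \<beta> (midline_functional \<beta> \<mu>)"
  unfolding Hinf_state_def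
proof (intro conjI ballI is_linear_on_midline_functional[OF assms])
  interpret \<mu>: real_distribution \<mu> by fact
  show "midline_functional \<beta> \<mu> (Hinf_one \<beta>) = 1"
    using midline_functional_g[OF b, of \<mu> 0] \<mu>.char_zero by (simp add: Hinf_g_zero)
  fix f assume "f \<in> Hinf \<beta>"
  have refl: "strip_refl \<beta> (midline \<beta> x) = midline \<beta> x" for x using strip_refl_fixed_points[of \<beta>] by auto
  have "midline_functional \<beta> \<mu> (Hinf_mult (Hinf_star \<beta> f) f) = (\<integral>x. complex_of_real ((cmod (f (midline \<beta> x)))\<^sup>2) \<partial>\<mu>)"
    unfolding midline_functional_eq Hinf_mult_def Hinf_star_def refl
    by (simp add: complex_norm_square mult.commute del: of_real_power)
  also have "\<dots> = complex_of_real (\<integral>x. (cmod (f (midline \<beta> x)))\<^sup>2 \<partial>\<mu>)" by (rule integral_complex_of_real)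
  also have "\<dots> \<in> \<real>\<^sub>\<ge>\<^sub>0" by (simp add: complex_nonneg_Reals_iff integral_nonneg_AE)
  finally show "midline_functional \<beta> \<mu> (Hinf_mult (Hinf_star \<beta> f) f) \<in> \<real>\<^sub>\<ge>\<^sub>0" .
qed

text \<open>
  Positivity of the state at \<open>f\<^sup>\<sharp> f\<close> for \<open>f = (\<Sum>j<n. c j * Hinf_g \<beta> (t j))\<close>, multiplied out
  with the group law.
\<close>

lemma state_positive_definite:
  assumes "Hinf_state \<beta> \<omega>"
  shows "positive_definite (\<lambda>t. \<omega> (Hinf_g \<beta> t))"
  unfolding positive_definite_def
proof (intro allI)
  fix n :: nat and t :: "nat \<Rightarrow> real" and c :: "nat \<Rightarrow> complex"
  have lin: "is_linear_on (Hinf \<beta>) \<omega>" using assms unfolding Hinf_state_def by blast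
  define f where "f = (\<lambda>z. \<Sum>j<n. c j * Hinf_g \<beta> (t j) z)"
  define h where "h j = (\<lambda>z. \<Sum>k<n. cnj (c k) * Hinf_g \<beta> (t j - t k) z)" for j
  have f: "f \<in> Hinf \<beta>" unfolding f_def by (intro is_subspace_indexed_sum is_subspace_Hinf Hinf_g_in_Hinf)
  have h: "h j \<in> Hinf \<beta>" for j unfolding h_def by (intro is_subspace_indexed_sum is_subspace_Hinf Hinf_g_in_Hinf)
  have "Hinf_mult (Hinf_star \<beta> f) f = (\<lambda>z. \<Sum>j<n. c j * h j z)"
  proof
    fix z
    have st: "cnj (Hinf_g \<beta> s (strip_refl \<beta> z)) = Hinf_g \<beta> (- s) z" for s
      using fun_cong[OF Hinf_star_g[of \<beta> s], of z] by (simp add: Hinf_star_def)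
    have "Hinf_mult (Hinf_star \<beta> f) f z = (\<Sum>j<n. c j * Hinf_g \<beta> (t j) z) * (\<Sum>k<n. cnj (c k) * Hinf_g \<beta> (- t k) z)"
      by (simp add: Hinf_mult_def Hinf_star_def f_def st mult.commute)
    also have "\<dots> = (\<Sum>j<n. \<Sum>k<n. c j * (cnj (c k) * (Hinf_g \<beta> (t j) z * Hinf_g \<beta> (- t k) z)))"
      by (simp add: sum_product mult_ac)
    also have "\<dots> = (\<Sum>j<n. c j * h j z)"
    proof -
      have "Hinf_g \<beta> (t j) z * Hinf_g \<beta> (- t k) z = Hinf_g \<beta> (t j - t k) z" for j k
        using fun_cong[OF Hinf_mult_g[of \<beta> "t j" "- t k"], of z] by (simp add: Hinf_mult_def)
      then show ?thesis by (simp add: h_def sum_distrib_left)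
    qed
    finally show "Hinf_mult (Hinf_star \<beta> f) f z = (\<Sum>j<n. c j * h j z)" .
  qed
  then have "\<omega> (Hinf_mult (Hinf_star \<beta> f) f) = (\<Sum>j<n. c j * \<omega> (h j))"
    using is_linear_on_indexed_sum[where f = h and I = "{..<n}" and c = c, OF is_subspace_Hinf lin h] by simp
  also have "\<dots> = (\<Sum>j<n. c j * (\<Sum>k<n. cnj (c k) * \<omega> (Hinf_g \<beta> (t j - t k))))"
    unfolding h_def by (subst is_linear_on_indexed_sum[OF is_subspace_Hinf lin Hinf_g_in_Hinf]) simp
  also have "\<dots> = (\<Sum>j<n. \<Sum>k<n. c j * cnj (c k) * \<omega> (Hinf_g \<beta> (t j - t k)))"
    by (simp add: sum_distrib_left mult.assoc)
  finally have eq: "\<omega> (Hinf_mult (Hinf_star \<beta> f) f) = (\<Sum>j<n. \<Sum>k<n. c j * cnj (c k) * \<omega> (Hinf_g \<beta> (t j - t k)))" .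
  have "\<omega> (Hinf_mult (Hinf_star \<beta> f) f) \<in> \<real>\<^sub>\<ge>\<^sub>0" using assms f unfolding Hinf_state_def by blast
  then show "(\<Sum>j<n. \<Sum>k<n. c j * cnj (c k) * \<omega> (Hinf_g \<beta> (t j - t k))) \<in> \<real>\<^sub>\<ge>\<^sub>0" unfolding eq .
qed

lemma predual_continuous_along_g:
  assumes b: "\<beta> > 0" and p: "\<phi> \<in> Hinf_predual \<beta>"
  shows "continuous_on UNIV (\<lambda>t. \<phi> (Hinf_g \<beta> t))"
proof -
  have "(\<lambda>n. \<phi> (Hinf_g \<beta> (s n))) \<longlonglongrightarrow> \<phi> (Hinf_g \<beta> t)" if s: "s \<longlonglongrightarrow> t" for s t
  proof -
    obtain K where K: "\<And>n. \<bar>s n\<bar> \<le> K"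
      using convergent_imp_Bseq[OF convergentI[OF s]] unfolding Bseq_def by auto
    show ?thesis
    proof (rule predual_bounded_pointwise_limit[OF b p Hinf_g_in_Hinf _ Hinf_g_in_Hinf])
      show "Hinf_norm \<beta> (Hinf_g \<beta> (s n)) \<le> exp (K * \<beta> / 2)" for n
        unfolding Hinf_norm_g[OF b] using K[of n] b by simp
      show "(\<lambda>n. Hinf_g \<beta> (s n) z) \<longlonglongrightarrow> Hinf_g \<beta> t z" if "z \<in> strip \<beta>" for z
        using that unfolding Hinf_g_def by (simp, intro tendsto_intros s) simp
    qed
  qed
  then show ?thesis
    unfolding continuous_on_sequentially by (auto simp: o_def)
qed

text \<open>
  Bochner's theorem yields a measure whose functional agrees with \<open>\<omega>\<close> on the exponentials. Both
  functionals come from the predual, so they agree everywhere.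
\<close>

theorem weakly_continuous_state_is_midline_functional:
  assumes b: "\<beta> > 0" and st: "Hinf_state \<beta> \<omega>" and cont: "continuous_map (Hinf_weak \<beta>) euclidean \<omega>"
  shows "\<exists>\<mu>. real_distribution \<mu> \<and> (\<forall>f\<in>Hinf \<beta>. \<omega> f = midline_functional \<beta> \<mu> f)"
proof -
  have lin: "is_linear_on (Hinf \<beta>) \<omega>" and one: "\<omega> (Hinf_one \<beta>) = 1"
    using st unfolding Hinf_state_def by auto
  obtain \<phi> where p: "\<phi> \<in> Hinf_predual \<beta>" "\<And>f. f \<in> Hinf \<beta> \<Longrightarrow> \<omega> f = \<phi> f"
    using weakly_continuous_linear_in_span[OF is_subspace_Hinf predual_subspace[OF b] predual_linear[OF b] lin]
      cont unfolding Hinf_weak_def by blast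
  have "continuous_on UNIV (\<lambda>t. \<omega> (Hinf_g \<beta> t))"
    using predual_continuous_along_g[OF b p(1)] p(2)[OF Hinf_g_in_Hinf] by simp
  then obtain \<mu> where \<mu>: "real_distribution \<mu>" "char \<mu> = (\<lambda>t. \<omega> (Hinf_g \<beta> t))"
    using Bochner[OF state_positive_definite[OF st]] one by (auto simp: Hinf_g_zero)
  obtain \<psi> where q: "\<psi> \<in> Hinf_predual \<beta>" "\<And>f. f \<in> Hinf \<beta> \<Longrightarrow> midline_functional \<beta> \<mu> f = \<psi> f"
    using midline_functional_in_predual[OF b \<mu>(1)] by blast
  have "\<phi> (Hinf_g \<beta> t) - \<psi> (Hinf_g \<beta> t) = 0" for t
    using p(2)[OF Hinf_g_in_Hinf] q(2)[OF Hinf_g_in_Hinf] midline_functional_g[OF b, of \<mu> t] \<mu>(2) by simp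
  from predual_zero_if_kills_exponentials[OF b is_subspace_diff[OF predual_subspace[OF b] p(1) q(1)] this]
  have "\<omega> f = midline_functional \<beta> \<mu> f" if "f \<in> Hinf \<beta>" for f
    using p(2)[OF that] q(2)[OF that] that by auto
  then show ?thesis using \<mu>(1) by blast
qed

theorem proposition5p1:
  fixes \<beta> :: real
  assumes "\<beta> > 0"
  shows
    "(\<forall>t. Hinf_g \<beta> t \<in> Hinf \<beta>) \<and>
     (\<forall>t s. Hinf_mult (Hinf_g \<beta> t) (Hinf_g \<beta> s) = Hinf_g \<beta> (t + s)) \<and>
     (\<forall>t. Hinf_star \<beta> (Hinf_g \<beta> t) = Hinf_g \<beta> (- t) \<and>
          Hinf_mult (Hinf_g \<beta> t) (Hinf_g \<beta> (- t)) = Hinf_one \<beta> \<and>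
          Hinf_mult (Hinf_g \<beta> (- t)) (Hinf_g \<beta> t) = Hinf_one \<beta>) \<and>
     Hinf_star_subalgebra \<beta> (cspan (range (Hinf_g \<beta>))) \<and>
     Hinf_weak \<beta> closure_of cspan (range (Hinf_g \<beta>)) = Hinf \<beta> \<and>
     (\<forall>t. Hinf_norm \<beta> (Hinf_g \<beta> t) = exp (\<bar>t\<bar> * \<beta> / 2)) \<and>
     {z. strip_refl \<beta> z = z} = range (\<lambda>x::real. of_real \<beta> * \<i> / 2 + of_real x) \<and>
     (\<forall>\<omega>. Hinf_state \<beta> \<omega> \<and> continuous_map (Hinf_weak \<beta>) euclidean \<omega> \<longrightarrow>
        (\<exists>\<mu>. real_distribution \<mu> \<and>
             (\<forall>F\<in>Hinf \<beta>. \<omega> F = midline_functional \<beta> \<mu> F) \<and>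
             (\<forall>t. midline_functional \<beta> \<mu> (Hinf_g \<beta> t) = char \<mu> t))) \<and>
     (\<forall>\<phi>. continuous_on UNIV \<phi> \<and> positive_definite \<phi> \<and> \<phi> 0 = 1 \<longrightarrow>
        (\<exists>\<mu>. real_distribution \<mu> \<and>
             Hinf_state \<beta> (midline_functional \<beta> \<mu>) \<and>
             continuous_map (Hinf_weak \<beta>) euclidean (midline_functional \<beta> \<mu>) \<and>
             (\<forall>t. \<phi> t = midline_functional \<beta> \<mu> (Hinf_g \<beta> t) \<and>
                  midline_functional \<beta> \<mu> (Hinf_g \<beta> t) = char \<mu> t)))"
proof (intro conjI allI impI; (elim conjE)?)
  show "{z. strip_refl \<beta> z = z} = range (\<lambda>x::real. of_real \<beta> * \<i> / 2 + of_real x)"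
    using strip_refl_fixed_points[of \<beta>] by (simp add: midline_def)
next
  fix \<omega> assume "Hinf_state \<beta> \<omega>" "continuous_map (Hinf_weak \<beta>) euclidean \<omega>"
  from weakly_continuous_state_is_midline_functional[OF assms this]
  show "\<exists>\<mu>. real_distribution \<mu> \<and> (\<forall>F\<in>Hinf \<beta>. \<omega> F = midline_functional \<beta> \<mu> F) \<and>
      (\<forall>t. midline_functional \<beta> \<mu> (Hinf_g \<beta> t) = char \<mu> t)"
    using midline_functional_g[OF assms] by blast
next
  fix \<phi> :: "real \<Rightarrow> complex" assume \<phi>: "continuous_on UNIV \<phi>" "positive_definite \<phi>" "\<phi> 0 = 1"
  obtain \<mu> where \<mu>: "real_distribution \<mu>" "char \<mu> = \<phi>" using Bochner[OF \<phi>(2,3,1)] by blast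
  have "continuous_map (Hinf_weak \<beta>) euclidean (midline_functional \<beta> \<mu>)"
    using midline_functional_in_predual[OF assms \<mu>(1)] continuous_map_weak_topology unfolding Hinf_weak_def by blast
  then show "\<exists>\<mu>. real_distribution \<mu> \<and> Hinf_state \<beta> (midline_functional \<beta> \<mu>) \<and>
      continuous_map (Hinf_weak \<beta>) euclidean (midline_functional \<beta> \<mu>) \<and>
      (\<forall>t. \<phi> t = midline_functional \<beta> \<mu> (Hinf_g \<beta> t) \<and> midline_functional \<beta> \<mu> (Hinf_g \<beta> t) = char \<mu> t)"
    using \<mu> state_midline_functional[OF assms \<mu>(1)] midline_functional_g[OF assms] by (intro exI[of _ \<mu>]) simp
qed (simp_all add: Hinf_g_in_Hinf Hinf_mult_g Hinf_star_g Hinf_g_zero star_subalgebra_span_g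
      weakly_dense_span_g[OF assms] Hinf_norm_g[OF assms])

end
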